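(* Consider a three-dimensional periodic insulating system satisfying the standing assumptions of the context. Assume that $t=\mathcal F_{\rm TDL}(t)$ has a unique solution $t_*$, that for all sufficiently large $N_{\mathbf k}$ the equation $T=\mathcal F_{N_{\mathbf k}}(T)$ has a unique solution $T_*^{N_{\mathbf k}}$, and that the fixed point iterations converge: $\lim_{n\to\infty}\|T_n^{N_{\mathbf k}}-T_*^{N_{\mathbf k}}\|_\infty=0$ and $\lim_{n\to\infty}\|t_n-t_*\|_\infty=0$. Assume further that there is a constant $L<1$ (independent of $N_{\mathbf k}$) such that: (i) there is a domain $\mathbb B_{\rm TDL}\subset\mathbb T(\Omega^* )^{n_{\rm occ}\times n_{\rm occ}\times n_{\rm vir}\times n_{\rm vir}}$ containing $t_*$ and $\mathbf 0$ with $\mathcal F_{\rm TDL}(t)\in\mathbb B_{\rm TDL}$ for all $t\in\mathbb B_{\rm TDL}$ and $\|\mathcal F_{\rm TDL}(t)-\mathcal F_{\rm TDL}(s)\|_\infty\le L\|t-s\|_\infty$ for all $t,s\in\mathbb B_{\rm TDL}$; (ii) for all sufficiently large $N_{\mathbf k}$ there is a domain $\mathbb B_{N_{\mathbf k}}\subset\mathbb C^{n_{\rm occ}\times n_{\rm occ}\times n_{\rm vir}\times n_{\rm vir}\times N_{\mathbf k}\times N_{\mathbf k}\times N_{\mathbf k}}$ containing $T_*^{N_{\mathbf k}}$ and $\mathbf 0$ with $\mathcal F_{N_{\mathbf k}}(T)\in\mathbb B_{N_{\mathbf k}}$ for all $T\in\mathbb B_{N_{\mathbf k}}$ and $\|\mathcal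 F_{N_{\mathbf k}}(T)-\mathcal F_{N_{\mathbf k}}(S)\|_\infty\le L\|T-S\|_\infty$ for all $T,S\in\mathbb B_{N_{\mathbf k}}$; (iii) for all sufficiently large $N_{\mathbf k}$, $\{\mathcal M_{\mathcal K}t: t\in\mathbb B_{\rm TDL}\}\subset\mathbb B_{N_{\mathbf k}}$; (iv) there is a constant $C$ (independent of $n$ and $N_{\mathbf k}$) such that $\|\mathcal M_{\mathcal K}\mathcal F_{\rm TDL}(t_n)-\mathcal F_{N_{\mathbf k}}(\mathcal M_{\mathcal K}t_n)\|_\infty\le CN_{\mathbf k}^{-1/3}$ for all $n>0$. Then the finite-size error in the CCD energy calculation satisfies, as $N_{\mathbf k}\to\infty$, $$\left|E^{\rm TDL}_{\rm CCD}-E^{N_{\mathbf k}}_{\rm CCD}\right|=\mathcal O(N_{\mathbf k}^{-1/3}),\qquad\text{where }E^{\rm TDL}_{\rm CCD}=\mathcal G_{\rm TDL}(t_* ),\quad E^{N_{\mathbf k}}_{\rm CCD}=\mathcal G_{N_{\mathbf k}}(T_*^{N_{\mathbf k}}).$$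
   Context: **Setting.** $\Omega\subset\mathbb R^3$ is a unit cell with Bravais lattice $\mathbb L$; $\mathbb L^*$ is the reciprocal lattice and $\Omega^*$ the Brillouin zone (a unit cell of $\mathbb L^*$). $\mathcal K\subset\Omega^*$ is a uniform (Monkhorst-Pack) mesh of size $N_{\mathbf k}^{1/3}\times N_{\mathbf k}^{1/3}\times N_{\mathbf k}^{1/3}$. Orbitals are $\psi_{n\mathbf k}(\mathbf r)=N_{\mathbf k}^{-1/2}e^{\mathrm i\mathbf k\cdot\mathbf r}u_{n\mathbf k}(\mathbf r)$, where $u_{n\mathbf k}$ is periodic with respect to $\Omega$ and, for each $\mathbf k$, the $u_{n\mathbf k}$ are orthonormal in $L^2(\Omega)$; orbital energies are $\varepsilon_{n\mathbf k}$. Band indices $i,j,k,l$ run over $n_{\rm occ}$ occupied bands and $a,b,c,d$ over $n_{\rm vir}$ virtual bands, both finite. Standing assumptions: there is a direct gap between occupied and virtual bands; orbitals and orbital energies are known exactly at every $\mathbf k$ (independently of $N_{\mathbf k}$ apart from the normalization factor); and, in a suitable gauge, $\psi_{n\mathbf k}(\mathbf r)$ and $\varepsilon_{n\mathbf k}$ are smooth and $\mathbb L^*$-periodic in $\mathbf k$. **Electron repulsion integrals (ERIs).** For $\mathbf k_1+\mathbf k_2-\mathbf k_3-\mathbf k_4\in\mathbb L^*$ and $\mathbf q=\mathbf k_3-\mathbf k_1$, $$\langle n_1\mathbf k_1,n_2\mathbf k_2|n_3\mathbf k_3,n_4\mathbf k_4\rangle=\frac{4\pi}{|\Omega|}\sum_{\mathbf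 G\in\mathbb L^*}{}^{'}\frac{1}{|\mathbf q+\mathbf G|^2}\hat\varrho_{n_1\mathbf k_1,n_3(\mathbf k_1+\mathbf q)}(\mathbf G)\,\hat\varrho_{n_2\mathbf k_2,n_4(\mathbf k_2-\mathbf q)}(-\mathbf G),$$ with $\hat\varrho_{n'\mathbf k',n\mathbf k}(\mathbf G)=\langle\psi_{n'\mathbf k'}|e^{\mathrm i(\mathbf k'-\mathbf k-\mathbf G)\cdot\mathbf r}|\psi_{n\mathbf k}\rangle=\int_\Omega\overline{u_{n'\mathbf k'}(\mathbf r)}u_{n\mathbf k}(\mathbf r)e^{-\mathrm i\mathbf G\cdot\mathbf r}\mathrm d\mathbf r$; the prime means the term with $\mathbf q+\mathbf G=\mathbf 0$ is omitted. **Conventions.** A capital letter $P$ denotes the pair $(p,\mathbf k_p)$. Crystal momentum conservation always holds implicitly: $\mathbf k_p+\mathbf k_q-\mathbf k_r-\mathbf k_s\in\mathbb L^*$ in $\langle PQ|RS\rangle$, $\mathbf k_i+\mathbf k_j-\mathbf k_a-\mathbf k_b\in\mathbb L^*$ in $t_{IJ}^{AB}$, $\mathbf k_p+\mathbf k_q-\mathbf k_r-\mathbf k_s\in\mathbb L^*$ in $\chi_{PQ}^{RS}$, and $\mathbf k_p-\mathbf k_q\in\mathbb L^*$ in $\kappa_P^Q$. Amplitudes are written $t_{IJ}^{AB}=T_{ijab}(\mathbf k_i,\mathbf k_j,\mathbf k_a)$ ($\mathbf k_b$ is determined). A sum over capital letters is over the bands and over the momenta in $\mathcal K$ compatible with momentum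 conservation. $\varepsilon_{IJ}^{AB}=\varepsilon_I+\varepsilon_J-\varepsilon_A-\varepsilon_B$ and $\mathcal P(\cdots)_{IJ}^{AB}=(\cdots)_{IJ}^{AB}+(\cdots)_{JI}^{BA}$. $W_{ijab}(\mathbf k_i,\mathbf k_j,\mathbf k_a)=2\langle IJ|AB\rangle-\langle IJ|BA\rangle$. **Finite CCD map.** $\mathcal F_{N_{\mathbf k}}$ maps a tensor $t=\{t_{IJ}^{AB}\}$ (momenta in $\mathcal K$) to the tensor with entries $$\begin{aligned}\frac{1}{\varepsilon_{IJ}^{AB}}\Big\{&\langle AB|IJ\rangle+\mathcal P\Big(\sum_C\kappa_C^At_{IJ}^{CB}-\sum_K\kappa_I^Kt_{KJ}^{AB}\Big)+\frac1{N_{\mathbf k}}\sum_{KL}\chi_{IJ}^{KL}t_{KL}^{AB}+\frac1{N_{\mathbf k}}\sum_{CD}\chi_{CD}^{AB}t_{IJ}^{CD}\\&+\mathcal P\Big(\frac1{N_{\mathbf k}}\sum_{KC}\big[(2\chi_{IC}^{AK}-\chi_{CI}^{AK})t_{KJ}^{CB}-\chi_{IC}^{AK}t_{KJ}^{BC}-\chi_{CJ}^{AK}t_{KI}^{BC}\big]\Big)\Big\},\end{aligned}$$ where $\kappa_C^A=-\frac1{N_{\mathbf k}^2}\sum_{KLD}(2\langle KL|CD\rangle-\langle KL|DC\rangle)t_{KL}^{AD}$, $\kappa_I^K=\frac1{N_{\mathbf k}^2}\sum_{LCD}(2\langle KL|CD\rangle-\langle KL|DC\rangle)t_{IL}^{CD}$,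 $\chi_{IJ}^{KL}=\langle KL|IJ\rangle+\frac1{N_{\mathbf k}}\sum_{CD}\langle KL|CD\rangle t_{IJ}^{CD}$, $\chi_{CD}^{AB}=\langle AB|CD\rangle$, $\chi_{IC}^{AK}=\langle AK|IC\rangle+\frac1{2N_{\mathbf k}}\sum_{LD}\big[(2\langle LK|DC\rangle-\langle LK|CD\rangle)t_{IL}^{AD}-\langle LK|DC\rangle t_{IL}^{DA}\big]$, $\chi_{CI}^{AK}=\langle AK|CI\rangle-\frac1{2N_{\mathbf k}}\sum_{LD}\langle LK|CD\rangle t_{IL}^{DA}$. **TDL CCD map.** $\mathcal F_{\rm TDL}$ maps a family of functions $t_{ijab}(\mathbf k_i,\mathbf k_j,\mathbf k_a)$ on $(\Omega^* )^3$ to such a family by the same formulas, with every average $\frac1{N_{\mathbf k}}\sum_{\mathbf k\in\mathcal K}$ over a free intermediate momentum replaced by $\frac1{|\Omega^*|}\int_{\Omega^*}\mathrm d\mathbf k$ (and $\frac1{N_{\mathbf k}^2}\sum\sum$ by $\frac1{|\Omega^*|^2}\iint$), band sums unchanged. **Iterations.** $T_0^{N_{\mathbf k}}=\mathbf 0$, $T_m^{N_{\mathbf k}}=\mathcal F_{N_{\mathbf k}}(T_{m-1}^{N_{\mathbf k}})$; $t_0=\mathbf 0$, $t_m=\mathcal F_{\rm TDL}(t_{m-1})$. **Function space.** $\mathbb T(\Omega^* )$ is the set of functions $f(\mathbf k_i,\mathbf k_j,\mathbf k_a)$ that are $\mathbb L^*$-periodic in each variable, smooth everywhere except at $\mathbf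 k_a=\mathbf k_i$ (and periodic images) with algebraic singularity of order $0$, and smooth in $\mathbf k_i,\mathbf k_j$ at $\mathbf k_a=\mathbf k_i$. Algebraic singularity of order $\gamma$ at $\mathbf k_a=\mathbf k_i$ means: with $\mathbf k_a=\mathbf k_i+\mathbf q$, for all multi-indices $\alpha,\beta\ge0$ there is $C_{\alpha,\beta}$ with $|\partial_{\mathbf q}^\alpha\partial_{(\mathbf k_i,\mathbf k_j)}^\beta f|\le C_{\alpha,\beta}|\mathbf q|^{\gamma-|\alpha|}$ for all $0<|\mathbf q|<\delta$ (some $\delta>0$) and all $\mathbf k_i,\mathbf k_j\in\Omega^*$. **Norms and functionals.** $\mathcal M_{\mathcal K}t=\{t_{ijab}(\mathbf k_i,\mathbf k_j,\mathbf k_a)\}_{ijab,\,\mathbf k_i,\mathbf k_j,\mathbf k_a\in\mathcal K}$ is evaluation on the mesh. For tensors, $\|T\|_\infty$ is the entrywise max norm; for families of functions, $\|t\|_\infty=\max_{ijab}\|t_{ijab}\|_{L^\infty((\Omega^* )^3)}$. $$\mathcal G_{N_{\mathbf k}}(T)=\frac1{N_{\mathbf k}^3}\sum_{\mathbf k_i,\mathbf k_j,\mathbf k_a\in\mathcal K}\sum_{ijab}W_{ijab}T_{ijab},\qquad \mathcal G_{\rm TDL}(t)=\frac1{|\Omega^*|^3}\int_{(\Omega^* )^3}\sum_{ijab}W_{ijab}t_{ijab}\,\mathrm d\mathbf k_i\mathrm d\mathbf k_j\mathrm d\mathbf k_a.$$ *)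

theory Defs
  imports
    "HOL-Analysis.Analysis"
    "HOL-Library.Landau_Symbols"
    "HOL-Library.Function_Algebras"
    "HOL-Probability.Essential_Supremum"
begin

section \<open>Smoothness and algebraic singularities\<close>

text \<open>A list of coordinate directions plays the role of a multi-index, with the length of the list
  as its order; \<open>smooth_on\<close> is meant for open sets.\<close>

primrec iter_deriv :: "'a::euclidean_space list \<Rightarrow> ('a \<Rightarrow> 'b::real_normed_vector) \<Rightarrow> 'a \<Rightarrow> 'b" where
  "iter_deriv [] f = f"
| "iter_deriv (v # vs) f = (\<lambda>x. frechet_derivative (iter_deriv vs f) (at x) v)"

definition smooth_on :: "'a::euclidean_space set \<Rightarrow> ('a \<Rightarrow> 'b::real_normed_vector) \<Rightarrow> bool" where
  "smooth_on U f \<longleftrightarrow> (\<forall>vs. set vs \<subseteq> Basis \<longrightarrow> iter_deriv vs f differentiable_on U)"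

type_synonym vec3 = "real ^ 3"

text \<open>The function \<open>g\<close> has arguments \<open>(k\<^sub>i, k\<^sub>j, q)\<close>, the singularity being at \<open>q = 0\<close>.\<close>

definition algebraic_singularity ::
    "vec3 set \<Rightarrow> real \<Rightarrow> (vec3 \<times> vec3 \<times> vec3 \<Rightarrow> complex) \<Rightarrow> bool" where
  "algebraic_singularity Z \<gamma> g \<longleftrightarrow>
    (\<exists>\<delta>>0. \<forall>\<alpha> \<beta>. set \<alpha> \<subseteq> {e \<in> Basis. fst e = 0 \<and> fst (snd e) = 0} \<longrightarrow>
       set \<beta> \<subseteq> {e \<in> Basis. snd (snd e) = 0} \<longrightarrow>
       (\<exists>C. \<forall>ki\<in>Z. \<forall>kj\<in>Z. \<forall>q. 0 < norm q \<and> norm q < \<delta> \<longrightarrow>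
          norm (iter_deriv \<alpha> (iter_deriv \<beta> g) (ki, kj, q))
            \<le> C * norm q powr (\<gamma> - real (length \<alpha>))))"

section \<open>Periodic insulating systems\<close>

text \<open>\<open>basis\<close> has the primitive lattice vectors as rows, \<open>cell\<close> and \<open>zone\<close> are the unit cells
  \<open>\<Omega>\<close> and \<open>\<Omega>\<^sup>*\<close>, and \<open>bloch n k\<close> is the periodic part \<open>u\<close> of the orbital. Occupied bands are
  \<open>Inl i\<close>, virtual bands are \<open>Inr a\<close>.\<close>

record ('o, 'v) crystal =
  basis :: "real ^ 3 ^ 3"
  cell :: "vec3 set"
  zone :: "vec3 set"
  bloch :: "'o + 'v \<Rightarrow> vec3 \<Rightarrow> vec3 \<Rightarrow> complex"
  energy :: "'o + 'v \<Rightarrow> vec3 \<Rightarrow> real"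

definition bravais :: "('o, 'v) crystal \<Rightarrow> vec3 set" where
  "bravais S = range (\<lambda>m :: int ^ 3. \<Sum>i\<in>UNIV. of_int (m $ i) *\<^sub>R (basis S $ i))"

definition reciprocal :: "('o, 'v) crystal \<Rightarrow> vec3 set" where
  "reciprocal S = {G. \<forall>R\<in>bravais S. \<exists>m::int. G \<bullet> R = 2 * pi * of_int m}"

text \<open>A unit cell is any bounded fundamental domain, such as a half-open parallelepiped or a
  Wigner-Seitz cell with one representative chosen for each class of boundary points.\<close>

definition unit_cell :: "vec3 set \<Rightarrow> vec3 set \<Rightarrow> bool" where
  "unit_cell \<Lambda> C \<longleftrightarrow> bounded C \<and> C \<in> sets borel \<and> (\<forall>x. \<exists>!R. R \<in> \<Lambda> \<and> x - R \<in> C)"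

text \<open>The orbital \<open>\<psi>\<close>, without the factor \<open>1 / sqrt N\<close>, which cancels in the pair densities below.\<close>

definition orbital :: "('o, 'v) crystal \<Rightarrow> 'o + 'v \<Rightarrow> vec3 \<Rightarrow> vec3 \<Rightarrow> complex" where
  "orbital S n k r = cis (k \<bullet> r) * bloch S n k r"

text \<open>Smoothness of the orbitals in \<open>k\<close> means that the derivatives of all orders in \<open>k\<close> exist
  and are jointly continuous in \<open>k\<close> and \<open>r\<close>; no differentiability in \<open>r\<close> is required.
  The gap is the direct one, comparing energies at the same \<open>k\<close> only.\<close>

definition insulator :: "('o, 'v) crystal \<Rightarrow> bool" where
  "insulator S \<longleftrightarrow>
     invertible (basis S) \<and> unit_cell (bravais S) (cell S) \<and> unit_cell (reciprocal S) (zone S) \<and>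
     (\<forall>n k r. \<forall>R\<in>bravais S. bloch S n k (r + R) = bloch S n k r) \<and>
     (\<forall>n m k. (LINT r:cell S|lborel. cnj (bloch S n k r) * bloch S m k r) = (if n = m then 1 else 0)) \<and>
     (\<exists>g>0. \<forall>i a k. energy S (Inl i) k + g \<le> energy S (Inr a) k) \<and>
     (\<forall>n k r. \<forall>G\<in>reciprocal S. orbital S n (k + G) r = orbital S n k r) \<and>
     (\<forall>n r. smooth_on UNIV (\<lambda>k. orbital S n k r)) \<and>
     (\<forall>n vs. set vs \<subseteq> Basis \<longrightarrow>
        continuous_on UNIV (\<lambda>(k, r). iter_deriv vs (\<lambda>k. orbital S n k r) k)) \<and>
     (\<forall>n k. \<forall>G\<in>reciprocal S. energy S n (k + G) = energy S n k) \<and>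
     (\<forall>n. smooth_on UNIV (energy S n))"

text \<open>The representative of a momentum in the Brillouin zone.\<close>

definition fold_zone :: "('o, 'v) crystal \<Rightarrow> vec3 \<Rightarrow> vec3" where
  "fold_zone S k = (THE k'. k' \<in> zone S \<and> k - k' \<in> reciprocal S)"

text \<open>The uniform \<open>n \<times> n \<times> n\<close> mesh with offset \<open>s n\<close>: all points \<open>s n + G / n\<close> in the zone.\<close>

definition mesh :: "('o, 'v) crystal \<Rightarrow> (nat \<Rightarrow> vec3) \<Rightarrow> nat \<Rightarrow> vec3 set" where
  "mesh S s n = {k \<in> zone S. real n *\<^sub>R (k - s n) \<in> reciprocal S}"

section \<open>Electron repulsion integrals\<close>

definition pair_density ::
    "('o, 'v) crystal \<Rightarrow> ('o + 'v) \<times> vec3 \<Rightarrow> ('o + 'v) \<times> vec3 \<Rightarrow> vec3 \<Rightarrow> complex" where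
  "pair_density S P Q G =
     (LINT r:cell S|lborel. cnj (bloch S (fst P) (snd P) r) * bloch S (fst Q) (snd Q) r * cis (- (G \<bullet> r)))"

definition eri :: "('o, 'v) crystal \<Rightarrow> ('o + 'v) \<times> vec3 \<Rightarrow> ('o + 'v) \<times> vec3 \<Rightarrow>
    ('o + 'v) \<times> vec3 \<Rightarrow> ('o + 'v) \<times> vec3 \<Rightarrow> complex" where
  "eri S P1 P2 P3 P4 =
     (let q = snd P3 - snd P1 in
      of_real (4 * pi / measure lborel (cell S)) *
      (\<Sum>\<^sub>\<infinity>G\<in>{G \<in> reciprocal S. q + G \<noteq> 0}.
         of_real (1 / (norm (q + G))\<^sup>2) *
         pair_density S P1 (fst P3, snd P1 + q) G * pair_density S P2 (fst P4, snd P2 - q) (- G)))"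

section \<open>The CCD amplitude maps\<close>

text \<open>\<open>t i j a b (k\<^sub>i, k\<^sub>j, k\<^sub>a)\<close>. A tensor on a mesh is represented by a family that vanishes off
  the mesh.\<close>

type_synonym ('o, 'v) amplitude =
  "'o \<Rightarrow> 'o \<Rightarrow> 'v \<Rightarrow> 'v \<Rightarrow> vec3 \<times> vec3 \<times> vec3 \<Rightarrow> complex"

definition amp :: "('o, 'v) amplitude \<Rightarrow> 'o \<times> vec3 \<Rightarrow> 'o \<times> vec3 \<Rightarrow> 'v \<times> vec3 \<Rightarrow> 'v \<times> vec3 \<Rightarrow> complex" where
  "amp t I J A B = t (fst I) (fst J) (fst A) (fst B) (snd I, snd J, snd A)"

definition occ :: "'o \<times> vec3 \<Rightarrow> ('o + 'v) \<times> vec3" where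
  "occ I = (Inl (fst I), snd I)"

definition vir :: "'v \<times> vec3 \<Rightarrow> ('o + 'v) \<times> vec3" where
  "vir A = (Inr (fst A), snd A)"

definition eri_w :: "('o, 'v) crystal \<Rightarrow> 'o \<times> vec3 \<Rightarrow> 'o \<times> vec3 \<Rightarrow> 'v \<times> vec3 \<Rightarrow> 'v \<times> vec3 \<Rightarrow> complex" where
  "eri_w S I J A B =
     2 * eri S (occ I) (occ J) (vir A) (vir B) - eri S (occ I) (occ J) (vir B) (vir A)"

text \<open>The finite and the thermodynamic-limit maps share one formula, parametrised by the operator
  \<open>av\<close> that averages over a free momentum. All other momenta are fixed by momentum conservation.\<close>

type_synonym averaging = "(vec3 \<Rightarrow> complex) \<Rightarrow> complex"

definition mesh_average :: "vec3 set \<Rightarrow> averaging" where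
  "mesh_average K f = (\<Sum>k\<in>K. f k) / of_nat (card K)"

definition zone_average :: "('o, 'v) crystal \<Rightarrow> averaging" where
  "zone_average S f = (LINT k:zone S|lborel. f k) / of_real (measure lborel (zone S))"

text \<open>In the following names the upper-index letters come first: \<open>kappa_vv S av t A C\<close> is
  \<open>\<kappa>\<close> with upper index \<open>A\<close> and lower index \<open>C\<close>, \<open>kappa_oo S av t K I\<close> has upper index \<open>K\<close> and
  lower index \<open>I\<close>, and \<open>chi S av t P Q R T\<close> has upper indices \<open>P Q\<close> and lower indices \<open>R T\<close>.\<close>

definition kappa_vv :: "('o::finite, 'v::finite) crystal \<Rightarrow> averaging \<Rightarrow> ('o, 'v) amplitude \<Rightarrow>
    'v \<times> vec3 \<Rightarrow> 'v \<times> vec3 \<Rightarrow> complex" where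
  "kappa_vv S av t A C =
     - av (\<lambda>kk. av (\<lambda>kl. \<Sum>k\<in>UNIV. \<Sum>l\<in>UNIV. \<Sum>d\<in>UNIV.
         let K = (k, kk); L = (l, kl); D = (d, fold_zone S (kk + kl - snd C))
         in eri_w S K L C D * amp t K L A D))"

definition kappa_oo :: "('o::finite, 'v::finite) crystal \<Rightarrow> averaging \<Rightarrow> ('o, 'v) amplitude \<Rightarrow>
    'o \<times> vec3 \<Rightarrow> 'o \<times> vec3 \<Rightarrow> complex" where
  "kappa_oo S av t K I =
     av (\<lambda>kl. av (\<lambda>kc. \<Sum>l\<in>UNIV. \<Sum>c\<in>UNIV. \<Sum>d\<in>UNIV.
         let L = (l, kl); C = (c, kc); D = (d, fold_zone S (snd K + kl - kc))
         in eri_w S K L C D * amp t I L C D))"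

definition chi_oooo :: "('o::finite, 'v::finite) crystal \<Rightarrow> averaging \<Rightarrow> ('o, 'v) amplitude \<Rightarrow>
    'o \<times> vec3 \<Rightarrow> 'o \<times> vec3 \<Rightarrow> 'o \<times> vec3 \<Rightarrow> 'o \<times> vec3 \<Rightarrow> complex" where
  "chi_oooo S av t K L I J =
     eri S (occ K) (occ L) (occ I) (occ J) +
     av (\<lambda>kc. \<Sum>c\<in>UNIV. \<Sum>d\<in>UNIV.
         let C = (c, kc); D = (d, fold_zone S (snd I + snd J - kc))
         in eri S (occ K) (occ L) (vir C) (vir D) * amp t I J C D)"

definition chi_vvvv :: "('o, 'v) crystal \<Rightarrow>
    'v \<times> vec3 \<Rightarrow> 'v \<times> vec3 \<Rightarrow> 'v \<times> vec3 \<Rightarrow> 'v \<times> vec3 \<Rightarrow> complex" where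
  "chi_vvvv S A B C D = eri S (vir A) (vir B) (vir C) (vir D)"

definition chi_voov :: "('o::finite, 'v::finite) crystal \<Rightarrow> averaging \<Rightarrow> ('o, 'v) amplitude \<Rightarrow>
    'v \<times> vec3 \<Rightarrow> 'o \<times> vec3 \<Rightarrow> 'o \<times> vec3 \<Rightarrow> 'v \<times> vec3 \<Rightarrow> complex" where
  "chi_voov S av t A K I C =
     eri S (vir A) (occ K) (occ I) (vir C) +
     1 / 2 * av (\<lambda>kl. \<Sum>l\<in>UNIV. \<Sum>d\<in>UNIV.
         let L = (l, kl); D = (d, fold_zone S (snd I + kl - snd A))
         in eri_w S L K D C * amp t I L A D
            - eri S (occ L) (occ K) (vir D) (vir C) * amp t I L D A)"

definition chi_vovo :: "('o::finite, 'v::finite) crystal \<Rightarrow> averaging \<Rightarrow> ('o, 'v) amplitude \<Rightarrow>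
    'v \<times> vec3 \<Rightarrow> 'o \<times> vec3 \<Rightarrow> 'v \<times> vec3 \<Rightarrow> 'o \<times> vec3 \<Rightarrow> complex" where
  "chi_vovo S av t A K C I =
     eri S (vir A) (occ K) (vir C) (occ I) -
     1 / 2 * av (\<lambda>kl. \<Sum>l\<in>UNIV. \<Sum>d\<in>UNIV.
         let L = (l, kl); D = (d, fold_zone S (snd I + kl - snd A))
         in eri S (occ L) (occ K) (vir C) (vir D) * amp t I L D A)"

definition exchange_sym :: "('p \<Rightarrow> 'p \<Rightarrow> 'q \<Rightarrow> 'q \<Rightarrow> complex) \<Rightarrow> 'p \<Rightarrow> 'p \<Rightarrow> 'q \<Rightarrow> 'q \<Rightarrow> complex" where
  "exchange_sym f I J A B = f I J A B + f J I B A"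

definition ccd_linear :: "('o::finite, 'v::finite) crystal \<Rightarrow> averaging \<Rightarrow> ('o, 'v) amplitude \<Rightarrow>
    'o \<times> vec3 \<Rightarrow> 'o \<times> vec3 \<Rightarrow> 'v \<times> vec3 \<Rightarrow> 'v \<times> vec3 \<Rightarrow> complex" where
  "ccd_linear S av t I J A B =
     (\<Sum>c\<in>UNIV. let C = (c, snd A) in kappa_vv S av t A C * amp t I J C B) -
     (\<Sum>k\<in>UNIV. let K = (k, snd I) in kappa_oo S av t K I * amp t K J A B)"

text \<open>In the last term, the momentum of \<open>C\<close> is fixed by \<open>k\<^sub>i + k\<^sub>c = k\<^sub>a + k\<^sub>k\<close>, but by
  \<open>k\<^sub>j + k\<^sub>c = k\<^sub>a + k\<^sub>k\<close> where \<open>J\<close> is the lower index.\<close>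

definition ccd_ring :: "('o::finite, 'v::finite) crystal \<Rightarrow> averaging \<Rightarrow> ('o, 'v) amplitude \<Rightarrow>
    'o \<times> vec3 \<Rightarrow> 'o \<times> vec3 \<Rightarrow> 'v \<times> vec3 \<Rightarrow> 'v \<times> vec3 \<Rightarrow> complex" where
  "ccd_ring S av t I J A B =
     av (\<lambda>kk. \<Sum>k\<in>UNIV. \<Sum>c\<in>UNIV.
         let K = (k, kk);
             C = (c, fold_zone S (kk + snd A - snd I));
             C' = (c, fold_zone S (kk + snd A - snd J))
         in (2 * chi_voov S av t A K I C - chi_vovo S av t A K C I) * amp t K J C B
            - chi_voov S av t A K I C * amp t K J B C
            - chi_vovo S av t A K C' J * amp t K I B C')"

definition ccd_map :: "('o::finite, 'v::finite) crystal \<Rightarrow> averaging \<Rightarrow>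
    ('o, 'v) amplitude \<Rightarrow> ('o, 'v) amplitude" where
  "ccd_map S av t i j a b = (\<lambda>(ki, kj, ka).
     let kb = fold_zone S (ki + kj - ka);
         I = (i, ki); J = (j, kj); A = (a, ka); B = (b, kb)
     in (eri S (vir A) (vir B) (occ I) (occ J)
         + exchange_sym (ccd_linear S av t) I J A B
         + av (\<lambda>kk. \<Sum>k\<in>UNIV. \<Sum>l\<in>UNIV.
             let K = (k, kk); L = (l, fold_zone S (ki + kj - kk))
             in chi_oooo S av t K L I J * amp t K L A B)
         + av (\<lambda>kc. \<Sum>c\<in>UNIV. \<Sum>d\<in>UNIV.
             let C = (c, kc); D = (d, fold_zone S (ki + kj - kc))
             in chi_vvvv S A B C D * amp t I J C D)
         + exchange_sym (ccd_ring S av t) I J A B)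
        / of_real (energy S (Inl i) ki + energy S (Inl j) kj
                   - energy S (Inr a) ka - energy S (Inr b) kb))"

text \<open>Evaluation on a mesh, extended by zero.\<close>

definition on_mesh :: "vec3 set \<Rightarrow> ('o, 'v) amplitude \<Rightarrow> ('o, 'v) amplitude" where
  "on_mesh K t i j a b k = (if k \<in> K \<times> K \<times> K then t i j a b k else 0)"

definition mesh_tensors :: "vec3 set \<Rightarrow> ('o, 'v) amplitude set" where
  "mesh_tensors K = {T. \<forall>i j a b k. k \<notin> K \<times> K \<times> K \<longrightarrow> T i j a b k = 0}"

definition ccd_finite :: "('o::finite, 'v::finite) crystal \<Rightarrow> vec3 set \<Rightarrow>
    ('o, 'v) amplitude \<Rightarrow> ('o, 'v) amplitude" where
  "ccd_finite S K T = on_mesh K (ccd_map S (mesh_average K) T)"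

definition ccd_tdl :: "('o::finite, 'v::finite) crystal \<Rightarrow> ('o, 'v) amplitude \<Rightarrow> ('o, 'v) amplitude" where
  "ccd_tdl S t = ccd_map S (zone_average S) t"

section \<open>Function space, norms and energy functionals\<close>

definition T_space :: "('o, 'v) crystal \<Rightarrow> (vec3 \<times> vec3 \<times> vec3 \<Rightarrow> complex) set" where
  "T_space S = {f.
     (\<forall>ki kj ka. \<forall>G\<in>reciprocal S.
        f (ki + G, kj, ka) = f (ki, kj, ka) \<and> f (ki, kj + G, ka) = f (ki, kj, ka) \<and>
        f (ki, kj, ka + G) = f (ki, kj, ka)) \<and>
     smooth_on {(ki, kj, ka). ka - ki \<notin> reciprocal S} f \<and>
     algebraic_singularity (zone S) 0 (\<lambda>(ki, kj, q). f (ki, kj, ki + q)) \<and>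
     smooth_on UNIV (\<lambda>(ki, kj). f (ki, kj, ki))}"

definition T_families :: "('o, 'v) crystal \<Rightarrow> ('o, 'v) amplitude set" where
  "T_families S = {t. \<forall>i j a b. t i j a b \<in> T_space S}"

definition tensor_norm :: "vec3 set \<Rightarrow> ('o::finite, 'v::finite) amplitude \<Rightarrow> real" where
  "tensor_norm K T = Max {norm (T i j a b k) | i j a b k. k \<in> K \<times> K \<times> K}"

definition Linf_norm :: "('o::finite, 'v::finite) crystal \<Rightarrow> ('o, 'v) amplitude \<Rightarrow> ereal" where
  "Linf_norm S t = Max {esssup (restrict_space lborel (zone S \<times> zone S \<times> zone S))
                          (\<lambda>k. ereal (norm (t i j a b k))) | i j a b. True}"

definition energy_density :: "('o::finite, 'v::finite) crystal \<Rightarrow> ('o, 'v) amplitude \<Rightarrow>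
    vec3 \<times> vec3 \<times> vec3 \<Rightarrow> complex" where
  "energy_density S t = (\<lambda>(ki, kj, ka). \<Sum>i\<in>UNIV. \<Sum>j\<in>UNIV. \<Sum>a\<in>UNIV. \<Sum>b\<in>UNIV.
     eri_w S (i, ki) (j, kj) (a, ka) (b, fold_zone S (ki + kj - ka)) * t i j a b (ki, kj, ka))"

definition G_finite :: "('o::finite, 'v::finite) crystal \<Rightarrow> vec3 set \<Rightarrow> ('o, 'v) amplitude \<Rightarrow> complex" where
  "G_finite S K T = (\<Sum>k\<in>K \<times> K \<times> K. energy_density S T k) / of_nat (card K) ^ 3"

definition G_tdl :: "('o::finite, 'v::finite) crystal \<Rightarrow> ('o, 'v) amplitude \<Rightarrow> complex" where
  "G_tdl S t = (LINT k:zone S \<times> zone S \<times> zone S|lborel. energy_density S t k)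
                 / of_real (measure lborel (zone S)) ^ 3"

end

theory Submission
  imports Defs
begin

text \<open>The error splits at the thermodynamic-limit amplitude evaluated on the mesh:
  \<open>G_tdl t\<^sub>* - G_finite T\<^sub>* = (G_tdl t\<^sub>* - G_finite t\<^sub>*) + (G_finite t\<^sub>* - G_finite T\<^sub>*)\<close>, and both parts are
  \<open>O(1/n)\<close> on an \<open>n \<times> n \<times> n\<close> mesh. Below, \<open>L\<^sup>*\<close> is the reciprocal lattice.

  \<^emph>\<open>The amplitude error.\<close> Let \<open>e\<^sub>m\<close> be the distance between the \<open>m\<close>-th iterate of the limit map,
  evaluated on the mesh, and the \<open>m\<close>-th iterate of the mesh map. Consistency and contraction give
  \<open>e\<^sub>m\<^sub>+\<^sub>1 \<le> c/n + L e\<^sub>m\<close>, hence \<open>e\<^sub>m \<le> c/(n (1 - L))\<close> (\<open>iteration_error\<close>); the first step has no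
  residual, because both maps send zero to the same amplitude. For \<open>m \<rightarrow> \<infinity>\<close> this bounds
  \<open>t\<^sub>* - T\<^sub>*\<close> at the mesh points with \<open>k\<^sub>a \<noteq> k\<^sub>i\<close>: there amplitudes are continuous, so that
  \<open>L\<^sup>\<infinity>\<close> convergence is pointwise (\<open>T_families_le_Linf_norm\<close>). The null set \<open>k\<^sub>a = k\<^sub>i\<close> is invisible to the
  essential supremum, but it contains only a fraction \<open>n\<^sup>-\<^sup>3\<close> of the mesh points, and there both
  amplitudes are bounded independently of \<open>n\<close> (\<open>tensor_norm_fixed_point\<close>). Since \<open>W\<close> is bounded, the
  energies differ by \<open>O(1/n)\<close> (\<open>G_finite_diff_le\<close>).

  \<^emph>\<open>The quadrature error.\<close> The integrand \<open>W t\<^sub>*\<close> is bounded, and its local Lipschitz constant is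
  \<open>O(1/d)\<close>, where \<open>d\<close> is the distance to the two singular sets \<open>k\<^sub>a - k\<^sub>i \<in> L\<^sup>*\<close> and
  \<open>k\<^sub>j - k\<^sub>a \<in> L\<^sup>*\<close>. The mesh average is the average of the integrand after its argument has been
  rounded to the mesh, so the error is at most \<open>C/n\<close> times the integral of \<open>1/d\<close>, which is finite in
  three dimensions (\<open>mesh_quadrature_error\<close>). The zone being an arbitrary fundamental domain,
  integrals are moved from one unit cell to another by a tiling lemma.

  \<^emph>\<open>Regularity of the factors.\<close> For \<open>t\<^sub>*\<close> the estimate restates the algebraic singularity of
  order 0 (\<open>mild_T_space\<close>). For \<open>W\<close> it rests on the Coulomb term with \<open>G = 0\<close>, a product of two
  pair densities divided by \<open>|q|\<^sup>2\<close>: occupied and virtual bands are orthogonal, so each density is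
  \<open>O(|q|)\<close>. The terms with \<open>G \<noteq> 0\<close> form a sum of products of Fourier coefficients with bounded
  weights, and Cauchy--Schwarz with Bessel's inequality controls it by the sup norms of the
  densities alone; the Lipschitz dependence of the orbitals on \<open>k\<close> then carries over to the sum
  (\<open>mild_interaction\<close>).\<close>

section \<open>Tilings by the translates of a lattice\<close>

definition tiles :: "'a::euclidean_space set \<Rightarrow> 'a set \<Rightarrow> bool" where
  "tiles \<Lambda> C \<longleftrightarrow> C \<in> sets borel \<and> (\<forall>x. \<exists>!R. R \<in> \<Lambda> \<and> x - R \<in> C)"

lemma unit_cell_iff_tiles: "unit_cell \<Lambda> C \<longleftrightarrow> bounded C \<and> tiles \<Lambda> C"
  by (simp add: unit_cell_def tiles_def)

lemma nn_integral_lborel_shift: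
  fixes f :: "'a::euclidean_space \<Rightarrow> ennreal"
  assumes "f \<in> borel_measurable borel"
  shows "(\<integral>\<^sup>+x. f (c + x) \<partial>lborel) = (\<integral>\<^sup>+x. f x \<partial>lborel)"
proof -
  have "(\<integral>\<^sup>+x. f x \<partial>lborel) = (\<integral>\<^sup>+x. f x \<partial>distr lborel borel ((+) c))"
    by (simp add: lborel_distr_plus)
  also have "\<dots> = (\<integral>\<^sup>+x. f (c + x) \<partial>lborel)"
    using assms by (subst nn_integral_distr) auto
  finally show ?thesis ..
qed

lemma nn_integral_count_space_singleton:
  assumes "R0 \<in> \<Lambda>" "\<And>R. R \<in> \<Lambda> \<Longrightarrow> R \<noteq> R0 \<Longrightarrow> f R = 0"
  shows "(\<integral>\<^sup>+R. f R \<partial>count_space \<Lambda>) = f R0"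
proof -
  have "(\<integral>\<^sup>+R. f R \<partial>count_space \<Lambda>) = (\<integral>\<^sup>+R. f R0 * indicator {R0} R \<partial>count_space \<Lambda>)"
    using assms by (intro nn_integral_cong) (auto simp: indicator_def)
  then show ?thesis using assms(1) by (simp add: nn_integral_cmult_indicator)
qed

locale translation_lattice =
  fixes \<Lambda> :: "'a::euclidean_space set"
  assumes countable [simp]: "countable \<Lambda>"
    and zero: "0 \<in> \<Lambda>"
    and diff: "x \<in> \<Lambda> \<Longrightarrow> y \<in> \<Lambda> \<Longrightarrow> x - y \<in> \<Lambda>"
begin

lemma uminus: "x \<in> \<Lambda> \<Longrightarrow> - x \<in> \<Lambda>"
  using diff[OF zero, of x] by simp

lemma add: "x \<in> \<Lambda> \<Longrightarrow> y \<in> \<Lambda> \<Longrightarrow> x + y \<in> \<Lambda>"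
  using diff[of x "- y"] uminus[of y] by simp

lemma uminus_iff: "- x \<in> \<Lambda> \<longleftrightarrow> x \<in> \<Lambda>"
  using uminus[of x] uminus[of "- x"] by auto

lemma minus_commute_iff: "x - y \<in> \<Lambda> \<longleftrightarrow> y - x \<in> \<Lambda>"
  using uminus_iff[of "x - y"] by simp

text \<open>Each point has exactly one representative in \<open>C\<close>, so an integral over the whole space is an
  integral over \<open>C\<close> of a sum over the lattice. All comparisons of unit cells follow from this.\<close>

lemma nn_integral_unfold:
  assumes C: "tiles \<Lambda> C" and \<phi> [measurable]: "\<phi> \<in> borel_measurable borel"
  shows "(\<integral>\<^sup>+x\<in>C. (\<integral>\<^sup>+R. \<phi> (R + x) \<partial>count_space \<Lambda>) \<partial>lborel) = (\<integral>\<^sup>+x. \<phi> x \<partial>lborel)"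
proof -
  have [measurable]: "C \<in> sets borel" using C by (simp add: tiles_def)
  have m: "(\<lambda>x. indicator C (x - R) :: ennreal) \<in> borel_measurable borel" for R
  proof -
    have "indicator C \<circ> (\<lambda>x. x - R) \<in> borel_measurable borel"
      by (rule measurable_comp[of _ _ borel]) auto
    then show ?thesis by (simp add: comp_def)
  qed
  note m [measurable]
  have "(\<integral>\<^sup>+x. \<phi> x \<partial>lborel) = (\<integral>\<^sup>+x. (\<integral>\<^sup>+R. \<phi> x * indicator C (x - R) \<partial>count_space \<Lambda>) \<partial>lborel)"
  proof (rule nn_integral_cong)
    fix x
    obtain R0 where R0: "R0 \<in> \<Lambda>" "x - R0 \<in> C" "\<And>R. R \<in> \<Lambda> \<Longrightarrow> x - R \<in> C \<Longrightarrow> R = R0"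
      using C unfolding tiles_def by metis
    have "(\<integral>\<^sup>+R. \<phi> x * indicator C (x - R) \<partial>count_space \<Lambda>) = \<phi> x * indicator C (x - R0)"
    proof (rule nn_integral_count_space_singleton[OF R0(1)])
      show "\<phi> x * indicator C (x - R) = 0" if "R \<in> \<Lambda>" "R \<noteq> R0" for R
        using R0(3)[OF that(1)] that(2) by (cases "x - R \<in> C") auto
    qed
    with R0(2) show "\<phi> x = (\<integral>\<^sup>+R. \<phi> x * indicator C (x - R) \<partial>count_space \<Lambda>)" by simp
  qed
  also have "\<dots> = (\<integral>\<^sup>+R. (\<integral>\<^sup>+x. \<phi> x * indicator C (x - R) \<partial>lborel) \<partial>count_space \<Lambda>)"
    by (intro nn_integral_count_space_nn_integral) auto
  also have "\<dots> = (\<integral>\<^sup>+R. (\<integral>\<^sup>+x. \<phi> (R + x) * indicator C x \<partial>lborel) \<partial>count_space \<Lambda>)"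
  proof (rule nn_integral_cong)
    fix R
    show "(\<integral>\<^sup>+x. \<phi> x * indicator C (x - R) \<partial>lborel) = (\<integral>\<^sup>+x. \<phi> (R + x) * indicator C x \<partial>lborel)"
      using nn_integral_lborel_shift[of "\<lambda>x. \<phi> x * indicator C (x - R)" R] by simp
  qed
  also have "\<dots> = (\<integral>\<^sup>+x. (\<integral>\<^sup>+R. \<phi> (R + x) * indicator C x \<partial>count_space \<Lambda>) \<partial>lborel)"
    by (intro nn_integral_count_space_nn_integral[symmetric]) auto
  also have "\<dots> = (\<integral>\<^sup>+x\<in>C. (\<integral>\<^sup>+R. \<phi> (R + x) \<partial>count_space \<Lambda>) \<partial>lborel)"
    by (intro nn_integral_cong) (simp add: nn_integral_multc)
  finally show ?thesis ..
qed

text \<open>Unfolding \<open>g\<close> restricted to \<open>D\<close>: over each \<open>x \<in> C\<close> the lattice sum has the single term \<open>g x\<close>.\<close>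

lemma nn_integral_tiles_eq:
  assumes C: "tiles \<Lambda> C" and D: "tiles \<Lambda> D" and g [measurable]: "g \<in> borel_measurable borel"
    and per: "\<And>x R. R \<in> \<Lambda> \<Longrightarrow> g (R + x) = g x"
  shows "(\<integral>\<^sup>+x\<in>C. g x \<partial>lborel) = (\<integral>\<^sup>+x\<in>D. g x \<partial>lborel)"
proof -
  have [measurable]: "D \<in> sets borel" using D by (simp add: tiles_def)
  have "(\<integral>\<^sup>+R. g (R + x) * indicator D (R + x) \<partial>count_space \<Lambda>) = g x" for x
  proof -
    obtain R0 where R0: "R0 \<in> \<Lambda>" "x - R0 \<in> D" "\<And>R. R \<in> \<Lambda> \<Longrightarrow> x - R \<in> D \<Longrightarrow> R = R0"
      using D unfolding tiles_def by metis
    have *: "R + x \<notin> D" if "R \<in> \<Lambda>" "R \<noteq> - R0" for R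
      using R0(3)[of "- R"] that uminus[of R] by (auto simp: add.commute)
    have "(\<integral>\<^sup>+R. g (R + x) * indicator D (R + x) \<partial>count_space \<Lambda>)
        = g (- R0 + x) * indicator D (- R0 + x)"
    proof (rule nn_integral_count_space_singleton[OF uminus[OF R0(1)]])
      show "g (R + x) * indicator D (R + x) = 0" if "R \<in> \<Lambda>" "R \<noteq> - R0" for R
        using *[OF that] by simp
    qed
    with R0(1,2) show ?thesis using per[of "- R0" x] by (simp add: uminus)
  qed
  then show ?thesis
    using nn_integral_unfold[OF C, of "\<lambda>x. g x * indicator D x"] by simp
qed

lemma emeasure_tiles_eq:
  assumes "tiles \<Lambda> C" "tiles \<Lambda> D"
  shows "emeasure lborel C = emeasure lborel D"
  using nn_integral_tiles_eq[OF assms, of "\<lambda>_. 1"] assms by (simp add: tiles_def)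

lemma AE_from_tile:
  assumes C: "tiles \<Lambda> C" and [measurable]: "Measurable.pred borel P"
    and per: "\<And>x R. R \<in> \<Lambda> \<Longrightarrow> P (R + x) \<longleftrightarrow> P x"
    and AE: "AE x in lborel. x \<in> C \<longrightarrow> P x"
  shows "AE x in lborel. P x"
proof -
  have [measurable]: "C \<in> sets borel" using C by (simp add: tiles_def)
  have "(\<integral>\<^sup>+x. indicator {x. \<not> P x} x \<partial>lborel)
      = (\<integral>\<^sup>+x\<in>C. (\<integral>\<^sup>+R. indicator {x. \<not> P x} (R + x) \<partial>count_space \<Lambda>) \<partial>lborel)"
    by (intro nn_integral_unfold[OF C, symmetric]) auto
  also have "\<dots> = (\<integral>\<^sup>+x. 0 \<partial>(lborel :: 'a measure))"
  proof (intro nn_integral_cong_AE)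
    have "(\<integral>\<^sup>+R. indicator {x. \<not> P x} (R + x) \<partial>count_space \<Lambda>) * indicator C x = (0 :: ennreal)"
      if "x \<in> C \<longrightarrow> P x" for x
    proof (cases "x \<in> C")
      case True
      with that have "(\<integral>\<^sup>+R. indicator {x. \<not> P x} (R + x) \<partial>count_space \<Lambda>)
          = (\<integral>\<^sup>+R. (0 :: ennreal) \<partial>count_space \<Lambda>)"
        by (intro nn_integral_cong) (simp add: per)
      then show ?thesis by simp
    qed simp
    with AE show "AE x in lborel. (\<integral>\<^sup>+R. indicator {x. \<not> P x} (R + x) \<partial>count_space \<Lambda>)
          * indicator C x = (0 :: ennreal)"
      by (auto elim!: eventually_mono)
  qed
  finally have "emeasure lborel {x. \<not> P x} = 0" by simp
  then show ?thesis by (intro AE_I[of _ _ "{x. \<not> P x}"]) auto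
qed

lemma set_integral_real_tiles_eq:
  fixes f :: "'a \<Rightarrow> real"
  assumes C: "tiles \<Lambda> C" and D: "tiles \<Lambda> D" and f [measurable]: "f \<in> borel_measurable borel"
    and per: "\<And>x R. R \<in> \<Lambda> \<Longrightarrow> f (R + x) = f x"
    and int: "set_integrable lborel C f" "set_integrable lborel D f"
  shows "(LINT x:C|lborel. f x) = (LINT x:D|lborel. f x)"
proof -
  have e: "ennreal (indicator A x * r) = ennreal r * indicator A x" for A and x :: 'a and r :: real
    by (auto simp: indicator_def)
  have "(LINT x:A|lborel. f x) = enn2real (\<integral>\<^sup>+x\<in>A. ennreal (f x) \<partial>lborel)
      - enn2real (\<integral>\<^sup>+x\<in>A. ennreal (- f x) \<partial>lborel)" if "set_integrable lborel A f" for A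
    using real_lebesgue_integral_def[OF that[unfolded set_integrable_def]]
      e[of A _ "f _"] e[of A _ "- f _"]
    by (simp add: set_lebesgue_integral_def)
  with int show ?thesis
    using nn_integral_tiles_eq[OF C D, of "\<lambda>x. ennreal (f x)"]
      nn_integral_tiles_eq[OF C D, of "\<lambda>x. ennreal (- f x)"] per by simp
qed

text \<open>The decomposition into positive and negative real and imaginary parts reduces the Bochner
  integral to the previous nonnegative case.\<close>

lemma set_integral_tiles_eq:
  fixes f :: "'a \<Rightarrow> complex"
  assumes C: "tiles \<Lambda> C" and D: "tiles \<Lambda> D" and f [measurable]: "f \<in> borel_measurable borel"
    and per: "\<And>x R. R \<in> \<Lambda> \<Longrightarrow> f (R + x) = f x"
    and int: "set_integrable lborel C f" "set_integrable lborel D f"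
  shows "(LINT x:C|lborel. f x) = (LINT x:D|lborel. f x)"
proof (rule complex_eqI)
  have iR: "set_integrable lborel A (\<lambda>x. Re (f x))" "set_integrable lborel A (\<lambda>x. Im (f x))"
    "Re (LINT x:A|lborel. f x) = (LINT x:A|lborel. Re (f x))"
    "Im (LINT x:A|lborel. f x) = (LINT x:A|lborel. Im (f x))" if "set_integrable lborel A f" for A
    using that integrable_Re[OF that[unfolded set_integrable_def]]
      integrable_Im[OF that[unfolded set_integrable_def]]
      integral_Re[OF that[unfolded set_integrable_def]] integral_Im[OF that[unfolded set_integrable_def]]
    by (auto simp: set_integrable_def set_lebesgue_integral_def)
  show "Re (LINT x:C|lborel. f x) = Re (LINT x:D|lborel. f x)"
    using int per by (simp add: iR, intro set_integral_real_tiles_eq[OF C D]) (auto simp: iR)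
  show "Im (LINT x:C|lborel. f x) = Im (LINT x:D|lborel. f x)"
    using int per by (simp add: iR, intro set_integral_real_tiles_eq[OF C D]) (auto simp: iR)
qed

lemma emeasure_tiles_pos:
  assumes "tiles \<Lambda> C"
  shows "emeasure lborel C > 0"
proof (rule ccontr)
  have [measurable]: "C \<in> sets borel" using assms by (simp add: tiles_def)
  assume "\<not> ?thesis"
  then have "emeasure lborel C = 0" by simp
  then have "AE x in lborel. x \<notin> C" by (intro AE_I[of _ _ C]) auto
  then have "AE x in lborel. x \<in> C \<longrightarrow> False" by eventually_elim auto
  then have "AE x in (lborel :: 'a measure). False"
    by (intro AE_from_tile[OF assms, of "\<lambda>_. False"]) auto
  then show False by (simp add: AE_iff_measurable[of UNIV])
qed

lemma tiles_shift:
  assumes "tiles \<Lambda> C"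
  shows "tiles \<Lambda> ((\<lambda>x. x + a) -` C)"
proof -
  have "(\<lambda>x. x + a) -` C \<in> sets borel"
    using measurable_sets_borel[of "\<lambda>x. x + a" borel C] assms by (simp add: tiles_def)
  moreover have "\<exists>!R. R \<in> \<Lambda> \<and> x - R + a \<in> C" for x
    using assms[unfolded tiles_def, THEN conjunct2, rule_format, of "x + a"]
    by (simp add: algebra_simps)
  ultimately show ?thesis by (auto simp: tiles_def)
qed

end

lemma translation_lattice_Times:
  assumes "translation_lattice A" "translation_lattice B"
  shows "translation_lattice (A \<times> B)"
  using assms unfolding translation_lattice_def by (auto simp: zero_prod_def)

lemma tiles_Times:
  assumes "tiles A C" "tiles B D"
  shows "tiles (A \<times> B) (C \<times> D)"
proof -
  have "\<exists>!R. R \<in> A \<times> B \<and> x - R \<in> C \<times> D" for x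
  proof -
    obtain R where R: "R \<in> A" "fst x - R \<in> C" "\<And>R'. R' \<in> A \<Longrightarrow> fst x - R' \<in> C \<Longrightarrow> R' = R"
      using assms(1) unfolding tiles_def by metis
    obtain Q where Q: "Q \<in> B" "snd x - Q \<in> D" "\<And>Q'. Q' \<in> B \<Longrightarrow> snd x - Q' \<in> D \<Longrightarrow> Q' = Q"
      using assms(2) unfolding tiles_def by metis
    show ?thesis
    proof (intro ex1I[of _ "(R, Q)"])
      show "(R, Q) \<in> A \<times> B \<and> x - (R, Q) \<in> C \<times> D"
        using R(1,2) Q(1,2) by (simp add: mem_Times_iff)
      show "P = (R, Q)" if "P \<in> A \<times> B \<and> x - P \<in> C \<times> D" for P
      proof (rule prod_eqI)
        show "fst P = fst (R, Q)" using R(3)[of "fst P"] that unfolding mem_Times_iff by simp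
        show "snd P = snd (R, Q)" using Q(3)[of "snd P"] that unfolding mem_Times_iff by simp
      qed
    qed
  qed
  moreover have "C \<times> D \<in> sets borel"
    using assms by (auto simp: tiles_def borel_prod[symmetric])
  ultimately show ?thesis by (simp add: tiles_def)
qed

section \<open>Reciprocal lattice and Brillouin zone\<close>

locale insulating_system =
  fixes S :: "('o::finite, 'v::finite) crystal"
  assumes system: "insulator S"
begin

lemma zone_tiles: "tiles (reciprocal S) (zone S)" and zone_bounded: "bounded (zone S)"
  using system by (auto simp: insulator_def unit_cell_iff_tiles)

lemma invertible_basis: "invertible (basis S)"
  using system by (auto simp: insulator_def)

text \<open>In the coordinates \<open>G \<mapsto> basis S *v G\<close> the reciprocal lattice is the cubic lattice with spacing
  \<open>2\<pi>\<close>; countability and the gap around \<open>0\<close> are read off from this.\<close>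

lemma reciprocal_iff:
  "G \<in> reciprocal S \<longleftrightarrow> (\<forall>i. \<exists>m::int. (basis S *v G) $ i = 2 * pi * of_int m)"
proof
  assume G: "G \<in> reciprocal S"
  show "\<forall>i. \<exists>m::int. (basis S *v G) $ i = 2 * pi * of_int m"
  proof
    fix i
    have "basis S $ i = (\<Sum>j\<in>UNIV. of_int ((\<chi> j. if j = i then 1 else 0) $ j :: int) *\<^sub>R (basis S $ j))"
      by (simp add: if_distrib[of of_int] if_distrib[of "\<lambda>c. c *\<^sub>R _"] cong: if_cong)
    then have "basis S $ i \<in> bravais S" unfolding bravais_def by (rule range_eqI)
    then obtain m :: int where "G \<bullet> basis S $ i = 2 * pi * of_int m"
      using G unfolding reciprocal_def by blast
    then show "\<exists>m::int. (basis S *v G) $ i = 2 * pi * of_int m"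
      by (auto simp: matrix_vector_mul_component inner_commute)
  qed
next
  assume *: "\<forall>i. \<exists>m::int. (basis S *v G) $ i = 2 * pi * of_int m"
  then obtain m :: "3 \<Rightarrow> int" where m: "\<And>i. (basis S *v G) $ i = 2 * pi * of_int (m i)" by metis
  have "\<exists>k::int. G \<bullet> R = 2 * pi * of_int k" if "R \<in> bravais S" for R
  proof -
    from that obtain c :: "int^3" where R: "R = (\<Sum>i\<in>UNIV. of_int (c $ i) *\<^sub>R (basis S $ i))"
      by (auto simp: bravais_def)
    have "G \<bullet> R = (\<Sum>i\<in>UNIV. of_int (c $ i) * ((basis S *v G) $ i))"
      by (simp add: R inner_sum_right matrix_vector_mul_component inner_commute)
    also have "\<dots> = 2 * pi * of_int (\<Sum>i\<in>UNIV. c $ i * m i)"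
      by (simp add: m sum_distrib_left algebra_simps)
    finally show ?thesis by blast
  qed
  then show "G \<in> reciprocal S" by (auto simp: reciprocal_def)
qed

sublocale recip: translation_lattice "reciprocal S"
proof
  obtain A where A: "A ** basis S = mat 1"
    using invertible_basis unfolding invertible_def by blast
  have "reciprocal S \<subseteq> range (\<lambda>m :: int ^ 3. A *v (\<chi> i. 2 * pi * of_int (m $ i)))"
  proof
    fix G assume "G \<in> reciprocal S"
    then obtain m :: "3 \<Rightarrow> int" where "\<And>i. (basis S *v G) $ i = 2 * pi * of_int (m i)"
      unfolding reciprocal_iff by metis
    then have "basis S *v G = (\<chi> i. 2 * pi * of_int ((\<chi> j. m j) $ i))" by (simp add: vec_eq_iff)
    then have "A *v (basis S *v G) = A *v (\<chi> i. 2 * pi * of_int ((\<chi> j. m j) $ i))" by (rule arg_cong)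
    then have "G = A *v (\<chi> i. 2 * pi * of_int ((\<chi> j. m j) $ i))"
      by (simp only: matrix_vector_mul_assoc A matrix_vector_mul_lid)
    then show "G \<in> range (\<lambda>m :: int ^ 3. A *v (\<chi> i. 2 * pi * of_int (m $ i)))" by (rule range_eqI)
  qed
  then show "countable (reciprocal S)" by (rule countable_subset) auto
  show "0 \<in> reciprocal S" by (auto simp: reciprocal_def intro: exI[of _ 0])
  show "x - y \<in> reciprocal S" if "x \<in> reciprocal S" "y \<in> reciprocal S" for x y
    unfolding reciprocal_def
  proof (intro CollectI ballI)
    fix R assume "R \<in> bravais S"
    then obtain a b :: int where "x \<bullet> R = 2 * pi * of_int a" "y \<bullet> R = 2 * pi * of_int b"
      using \<open>x \<in> _\<close> \<open>y \<in> _\<close> unfolding reciprocal_def by blast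
    then have "(x - y) \<bullet> R = 2 * pi * of_int (a - b)" by (simp add: inner_diff_left algebra_simps)
    then show "\<exists>m::int. (x - y) \<bullet> R = 2 * pi * of_int m" by blast
  qed
qed

lemma reciprocal_separated: "\<exists>c>0. \<forall>G\<in>reciprocal S. G \<noteq> 0 \<longrightarrow> c \<le> norm G"
proof -
  obtain K where K: "K > 0" "\<And>x. norm (basis S *v x) \<le> norm x * K"
    using bounded_linear.pos_bounded[OF matrix_vector_mul_bounded_linear[of "basis S"]] by blast
  obtain A where A: "A ** basis S = mat 1"
    using invertible_basis unfolding invertible_def by blast
  have "2 * pi / K \<le> norm G" if G: "G \<in> reciprocal S" "G \<noteq> 0" for G
  proof -
    have "basis S *v G \<noteq> 0"
    proof
      assume "basis S *v G = 0"
      then have "A *v (basis S *v G) = 0" by simp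
      then show False using G(2) by (simp add: matrix_vector_mul_assoc A)
    qed
    then obtain i where i: "(basis S *v G) $ i \<noteq> 0" by (auto simp: vec_eq_iff)
    obtain m :: int where m: "(basis S *v G) $ i = 2 * pi * of_int m"
      using G(1) reciprocal_iff by blast
    with i have "1 \<le> \<bar>real_of_int m\<bar>" by (cases "m = 0") auto
    then have "2 * pi \<le> \<bar>(basis S *v G) $ i\<bar>" by (simp add: m abs_mult)
    also have "\<dots> \<le> norm (basis S *v G)" by (rule component_le_norm_cart)
    also have "\<dots> \<le> norm G * K" by (rule K)
    finally show ?thesis using K(1) by (simp add: field_simps)
  qed
  then show ?thesis using K(1) by (intro exI[of _ "2 * pi / K"]) auto
qed

lemma closed_reciprocal: "closed (reciprocal S)"
proof -
  obtain c where c: "c > 0" "\<forall>G\<in>reciprocal S. G \<noteq> 0 \<longrightarrow> c \<le> norm G"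
    using reciprocal_separated by blast
  show ?thesis
  proof (rule discrete_imp_closed[OF c(1)], intro ballI impI)
    fix x y assume "x \<in> reciprocal S" "y \<in> reciprocal S" "dist y x < c"
    then show "y = x" using c(2) recip.diff[of y x] by (force simp: dist_norm)
  qed
qed

definition lat_dist :: "vec3 \<Rightarrow> real" where
  "lat_dist q = infdist q (reciprocal S)"

lemma recip_nonempty: "reciprocal S \<noteq> {}"
  using recip.zero by blast

lemma lat_dist_nonneg: "0 \<le> lat_dist q"
  by (simp add: lat_dist_def infdist_nonneg)

lemma lat_dist_le: "G \<in> reciprocal S \<Longrightarrow> lat_dist q \<le> norm (q + G)"
  using infdist_le[OF recip.uminus[of G], of q] by (simp add: lat_dist_def dist_norm)

lemma lat_dist_attained: "\<exists>G\<in>reciprocal S. lat_dist q = norm (q + G)"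
proof -
  obtain H where "H \<in> reciprocal S" "infdist q (reciprocal S) = dist q H"
    using infdist_attains_inf[OF closed_reciprocal recip_nonempty] by blast
  then show ?thesis
    using recip.uminus by (intro bexI[of _ "- H"]) (auto simp: lat_dist_def dist_norm)
qed

lemma lat_dist_zero_iff: "lat_dist q = 0 \<longleftrightarrow> q \<in> reciprocal S"
  by (simp add: lat_dist_def in_closed_iff_infdist_zero[OF closed_reciprocal recip_nonempty])

lemma lat_dist_triangle: "lat_dist q \<le> lat_dist p + dist q p"
  unfolding lat_dist_def by (rule infdist_triangle)

lemma lat_dist_add: 
  assumes "G \<in> reciprocal S" shows "lat_dist (G + q) = lat_dist q"
proof -
  have le: "lat_dist (G + q) \<le> lat_dist q" if "G \<in> reciprocal S" for G q
  proof -
    obtain H where H: "H \<in> reciprocal S" "lat_dist q = norm (q + H)"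
      using lat_dist_attained by blast
    have "lat_dist (G + q) \<le> norm ((G + q) + (H - G))"
      by (rule lat_dist_le[OF recip.diff[OF H(1) that]])
    with H(2) show ?thesis by simp
  qed
  from le[OF assms, of q] le[OF recip.uminus[OF assms], of "G + q"] show ?thesis by simp
qed

lemma lat_dist_uminus: "lat_dist (- q) = lat_dist q"
proof -
  have le: "lat_dist (- q) \<le> lat_dist q" for q
  proof -
    obtain H where H: "H \<in> reciprocal S" "lat_dist q = norm (q + H)"
      using lat_dist_attained by blast
    have "lat_dist (- q) \<le> norm (- q + - H)" by (rule lat_dist_le[OF recip.uminus[OF H(1)]])
    also have "\<dots> = norm (q + H)" using norm_minus_cancel[of "q + H"] by simp
    finally show ?thesis using H by simp
  qed
  from le[of q] le[of "- q"] show ?thesis by simp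
qed

lemma continuous_lat_dist [continuous_intros]:
  "continuous_on A f \<Longrightarrow> continuous_on A (\<lambda>x. lat_dist (f x))"
  unfolding lat_dist_def by (rule continuous_on_infdist)

lemma borel_lat_dist [measurable]: "lat_dist \<in> borel_measurable borel"
  by (intro borel_measurable_continuous_onI continuous_intros)

definition zone_radius :: real where
  "zone_radius = (SOME R. R > 0 \<and> (\<forall>k\<in>zone S. norm k \<le> R))"

lemma zone_radius: "zone_radius > 0" "k \<in> zone S \<Longrightarrow> norm k \<le> zone_radius"
proof -
  have "\<exists>R. R > 0 \<and> (\<forall>k\<in>zone S. norm k \<le> R)"
    using zone_bounded unfolding bounded_pos by blast
  then have "zone_radius > 0 \<and> (\<forall>k\<in>zone S. norm k \<le> zone_radius)"
    unfolding zone_radius_def by (rule someI_ex)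
  then show "zone_radius > 0" "k \<in> zone S \<Longrightarrow> norm k \<le> zone_radius" by auto
qed

lemma fold_zone: "fold_zone S k \<in> zone S" "k - fold_zone S k \<in> reciprocal S"
  and fold_zone_eqI: "k' \<in> zone S \<Longrightarrow> k - k' \<in> reciprocal S \<Longrightarrow> fold_zone S k = k'"
proof -
  have ex1: "\<exists>!k'. k' \<in> zone S \<and> k - k' \<in> reciprocal S"
  proof -
    obtain R where R: "R \<in> reciprocal S" "k - R \<in> zone S"
      "\<And>R'. R' \<in> reciprocal S \<Longrightarrow> k - R' \<in> zone S \<Longrightarrow> R' = R"
      using zone_tiles unfolding tiles_def by metis
    show ?thesis
    proof (rule ex1I[of _ "k - R"])
      show "k - R \<in> zone S \<and> k - (k - R) \<in> reciprocal S" using R(1,2) by simp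
      show "k' = k - R" if "k' \<in> zone S \<and> k - k' \<in> reciprocal S" for k'
        using R(3)[of "k - k'"] that by (simp add: algebra_simps)
    qed
  qed
  from theI'[OF ex1] show "fold_zone S k \<in> zone S" "k - fold_zone S k \<in> reciprocal S"
    by (simp_all add: fold_zone_def)
  show "k' \<in> zone S \<Longrightarrow> k - k' \<in> reciprocal S \<Longrightarrow> fold_zone S k = k'"
    unfolding fold_zone_def using ex1 by (intro the1_equality) auto
qed

lemma fold_zone_cong:
  assumes "k - k' \<in> reciprocal S"
  shows "fold_zone S k = fold_zone S k'"
  using recip.add[OF assms fold_zone(2)[of k']]
  by (intro fold_zone_eqI fold_zone) (simp add: algebra_simps)

lemma lat_dist_le_radius: "lat_dist q \<le> zone_radius"
proof -
  have "lat_dist q \<le> norm (q + - (q - fold_zone S q))"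
    by (intro lat_dist_le recip.uminus fold_zone)
  then show ?thesis using zone_radius(2)[OF fold_zone(1)[of q]] by simp
qed

lemma borel_zone [measurable]: "zone S \<in> sets borel"
  using zone_tiles by (simp add: tiles_def)

lemma borel_fold_zone [measurable]: "fold_zone S \<in> borel_measurable borel"
proof (rule measurableI)
  fix A :: "vec3 set" assume A: "A \<in> sets borel"
  have eq: "fold_zone S -` A = (\<Union>G\<in>reciprocal S. (\<lambda>x. x - G) -` (A \<inter> zone S))"
  proof (intro set_eqI iffI)
    fix x assume "x \<in> fold_zone S -` A"
    then show "x \<in> (\<Union>G\<in>reciprocal S. (\<lambda>x. x - G) -` (A \<inter> zone S))"
      using fold_zone[of x] by (intro UN_I[of "x - fold_zone S x"]) auto
  next
    fix x assume "x \<in> (\<Union>G\<in>reciprocal S. (\<lambda>x. x - G) -` (A \<inter> zone S))"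
    then obtain G where G: "G \<in> reciprocal S" "x - G \<in> A" "x - G \<in> zone S" by auto
    then have "fold_zone S x = x - G" by (intro fold_zone_eqI) auto
    with G show "x \<in> fold_zone S -` A" by simp
  qed
  have "(\<lambda>x. x - G) -` (A \<inter> zone S) \<in> sets borel" for G
    using A by (intro measurable_sets_borel[of _ borel]) auto
  then have "fold_zone S -` A \<in> sets borel" unfolding eq by (intro sets.countable_UN') auto
  then show "fold_zone S -` A \<inter> space borel \<in> sets borel" by simp
qed simp

lemma emeasure_zone_finite: "emeasure lborel (zone S) < \<infinity>"
  by (rule emeasure_bounded_finite[OF zone_bounded])

lemma measure_zone_pos: "0 < measure lborel (zone S)"
  using recip.emeasure_tiles_pos[OF zone_tiles] emeasure_zone_finite
  by (simp add: measure_def enn2real_positive_iff)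

lemma emeasure_zone: "emeasure lborel (zone S) = ennreal (measure lborel (zone S))"
  using emeasure_zone_finite by (intro emeasure_eq_ennreal_measure) auto

end

section \<open>Replacing integrals by lattice sums\<close>

text \<open>At \<open>d = 0\<close> the right-hand side is \<open>\<infinity>\<close>, as the inverse of \<open>0\<close> in \<open>ennreal\<close>, because \<open>b > 0\<close>.\<close>

lemma ennreal_le_mult_inverse:
  assumes "a * d \<le> b" "0 \<le> a" "0 \<le> d" "0 < b"
  shows "ennreal a \<le> ennreal b * inverse (ennreal d)"
proof (cases "d = 0")
  case True
  with assms show ?thesis by (simp add: ennreal_mult_top)
next
  case False
  with assms have "a \<le> b * inverse d" by (simp add: field_simps)
  then have "ennreal a \<le> ennreal (b * inverse d)" by (rule ennreal_leI)
  also have "\<dots> = ennreal b * inverse (ennreal d)"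
    using assms False by (simp add: ennreal_mult inverse_ennreal)
  finally show ?thesis .
qed

text \<open>The map \<open>r\<close> is rounding to a mesh \<open>M\<close>. The points that are rounded into \<open>M\<close> form another tile,
  over which \<open>w\<close> times the sum over \<open>M\<close> is exactly the integral of \<open>h \<circ> r\<close>. The pointwise error is
  at most \<open>b / D\<close>, and integrals over this tile are integrals over \<open>A\<close>.\<close>

lemma (in translation_lattice) lattice_sum_error:
  fixes h :: "'a \<Rightarrow> complex"
  assumes A: "tiles \<Lambda> A" "emeasure lborel A < \<infinity>"
    and M: "finite M" "tiles \<Lambda> {z. r z \<in> M}"
    and Q: "\<And>k. k \<in> M \<Longrightarrow> {z. r z = k} \<in> sets borel"
      "\<And>k. k \<in> M \<Longrightarrow> emeasure lborel {z. r z = k} = ennreal w" and w: "w \<ge> 0"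
    and h [measurable]: "h \<in> borel_measurable borel" and bound: "\<And>z. norm (h z) \<le> C"
    and per: "\<And>R z. R \<in> \<Lambda> \<Longrightarrow> h (R + z) = h z"
    and D [measurable]: "D \<in> borel_measurable borel" and D0: "\<And>z. D z \<ge> 0"
    and Dper: "\<And>R z. R \<in> \<Lambda> \<Longrightarrow> D (R + z) = D z"
    and b: "b > 0" and err: "\<And>z. r z \<in> M \<Longrightarrow> norm (h z - h (r z)) * D z \<le> b"
  shows "ennreal (norm ((LINT z:A|lborel. h z) - of_real w * (\<Sum>k\<in>M. h k)))
    \<le> ennreal b * (\<integral>\<^sup>+z\<in>A. inverse (ennreal (D z)) \<partial>lborel)"
proof -
  define A' where "A' = {z. r z \<in> M}"
  have [measurable]: "A \<in> sets borel" "A' \<in> sets borel"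
    using A M by (auto simp: tiles_def A'_def)
  have int: "set_integrable lborel B h" if "tiles \<Lambda> B" for B
  proof -
    have "emeasure lborel B < \<infinity>" using emeasure_tiles_eq[OF that A(1)] A(2) by simp
    moreover have [measurable]: "B \<in> sets borel" using that by (simp add: tiles_def)
    ultimately have "integrable lborel (\<lambda>x. indicat_real B x *\<^sub>R C)"
      by (intro integrable_scaleR_left integrable_real_indicator) auto
    then show ?thesis
      unfolding set_integrable_def
      by (rule Bochner_Integration.integrable_bound)
        (auto simp: indicator_def intro!: AE_I2 order_trans[OF bound])
  qed
  define st where "st = (\<lambda>z. \<Sum>k\<in>M. indicator {z. r z = k} z *\<^sub>R h k)"
  have st_eq: "st z = (if r z \<in> M then h (r z) else 0)" for z
  proof -
    have "st z = (\<Sum>k\<in>M. if r z = k then h k else 0)"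
      unfolding st_def by (intro sum.cong) (auto simp: indicator_def)
    then show ?thesis using M(1) by (simp add: sum.delta)
  qed
  have piece: "has_bochner_integral lborel (\<lambda>z. indicator {z. r z = k} z *\<^sub>R h k) (of_real w * h k)"
    if "k \<in> M" for k
  proof -
    have "has_bochner_integral lborel (indicat_real {z. r z = k}) (measure lborel {z. r z = k})"
      using Q[OF that] by (intro has_bochner_integral_real_indicator) auto
    moreover have "measure lborel {z. r z = k} = w" using Q(2)[OF that] w by (simp add: measure_def)
    ultimately show ?thesis
      using has_bochner_integral_scaleR_left[of "h k" lborel "indicat_real {z. r z = k}" w]
      by (simp add: scaleR_conv_of_real)
  qed
  have st: "has_bochner_integral lborel st (of_real w * (\<Sum>k\<in>M. h k))"
    unfolding st_def sum_distrib_left by (intro has_bochner_integral_sum piece)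
  have "(LINT z:A|lborel. h z) = (LINT z:A'|lborel. h z)"
    using A(1) M(2) per int by (intro set_integral_tiles_eq) (auto simp: A'_def)
  then have "(LINT z:A|lborel. h z) - of_real w * (\<Sum>k\<in>M. h k)
      = (\<integral>z. indicator A' z *\<^sub>R h z - st z \<partial>lborel)"
    using st int[OF M(2)]
    by (subst Bochner_Integration.integral_diff)
      (auto simp: has_bochner_integral_iff set_lebesgue_integral_def set_integrable_def A'_def)
  also have "ennreal (norm \<dots>) \<le> (\<integral>\<^sup>+z. norm (indicator A' z *\<^sub>R h z - st z) \<partial>lborel)"
    using st int[OF M(2)] by (intro integral_norm_bound_ennreal Bochner_Integration.integrable_diff)
      (auto simp: has_bochner_integral_iff set_integrable_def A'_def)
  also have "\<dots> \<le> (\<integral>\<^sup>+z. ennreal b * (inverse (ennreal (D z)) * indicator A' z) \<partial>lborel)"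
  proof (rule nn_integral_mono)
    fix z
    show "ennreal (norm (indicator A' z *\<^sub>R h z - st z))
        \<le> ennreal b * (inverse (ennreal (D z)) * indicator A' z)"
      using ennreal_le_mult_inverse[OF err _ D0 b, of z]
      by (cases "r z \<in> M") (auto simp: A'_def st_eq)
  qed
  also have "\<dots> = ennreal b * (\<integral>\<^sup>+z\<in>A'. inverse (ennreal (D z)) \<partial>lborel)"
    by (intro nn_integral_cmult) auto
  also have "(\<integral>\<^sup>+z\<in>A'. inverse (ennreal (D z)) \<partial>lborel) = (\<integral>\<^sup>+z\<in>A. inverse (ennreal (D z)) \<partial>lborel)"
    using A(1) M(2) Dper by (intro nn_integral_tiles_eq) (auto simp: A'_def)
  finally show ?thesis .
qed

text \<open>On the dyadic shell of radius \<open>R / 2\<^sup>k\<close> the integrand is of order \<open>2\<^sup>k\<close> and the volume of order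
  \<open>8\<^sup>-\<^sup>k\<close>, so the shells contribute a geometric series of ratio \<open>1/4\<close>.\<close>

lemma nn_integral_inverse_norm_finite:
  assumes R: "R > 0"
  shows "(\<integral>\<^sup>+x\<in>cball 0 R. inverse (ennreal (norm x)) \<partial>(lborel :: vec3 measure)) < \<infinity>"
proof -
  have [measurable]: "cball (0::vec3) r \<in> sets borel" for r by (intro borel_closed closed_cball)
  let ?g = "\<lambda>k x. ennreal (2 ^ Suc k / R) * indicator (cball (0::vec3) (R / 2 ^ k)) x"
  have le: "inverse (ennreal (norm x)) * indicator (cball 0 R) x \<le> (\<Sum>k. ?g k x)"
    if "x \<noteq> 0" for x :: vec3
  proof (cases "x \<in> cball 0 R")
    case True
    have "\<exists>k. R / 2 ^ k < norm x"
    proof -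
      obtain k where "R / norm x < 2 ^ k" using real_arch_pow[of 2 "R / norm x"] by auto
      then show ?thesis using that by (intro exI[of _ k]) (simp add: field_simps)
    qed
    then obtain k where k: "R / 2 ^ k < norm x" "\<And>j. j < k \<Longrightarrow> \<not> R / 2 ^ j < norm x"
      using exists_least_iff[of "\<lambda>k. R / 2 ^ k < norm x"] by auto
    have "k \<noteq> 0" using k(1) True by (intro notI) simp
    then obtain j where j: "k = Suc j" by (cases k) auto
    have "inverse (norm x) \<le> 2 ^ Suc j / R"
      using k(1) R that unfolding j by (simp add: field_simps)
    then have "ennreal (inverse (norm x)) \<le> ?g j x"
      using k(2)[of j] j by (auto simp: indicator_def intro: ennreal_leI)
    also have "?g j x \<le> (\<Sum>k. ?g k x)"
      using sum_le_suminf[of "\<lambda>k. ?g k x" "{j}"] by (simp del: sum_mult_indicator)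
    finally show ?thesis using that True by (simp add: inverse_ennreal)
  qed simp
  have "(\<integral>\<^sup>+x\<in>cball 0 R. inverse (ennreal (norm x)) \<partial>(lborel :: vec3 measure))
      \<le> (\<integral>\<^sup>+x. (\<Sum>k. ?g k x) \<partial>lborel)"
  proof (rule nn_integral_mono_AE)
    show "AE x in lborel. inverse (ennreal (norm x)) * indicator (cball 0 R) x \<le> (\<Sum>k. ?g k x)"
      using AE_lborel_singleton[of 0] by eventually_elim (rule le)
  qed
  also have "\<dots> = (\<Sum>k. (\<integral>\<^sup>+x. ?g k x \<partial>lborel))"
    by (intro nn_integral_suminf) auto
  also have "\<dots> = (\<Sum>k. ennreal (2 * unit_ball_vol 3 * R\<^sup>2 * (1/4) ^ k))"
  proof (rule suminf_cong)
    fix k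
    have "(\<integral>\<^sup>+x. ?g k x \<partial>lborel) = ennreal (2 ^ Suc k / R) * ennreal (unit_ball_vol 3 * (R / 2 ^ k) ^ 3)"
      using R by (simp add: nn_integral_cmult_indicator emeasure_cball)
    also have "\<dots> = ennreal (2 ^ Suc k / R * (unit_ball_vol 3 * (R / 2 ^ k) ^ 3))"
      using R by (intro ennreal_mult[symmetric]) auto
    also have "2 ^ Suc k / R * (unit_ball_vol 3 * (R / 2 ^ k) ^ 3) = 2 * unit_ball_vol 3 * R\<^sup>2 * (1/4) ^ k"
    proof -
      have "(4::real) ^ k = 2 ^ k * 2 ^ k" by (simp add: power_mult_distrib[symmetric])
      then show ?thesis
        using R by (simp add: field_simps power2_eq_square power3_eq_cube)
    qed
    finally show "(\<integral>\<^sup>+x. ?g k x \<partial>lborel) = ennreal (2 * unit_ball_vol 3 * R\<^sup>2 * (1/4) ^ k)" .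
  qed
  also have "\<dots> = ennreal (\<Sum>k. 2 * unit_ball_vol 3 * R\<^sup>2 * (1/4) ^ k)"
    by (intro suminf_ennreal2 summable_mult summable_geometric) auto
  also have "\<dots> < \<infinity>" by simp
  finally show ?thesis .
qed

lemma emeasure_lborel_Times3:
  fixes A B C :: "vec3 set"
  assumes A: "A \<in> sets borel" and B: "B \<in> sets borel" and C: "C \<in> sets borel"
  shows "emeasure lborel (A \<times> B \<times> C) = emeasure lborel A * (emeasure lborel B * emeasure lborel C)"
proof -
  have BC: "B \<times> C \<in> sets (borel :: (vec3 \<times> vec3) measure)"
    using B C by (auto simp: borel_prod[symmetric])
  have "emeasure lborel (A \<times> B \<times> C) = emeasure (lborel \<Otimes>\<^sub>M lborel) (A \<times> B \<times> C)"
    by (simp add: lborel_prod)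
  also have "\<dots> = emeasure lborel A * emeasure lborel (B \<times> C)"
    using A BC by (intro lborel.emeasure_pair_measure_Times) auto
  also have "emeasure lborel (B \<times> C) = emeasure (lborel \<Otimes>\<^sub>M lborel) (B \<times> C)"
    by (simp add: lborel_prod)
  also have "\<dots> = emeasure lborel B * emeasure lborel C"
    using B C by (intro lborel.emeasure_pair_measure_Times) auto
  finally show ?thesis .
qed

context insulating_system
begin

text \<open>The inverse of the distance is one of the terms \<open>1/|q + G|\<close> with \<open>|q + G|\<close> at most the radius of
  the zone; the sum of all such terms unfolds to the integral of \<open>1/|x|\<close> over a ball.\<close>

lemma nn_integral_inverse_lat_dist_finite:
  "(\<integral>\<^sup>+q\<in>zone S. inverse (ennreal (lat_dist q)) \<partial>lborel) < \<infinity>"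
proof -
  have [measurable]: "cball (0::vec3) r \<in> sets borel" for r by (intro borel_closed closed_cball)
  let ?\<phi> = "\<lambda>x::vec3. inverse (ennreal (norm x)) * indicator (cball 0 zone_radius) x"
  have "inverse (ennreal (lat_dist q)) \<le> (\<integral>\<^sup>+G. ?\<phi> (G + q) \<partial>count_space (reciprocal S))" for q
  proof -
    obtain G where G: "G \<in> reciprocal S" "lat_dist q = norm (q + G)"
      using lat_dist_attained by blast
    then have "inverse (ennreal (lat_dist q)) = ?\<phi> (G + q)"
      using lat_dist_le_radius[of q] by (simp add: indicator_def add.commute)
    also have "\<dots> \<le> (\<integral>\<^sup>+G. ?\<phi> (G + q) \<partial>count_space (reciprocal S))"
      by (rule nn_integral_ge_point[OF G(1)])
    finally show ?thesis .
  qed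
  then have "(\<integral>\<^sup>+q\<in>zone S. inverse (ennreal (lat_dist q)) \<partial>lborel)
      \<le> (\<integral>\<^sup>+q\<in>zone S. (\<integral>\<^sup>+G. ?\<phi> (G + q) \<partial>count_space (reciprocal S)) \<partial>lborel)"
    by (intro nn_integral_mono mult_right_mono) auto
  also have "\<dots> = (\<integral>\<^sup>+x. ?\<phi> x \<partial>lborel)" by (rule recip.nn_integral_unfold[OF zone_tiles]) measurable
  also have "\<dots> < \<infinity>" by (rule nn_integral_inverse_norm_finite[OF zone_radius(1)])
  finally show ?thesis .
qed

abbreviation zone3 :: "(vec3 \<times> vec3 \<times> vec3) set" where
  "zone3 \<equiv> zone S \<times> zone S \<times> zone S"

abbreviation reciprocal3 :: "(vec3 \<times> vec3 \<times> vec3) set" where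
  "reciprocal3 \<equiv> reciprocal S \<times> reciprocal S \<times> reciprocal S"

sublocale recip3: translation_lattice reciprocal3
  by (intro translation_lattice_Times recip.translation_lattice_axioms)

lemma zone3_tiles: "tiles reciprocal3 zone3"
  by (intro tiles_Times zone_tiles)

lemma emeasure_zone3: "emeasure lborel zone3 = ennreal (measure lborel (zone S) ^ 3)"
  by (simp add: emeasure_lborel_Times3 emeasure_zone ennreal_mult[symmetric] power3_eq_cube)

text \<open>The direct part of \<open>W\<close> is singular where \<open>k\<^sub>a - k\<^sub>i\<close> is a lattice vector, its exchange part where
  \<open>k\<^sub>j - k\<^sub>a\<close> is one; the amplitudes share the first singularity.\<close>

definition sing_dist :: "vec3 \<times> vec3 \<times> vec3 \<Rightarrow> real" where
  "sing_dist = (\<lambda>(ki, kj, ka). min (lat_dist (ka - ki)) (lat_dist (kj - ka)))"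

lemma sing_dist_nonneg: "0 \<le> sing_dist z"
  by (auto simp: sing_dist_def lat_dist_nonneg split: prod.split)

lemma continuous_sing_dist: "continuous_on UNIV sing_dist"
  unfolding sing_dist_def split_beta by (intro continuous_intros)

lemma borel_sing_dist [measurable]: "sing_dist \<in> borel_measurable borel"
  by (intro borel_measurable_continuous_onI continuous_sing_dist)

lemma sing_dist_periodic: "R \<in> reciprocal3 \<Longrightarrow> sing_dist (R + z) = sing_dist z"
proof -
  assume R: "R \<in> reciprocal3"
  obtain x y w where z: "z = (x, y, w)" by (cases z) auto
  obtain a b c where R': "R = (a, b, c)" by (cases R) auto
  have "lat_dist (c + w - (a + x)) = lat_dist (w - x)" "lat_dist (b + y - (c + w)) = lat_dist (y - w)"
    using lat_dist_add[of "c - a" "w - x"] lat_dist_add[of "b - c" "y - w"] R recip.diff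
    by (auto simp: R' algebra_simps)
  then show ?thesis by (simp add: sing_dist_def z R')
qed

lemma nn_integral_zone_shift:
  "(\<integral>\<^sup>+k\<in>zone S. inverse (ennreal (lat_dist (k - c))) \<partial>lborel)
    = (\<integral>\<^sup>+q\<in>zone S. inverse (ennreal (lat_dist q)) \<partial>lborel)"
proof -
  have "(\<integral>\<^sup>+k\<in>zone S. inverse (ennreal (lat_dist (k - c))) \<partial>lborel)
      = (\<integral>\<^sup>+q. inverse (ennreal (lat_dist (c + q - c))) * indicator (zone S) (c + q) \<partial>lborel)"
    by (intro nn_integral_lborel_shift[symmetric]) measurable
  also have "\<dots> = (\<integral>\<^sup>+q\<in>(\<lambda>x. x + c) -` zone S. inverse (ennreal (lat_dist q)) \<partial>lborel)"
    by (intro nn_integral_cong) (simp add: indicator_def add.commute)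
  also have "\<dots> = (\<integral>\<^sup>+q\<in>zone S. inverse (ennreal (lat_dist q)) \<partial>lborel)"
    by (intro recip.nn_integral_tiles_eq recip.tiles_shift zone_tiles) (auto simp: lat_dist_add)
  finally show ?thesis .
qed

text \<open>The momentum \<open>k\<^sub>a\<close> is integrated first; shifting it by \<open>c\<close> moves the zone to another tile, so that the
  inner integral does not depend on \<open>k\<^sub>i\<close> and \<open>k\<^sub>j\<close>.\<close>

lemma nn_integral_zone3:
  assumes c [measurable]: "c \<in> borel_measurable borel"
  shows "(\<integral>\<^sup>+z\<in>zone3. (case z of (ki, kj, ka) \<Rightarrow> inverse (ennreal (lat_dist (ka - c (ki, kj))))) \<partial>lborel)
    = emeasure lborel (zone S) * (emeasure lborel (zone S) *
        (\<integral>\<^sup>+q\<in>zone S. inverse (ennreal (lat_dist q)) \<partial>lborel))"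
proof -
  let ?J = "\<integral>\<^sup>+q\<in>zone S. inverse (ennreal (lat_dist q)) \<partial>lborel"
  let ?f = "\<lambda>z. (case z of (ki, kj, ka) \<Rightarrow> inverse (ennreal (lat_dist (ka - c (ki, kj))))) * indicator zone3 z"
  have c' [measurable]: "c \<in> borel_measurable (borel \<Otimes>\<^sub>M borel)" using c by (simp add: borel_prod)
  have f: "?f \<in> borel_measurable (borel \<Otimes>\<^sub>M (borel \<Otimes>\<^sub>M borel))"
    by measurable
  have "(\<integral>\<^sup>+z. ?f z \<partial>lborel) = (\<integral>\<^sup>+z. ?f z \<partial>(lborel \<Otimes>\<^sub>M (lborel \<Otimes>\<^sub>M lborel)))"
    by (simp add: lborel_prod)
  also have "\<dots> = (\<integral>\<^sup>+x. \<integral>\<^sup>+y. ?f (x, y) \<partial>(lborel \<Otimes>\<^sub>M lborel) \<partial>lborel)"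
    using f by (intro sigma_finite_measure.nn_integral_fst[symmetric])
      (auto simp: lborel_prod borel_prod intro: lborel.sigma_finite_measure_axioms)
  also have "\<dots> = (\<integral>\<^sup>+x. \<integral>\<^sup>+y. \<integral>\<^sup>+w. ?f (x, y, w) \<partial>lborel \<partial>lborel \<partial>lborel)"
  proof (intro nn_integral_cong lborel.nn_integral_fst[symmetric])
    fix x
    have "(\<lambda>y. ?f (x, y)) \<in> borel_measurable (borel \<Otimes>\<^sub>M borel)" using f by measurable
    then show "(\<lambda>y. ?f (x, y)) \<in> borel_measurable (lborel \<Otimes>\<^sub>M lborel)"
      by (simp add: borel_prod lborel_prod)
  qed
  also have "\<dots> = (\<integral>\<^sup>+x. \<integral>\<^sup>+y. ?J * indicator (zone S) y * indicator (zone S) x \<partial>lborel \<partial>lborel)"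
  proof (intro nn_integral_cong)
    fix x y
    have "(\<integral>\<^sup>+w. ?f (x, y, w) \<partial>lborel)
        = (\<integral>\<^sup>+w. (inverse (ennreal (lat_dist (w - c (x, y)))) * indicator (zone S) w)
            * (indicator (zone S) y * indicator (zone S) x) \<partial>lborel)"
      by (intro nn_integral_cong) (auto simp: indicator_def)
    also have "\<dots> = ?J * (indicator (zone S) y * indicator (zone S) x)"
      by (subst nn_integral_multc) (auto simp: nn_integral_zone_shift)
    finally show "(\<integral>\<^sup>+w. ?f (x, y, w) \<partial>lborel) = ?J * indicator (zone S) y * indicator (zone S) x"
      by (simp add: mult.assoc)
  qed
  also have "\<dots> = emeasure lborel (zone S) * (emeasure lborel (zone S) * ?J)"
    by (simp add: nn_integral_cmult nn_integral_multc ac_simps)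
  finally show ?thesis .
qed

lemma nn_integral_inverse_sing_dist_finite:
  "(\<integral>\<^sup>+z\<in>zone3. inverse (ennreal (sing_dist z)) \<partial>lborel) < \<infinity>"
proof -
  have [measurable]: "zone3 \<in> sets borel" using zone3_tiles by (simp add: tiles_def)
  let ?a = "\<lambda>z. case z of (ki, kj, ka) \<Rightarrow> inverse (ennreal (lat_dist (ka - fst (ki, kj :: vec3))))"
  let ?b = "\<lambda>z. case z of (ki, kj, ka) \<Rightarrow> inverse (ennreal (lat_dist (ka - snd (ki :: vec3, kj))))"
  have "lat_dist \<circ> (\<lambda>z::vec3\<times>vec3\<times>vec3. snd (snd z) - fst z) \<in> borel_measurable borel"
    "lat_dist \<circ> (\<lambda>z::vec3\<times>vec3\<times>vec3. snd (snd z) - fst (snd z)) \<in> borel_measurable borel"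
    by (intro borel_measurable_continuous_onI; simp add: comp_def; intro continuous_intros)+
  then have [measurable]: "?a \<in> borel_measurable borel" "?b \<in> borel_measurable borel"
    by (simp_all add: split_beta comp_def)
  have "inverse (ennreal (sing_dist z)) \<le> ?a z + ?b z" for z
    using lat_dist_uminus[of "fst (snd z) - snd (snd z)"]
    by (cases z) (auto simp: sing_dist_def min_def)
  then have "(\<integral>\<^sup>+z\<in>zone3. inverse (ennreal (sing_dist z)) \<partial>lborel)
      \<le> (\<integral>\<^sup>+z. ?a z * indicator zone3 z + ?b z * indicator zone3 z \<partial>lborel)"
    by (intro nn_integral_mono) (auto simp: indicator_def)
  also have "\<dots> = (\<integral>\<^sup>+z\<in>zone3. ?a z \<partial>lborel) + (\<integral>\<^sup>+z\<in>zone3. ?b z \<partial>lborel)"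
    by (intro nn_integral_add) measurable
  also have "\<dots> < \<infinity>"
    using nn_integral_inverse_lat_dist_finite emeasure_zone_finite
    by (subst (1 2) nn_integral_zone3)
      (auto simp: borel_prod[symmetric] ennreal_mult_less_top)
  finally show ?thesis .
qed

end

section \<open>Mild singularities\<close>

text \<open>The function is bounded, and its Lipschitz constant near \<open>z\<close> is of order \<open>1 / D z\<close>, where \<open>D z\<close> is the
  distance from \<open>z\<close> to a singular set: a first-order form of an algebraic singularity of order 0.
  Multiplying by \<open>D\<close> instead of dividing admits \<open>D z = 0\<close>, and as \<open>F\<close> is bounded the estimate may be
  demanded for all pairs \<open>z, w\<close>, which makes the notion stable under sums, products and Lipschitz
  substitutions.\<close>

definition mild :: "('a::metric_space \<Rightarrow> real) \<Rightarrow> ('a \<Rightarrow> complex) \<Rightarrow> bool" where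
  "mild D F \<longleftrightarrow>
    (\<exists>C. (\<forall>z. norm (F z) \<le> C) \<and> (\<forall>z w. norm (F z - F w) * D z \<le> C * dist z w))"

lemma mildE:
  assumes "mild D F"
  obtains C where "C > 0" "\<And>z. norm (F z) \<le> C" "\<And>z w. norm (F z - F w) * D z \<le> C * dist z w"
proof -
  obtain C where C: "\<And>z. norm (F z) \<le> C" "\<And>z w. norm (F z - F w) * D z \<le> C * dist z w"
    using assms unfolding mild_def by blast
  show ?thesis
  proof (rule that[of "\<bar>C\<bar> + 1"])
    show "norm (F z) \<le> \<bar>C\<bar> + 1" for z using C(1)[of z] by linarith
    show "norm (F z - F w) * D z \<le> (\<bar>C\<bar> + 1) * dist z w" for z w
      using C(2)[of z w] by (rule order_trans) (intro mult_right_mono, auto)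
  qed auto
qed

text \<open>For distant points the bound on \<open>F\<close> suffices, since then \<open>D z\<close> is at most a multiple of the distance.\<close>

lemma mildI_near:
  assumes bound: "\<And>z. norm (F z) \<le> B" and D: "\<And>z. D z \<ge> 0" and c: "c > 0"
    and near: "\<And>z w. dist z w \<le> c * D z \<Longrightarrow> norm (F z - F w) * D z \<le> K * dist z w"
  shows "mild D F"
  unfolding mild_def
proof (intro exI[of _ "\<bar>K\<bar> + \<bar>B\<bar> + 2 * \<bar>B\<bar> / c"] conjI allI)
  fix z w
  have nn: "0 \<le> 2 * \<bar>B\<bar> / c" using c by simp
  show "norm (F z) \<le> \<bar>K\<bar> + \<bar>B\<bar> + 2 * \<bar>B\<bar> / c" using bound[of z] nn by linarith
  show "norm (F z - F w) * D z \<le> (\<bar>K\<bar> + \<bar>B\<bar> + 2 * \<bar>B\<bar> / c) * dist z w"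
  proof (cases "dist z w \<le> c * D z")
    case True
    have "K * dist z w \<le> (\<bar>K\<bar> + \<bar>B\<bar> + 2 * \<bar>B\<bar> / c) * dist z w"
      using nn by (intro mult_right_mono) auto
    with near[OF True] show ?thesis by linarith
  next
    case False
    have "norm (F z - F w) \<le> norm (F z) + norm (F w)" by (rule norm_triangle_ineq4)
    then have "norm (F z - F w) \<le> 2 * \<bar>B\<bar>" using bound[of z] bound[of w] by linarith
    moreover have "D z \<le> dist z w / c" using False c by (simp add: field_simps)
    ultimately have "norm (F z - F w) * D z \<le> (2 * \<bar>B\<bar>) * (dist z w / c)"
      using D by (intro mult_mono) auto
    also have "\<dots> = (2 * \<bar>B\<bar> / c) * dist z w" by simp
    also have "\<dots> \<le> (\<bar>K\<bar> + \<bar>B\<bar> + 2 * \<bar>B\<bar> / c) * dist z w"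
      by (intro mult_right_mono) auto
    finally show ?thesis .
  qed
qed

lemma mild_mono:
  assumes "mild D F" "\<And>z. D' z \<le> D z"
  shows "mild D' F"
proof -
  obtain C where C: "C > 0" "\<And>z. norm (F z) \<le> C" "\<And>z w. norm (F z - F w) * D z \<le> C * dist z w"
    using mildE[OF assms(1)] by blast
  have "norm (F z - F w) * D' z \<le> C * dist z w" for z w
    using mult_left_mono[OF assms(2)[of z] norm_ge_zero[of "F z - F w"]] C(3)[of z w] by linarith
  with C show ?thesis unfolding mild_def by blast
qed

lemma mild_add:
  assumes "mild D F" "mild D G" "\<And>z. D z \<ge> 0"
  shows "mild D (\<lambda>z. F z + G z)"
proof -
  obtain C where C: "C > 0" "\<And>z. norm (F z) \<le> C" "\<And>z w. norm (F z - F w) * D z \<le> C * dist z w"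
    using mildE[OF assms(1)] by blast
  obtain B where B: "B > 0" "\<And>z. norm (G z) \<le> B" "\<And>z w. norm (G z - G w) * D z \<le> B * dist z w"
    using mildE[OF assms(2)] by blast
  show ?thesis unfolding mild_def
  proof (intro exI[of _ "C + B"] conjI allI)
    fix z w
    show "norm (F z + G z) \<le> C + B"
      using norm_triangle_ineq[of "F z" "G z"] C(2)[of z] B(2)[of z] by linarith
    have "norm (F z + G z - (F w + G w)) \<le> norm (F z - F w) + norm (G z - G w)"
      by (metis add_diff_add norm_triangle_ineq)
    then have "norm (F z + G z - (F w + G w)) * D z \<le> (norm (F z - F w) + norm (G z - G w)) * D z"
      using assms(3) by (intro mult_right_mono)
    then show "norm (F z + G z - (F w + G w)) * D z \<le> (C + B) * dist z w"
      using C(3)[of z w] B(3)[of z w] by (simp add: algebra_simps)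
  qed
qed

lemma mild_mult:
  assumes "mild D F" "mild D G" "\<And>z. D z \<ge> 0"
  shows "mild D (\<lambda>z. F z * G z)"
proof -
  obtain C where C: "C > 0" "\<And>z. norm (F z) \<le> C" "\<And>z w. norm (F z - F w) * D z \<le> C * dist z w"
    using mildE[OF assms(1)] by blast
  obtain B where B: "B > 0" "\<And>z. norm (G z) \<le> B" "\<And>z w. norm (G z - G w) * D z \<le> B * dist z w"
    using mildE[OF assms(2)] by blast
  show ?thesis unfolding mild_def
  proof (intro exI[of _ "C * B + C * B"] conjI allI)
    fix z w
    have "norm (F z * G z) \<le> C * B"
      unfolding norm_mult using C(1,2) B(2) by (intro mult_mono) auto
    then show "norm (F z * G z) \<le> C * B + C * B" using mult_pos_pos[OF C(1) B(1)] by linarith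
    have "F z * G z - F w * G w = (F z - F w) * G z + F w * (G z - G w)" by (simp add: algebra_simps)
    then have "norm (F z * G z - F w * G w)
        \<le> norm (F z - F w) * norm (G z) + norm (F w) * norm (G z - G w)"
      by (metis norm_mult norm_triangle_ineq)
    also have "\<dots> \<le> norm (F z - F w) * B + C * norm (G z - G w)"
      using B(2) C(2) by (intro add_mono mult_left_mono mult_right_mono) auto
    finally have "norm (F z * G z - F w * G w) * D z
        \<le> (norm (F z - F w) * B + C * norm (G z - G w)) * D z"
      using assms(3) by (intro mult_right_mono)
    also have "\<dots> = (norm (F z - F w) * D z) * B + C * (norm (G z - G w) * D z)"
      by (simp add: algebra_simps)
    also have "\<dots> \<le> (C * dist z w) * B + C * (B * dist z w)"
      using B(1,3) C(1,3) by (intro add_mono mult_left_mono mult_right_mono) auto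
    finally show "norm (F z * G z - F w * G w) * D z \<le> (C * B + C * B) * dist z w"
      by (simp add: algebra_simps)
  qed
qed

lemma mild_const:
  "mild D (\<lambda>_. c)"
  unfolding mild_def by (intro exI[of _ "norm c"]) auto

lemma mild_cmult:
  "mild D F \<Longrightarrow> (\<And>z. D z \<ge> 0) \<Longrightarrow> mild D (\<lambda>z. c * F z)"
  by (rule mild_mult[OF mild_const])

lemma mild_diff:
  assumes "mild D F" "mild D G" "\<And>z. D z \<ge> 0"
  shows "mild D (\<lambda>z. F z - G z)"
  using mild_add[OF assms(1) mild_cmult[OF assms(2), of "- 1"]] assms(3) by simp

lemma mild_sum:
  assumes "\<And>i. i \<in> I \<Longrightarrow> mild D (F i)" "\<And>z. D z \<ge> 0"
  shows "mild D (\<lambda>z. \<Sum>i\<in>I. F i z)"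
  using assms by (induction I rule: infinite_finite_induct) (auto intro: mild_add mild_const)

lemma mild_compose:
  assumes "mild D F" "\<And>z w. dist (\<phi> z) (\<phi> w) \<le> K * dist z w" "K \<ge> 0"
  shows "mild (\<lambda>z. D (\<phi> z)) (\<lambda>z. F (\<phi> z))"
proof -
  obtain C where C: "C > 0" "\<And>z. norm (F z) \<le> C" "\<And>z w. norm (F z - F w) * D z \<le> C * dist z w"
    using mildE[OF assms(1)] by blast
  show ?thesis unfolding mild_def
  proof (intro exI[of _ "C + C * K"] conjI allI)
    fix z w
    have "0 \<le> C * K" using C(1) assms(3) by simp
    then show "norm (F (\<phi> z)) \<le> C + C * K" using C(2)[of "\<phi> z"] by linarith
    have "norm (F (\<phi> z) - F (\<phi> w)) * D (\<phi> z) \<le> C * (K * dist z w)"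
      using C(3)[of "\<phi> z" "\<phi> w"] mult_left_mono[OF assms(2)[of z w], of C] C(1) by linarith
    also have "\<dots> \<le> (C + C * K) * dist z w" using C(1) by (simp add: algebra_simps)
    finally show "norm (F (\<phi> z) - F (\<phi> w)) * D (\<phi> z) \<le> (C + C * K) * dist z w" .
  qed
qed

lemma mild_continuous_on:
  assumes "mild D F" and D: "\<And>z. z \<in> U \<Longrightarrow> D z > 0"
  shows "continuous_on U F"
  unfolding continuous_on_iff
proof (intro ballI allI impI)
  obtain C where C: "C > 0" "\<And>z. norm (F z) \<le> C" "\<And>z w. norm (F z - F w) * D z \<le> C * dist z w"
    using mildE[OF assms(1)] by blast
  fix z e assume z: "z \<in> U" and e: "(e::real) > 0"
  show "\<exists>d>0. \<forall>x'\<in>U. dist x' z < d \<longrightarrow> dist (F x') (F z) < e"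
  proof (intro exI[of _ "e * D z / C"] conjI ballI impI)
    show "0 < e * D z / C" using e D[OF z] C(1) by simp
    fix w assume "dist w z < e * D z / C"
    then have "C * dist z w < e * D z" using C(1) by (simp add: field_simps dist_commute)
    with C(3)[of z w] have "norm (F z - F w) * D z < e * D z" by linarith
    then show "dist (F w) (F z) < e"
      using D[OF z] by (simp add: dist_norm norm_minus_commute)
  qed
qed

text \<open>Energy integrals are taken over \<open>lborel\<close>, where a function has to be Borel measurable on the null
  set \<open>D = 0\<close> as well; there it agrees with some continuous function.\<close>

lemma mild_borel:
  fixes F :: "'a::euclidean_space \<Rightarrow> complex"
  assumes "mild D F" and D: "continuous_on UNIV D" "\<And>z. D z \<ge> 0"
    and G: "continuous_on UNIV G" "\<And>z. D z = 0 \<Longrightarrow> F z = G z"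
  shows "F \<in> borel_measurable borel"
proof -
  have op: "open {z. D z > 0}"
    using open_Collect_less[OF continuous_on_const D(1)] by simp
  have "(\<lambda>z. indicator {z. D z > 0} z *\<^sub>R F z) \<in> borel_measurable borel"
    using op by (intro borel_measurable_continuous_on_indicator mild_continuous_on[OF assms(1)]) auto
  moreover have "(\<lambda>z. indicator (- {z. D z > 0}) z *\<^sub>R G z) \<in> borel_measurable borel"
    using op by (intro borel_measurable_continuous_on_indicator continuous_on_subset[OF G(1)]) auto
  ultimately have "(\<lambda>z. indicator {z. D z > 0} z *\<^sub>R F z + indicator (- {z. D z > 0}) z *\<^sub>R G z)
      \<in> borel_measurable borel"
    by (rule borel_measurable_add)
  moreover have "F z = indicator {z. D z > 0} z *\<^sub>R F z + indicator (- {z. D z > 0}) z *\<^sub>R G z" for z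
    using D(2)[of z] G(2)[of z] by (cases "D z = 0") (auto simp: indicator_def)
  ultimately show ?thesis by (subst measurable_cong) auto
qed

context insulating_system
begin

section \<open>Rounding to the mesh\<close>

lemma scale_reciprocal: "G \<in> reciprocal S \<Longrightarrow> real n *\<^sub>R G \<in> reciprocal S"
  by (induction n) (auto simp: recip.zero scaleR_add_left intro: recip.add)

text \<open>The remainder \<open>x - mesh_round s n x\<close> lies in the zone shrunk by the factor \<open>n\<close>, which tiles the space
  under the translations of the lattice \<open>L\<^sup>*/n\<close> of mesh vectors.\<close>

definition mesh_round :: "(nat \<Rightarrow> vec3) \<Rightarrow> nat \<Rightarrow> vec3 \<Rightarrow> vec3" where
  "mesh_round s n x = x - (1 / real n) *\<^sub>R fold_zone S (real n *\<^sub>R (x - s n))"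

context
  fixes s :: "nat \<Rightarrow> vec3" and n :: nat
  assumes n: "n > 0"
begin

lemma mesh_round_lattice: "real n *\<^sub>R (mesh_round s n x - s n) \<in> reciprocal S"
  using fold_zone(2)[of "real n *\<^sub>R (x - s n)"] n
  by (simp add: mesh_round_def scaleR_diff_right algebra_simps)

lemma dist_mesh_round: "dist x (mesh_round s n x) \<le> zone_radius / n"
  using zone_radius(2)[OF fold_zone(1)[of "real n *\<^sub>R (x - s n)"]] n
  by (simp add: mesh_round_def dist_norm divide_right_mono)

lemma mesh_round_add:
  assumes "G \<in> reciprocal S" shows "mesh_round s n (G + x) = G + mesh_round s n x"
proof -
  have "fold_zone S (real n *\<^sub>R (G + x - s n)) = fold_zone S (real n *\<^sub>R (x - s n))"
    using scale_reciprocal[OF assms, of n]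
    by (intro fold_zone_cong) (simp add: scaleR_diff_right scaleR_add_right)
  then show ?thesis by (simp add: mesh_round_def)
qed

lemma mesh_round_eq_iff:
  assumes "real n *\<^sub>R (k - s n) \<in> reciprocal S"
  shows "mesh_round s n x = k \<longleftrightarrow> real n *\<^sub>R (x - k) \<in> zone S"
proof
  assume "mesh_round s n x = k"
  then have "real n *\<^sub>R (x - k) = fold_zone S (real n *\<^sub>R (x - s n))"
    using n by (auto simp: mesh_round_def)
  then show "real n *\<^sub>R (x - k) \<in> zone S" using fold_zone(1) by simp
next
  assume "real n *\<^sub>R (x - k) \<in> zone S"
  then have "fold_zone S (real n *\<^sub>R (x - s n)) = real n *\<^sub>R (x - k)"
    using assms by (intro fold_zone_eqI) (simp_all add: scaleR_diff_right)
  then show "mesh_round s n x = k" using n by (simp add: mesh_round_def)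
qed

lemma mesh_round_in_mesh_iff: "mesh_round s n x \<in> mesh S s n \<longleftrightarrow> mesh_round s n x \<in> zone S"
  by (simp add: mesh_def mesh_round_lattice)

lemma borel_mesh_round [measurable]: "mesh_round s n \<in> borel_measurable borel"
  unfolding mesh_round_def by measurable

text \<open>Rounding commutes with reciprocal translations, so the points that are rounded into the zone form a
  fundamental domain just as the zone does.\<close>

lemma tiles_mesh_round: "tiles (reciprocal S) {x. mesh_round s n x \<in> mesh S s n}"
  unfolding tiles_def mesh_round_in_mesh_iff
proof (intro conjI allI)
  show "{x. mesh_round s n x \<in> zone S} \<in> sets borel" by measurable
  fix x
  obtain R where R: "R \<in> reciprocal S" "mesh_round s n x - R \<in> zone S"
    "\<And>R'. R' \<in> reciprocal S \<Longrightarrow> mesh_round s n x - R' \<in> zone S \<Longrightarrow> R' = R"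
    using zone_tiles unfolding tiles_def by metis
  have eq: "mesh_round s n (x - R) = mesh_round s n x - R" if "R \<in> reciprocal S" for R
    using mesh_round_add[OF recip.uminus[OF that], of x] by simp
  show "\<exists>!R. R \<in> reciprocal S \<and> x - R \<in> {x. mesh_round s n x \<in> zone S}"
  proof (rule ex1I[of _ R])
    show "R \<in> reciprocal S \<and> x - R \<in> {x. mesh_round s n x \<in> zone S}" using R(1,2) eq by simp
    show "R' = R" if "R' \<in> reciprocal S \<and> x - R' \<in> {x. mesh_round s n x \<in> zone S}" for R'
      using R(3)[of R'] that eq[of R'] by simp
  qed
qed

lemma emeasure_mesh_cell:
  assumes "k \<in> mesh S s n"
  shows "emeasure lborel {x. mesh_round s n x = k} = ennreal (measure lborel (zone S) / real n ^ 3)"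
proof -
  let ?T = "\<lambda>x. - (real n *\<^sub>R k) + real n *\<^sub>R x"
  have eq: "{x. mesh_round s n x = k} = ?T -` zone S"
    using assms by (auto simp: mesh_def mesh_round_eq_iff algebra_simps)
  have "emeasure lborel (zone S) = emeasure (density (distr lborel borel ?T) (\<lambda>_. \<bar>real n\<bar> ^ DIM(vec3))) (zone S)"
    using n by (subst lborel_affine[of "real n" "- (real n *\<^sub>R k)"]) auto
  also have "\<dots> = ennreal (real n ^ 3) * emeasure lborel {x. mesh_round s n x = k}"
    by (subst emeasure_density)
      (auto simp: nn_integral_cmult nn_integral_distr emeasure_distr eq ennreal_power)
  finally have e: "ennreal (measure lborel (zone S)) = ennreal (real n ^ 3) * emeasure lborel {x. mesh_round s n x = k}"
    by (simp add: emeasure_zone)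
  have "emeasure lborel {x. mesh_round s n x = k} = ennreal (measure lborel (zone S)) / ennreal (real n ^ 3)"
    using n ennreal_mult_divide_eq[of "ennreal (real n ^ 3)" "emeasure lborel {x. mesh_round s n x = k}"]
    by (simp add: e mult.commute)
  then show ?thesis using n by (simp add: divide_ennreal)
qed

text \<open>The points rounded into the mesh have the volume of the zone, and each mesh point accounts for the
  volume of the zone divided by \<open>n\<^sup>3\<close>.\<close>

lemma card_mesh: "card (mesh S s n) = n ^ 3" and finite_mesh: "finite (mesh S s n)"
proof -
  let ?w = "measure lborel (zone S) / real n ^ 3"
  let ?Q = "\<lambda>k. {x. mesh_round s n x = k}"
  have w: "?w > 0" using measure_zone_pos n by simp
  have bound: "finite M \<and> real (card M) * ?w \<le> measure lborel (zone S)" if "finite M" "M \<subseteq> mesh S s n" for M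
  proof -
    have "real (card M) * ?w = (\<Sum>k\<in>M. ?w)" by simp
    also have "ennreal \<dots> = (\<Sum>k\<in>M. emeasure lborel (?Q k))"
      using that w by (subst sum_ennreal[symmetric]) (auto intro!: sum.cong simp: emeasure_mesh_cell subset_iff)
    also have "\<dots> = emeasure lborel (\<Union>k\<in>M. ?Q k)"
      using that by (intro sum_emeasure) (auto simp: disjoint_family_on_def)
    also have "\<dots> \<le> emeasure lborel {x. mesh_round s n x \<in> mesh S s n}"
      using that tiles_mesh_round by (intro emeasure_mono) (auto simp: tiles_def)
    also have "\<dots> = ennreal (measure lborel (zone S))"
      using recip.emeasure_tiles_eq[OF tiles_mesh_round zone_tiles] by (simp add: emeasure_zone)
    finally show ?thesis using that by (simp add: ennreal_le_iff)
  qed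
  show fin: "finite (mesh S s n)"
  proof (rule ccontr)
    assume inf: "infinite (mesh S s n)"
    obtain m :: nat where m: "measure lborel (zone S) < real m * ?w"
      using reals_Archimedean3[OF w] by blast
    obtain M where "M \<subseteq> mesh S s n" "finite M" "card M = m"
      using infinite_arbitrarily_large[OF inf] by blast
    with bound[of M] m show False by simp
  qed
  have "real (card (mesh S s n)) * ?w = (\<Sum>k\<in>mesh S s n. ?w)" by simp
  also have "ennreal \<dots> = (\<Sum>k\<in>mesh S s n. emeasure lborel (?Q k))"
    using w by (subst sum_ennreal[symmetric]) (auto intro!: sum.cong simp: emeasure_mesh_cell)
  also have "\<dots> = emeasure lborel (\<Union>k\<in>mesh S s n. ?Q k)"
    using fin by (intro sum_emeasure) (auto simp: disjoint_family_on_def)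
  also have "(\<Union>k\<in>mesh S s n. ?Q k) = {x. mesh_round s n x \<in> mesh S s n}" by auto
  also have "emeasure lborel \<dots> = ennreal (measure lborel (zone S))"
    using recip.emeasure_tiles_eq[OF tiles_mesh_round zone_tiles] by (simp add: emeasure_zone)
  finally have "real (card (mesh S s n)) * ?w = measure lborel (zone S)"
    using w by (subst (asm) ennreal_inj) auto
  then have "real (card (mesh S s n)) = real (n ^ 3)"
    using measure_zone_pos n by (simp add: field_simps)
  then show "card (mesh S s n) = n ^ 3" by (rule of_nat_eq_iff[THEN iffD1])
qed

lemma mesh_nonempty: "mesh S s n \<noteq> {}"
  using card_mesh n by (metis card.empty power_eq_0_iff less_numeral_extra(3))

end

text \<open>Rounding moves a triple of momenta by \<open>O(1/n)\<close>, hence changes \<open>h\<close> by \<open>O(1/n)\<close> divided by \<open>sing_dist\<close>,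
  whose inverse is integrable.\<close>

lemma mesh_quadrature_error:
  fixes h :: "vec3 \<times> vec3 \<times> vec3 \<Rightarrow> complex"
  assumes h: "h \<in> borel_measurable borel" "mild sing_dist h"
    and per: "\<And>R z. R \<in> reciprocal3 \<Longrightarrow> h (R + z) = h z"
  shows "\<exists>K. \<forall>s n. n > 0 \<longrightarrow>
    norm ((LINT z:zone3|lborel. h z) / of_real (measure lborel (zone S)) ^ 3
      - (\<Sum>k\<in>mesh S s n \<times> mesh S s n \<times> mesh S s n. h k) / of_nat (card (mesh S s n)) ^ 3) \<le> K / n"
proof -
  obtain C where C: "C > 0" "\<And>z. norm (h z) \<le> C"
    "\<And>z w. norm (h z - h w) * sing_dist z \<le> C * dist z w"
    using mildE[OF h(2)] by blast
  let ?V = "measure lborel (zone S)"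
  define J where "J = (\<integral>\<^sup>+z\<in>zone3. inverse (ennreal (sing_dist z)) \<partial>lborel)"
  have J: "J = ennreal (enn2real J)"
    using nn_integral_inverse_sing_dist_finite unfolding J_def
    by (intro ennreal_enn2real[symmetric]) auto
  define B where "B = C * (3 * zone_radius)"
  have B: "B > 0" using C(1) zone_radius(1) by (simp add: B_def)
  show ?thesis
  proof (intro exI[of _ "B * enn2real J / ?V ^ 3"] allI impI)
    fix s :: "nat \<Rightarrow> vec3" and n :: nat assume n: "n > 0"
    let ?M = "mesh S s n"
    define r where "r = (\<lambda>(x :: vec3, y :: vec3, z :: vec3). (mesh_round s n x, mesh_round s n y, mesh_round s n z))"
    define w where "w = (?V / real n ^ 3) ^ 3"
    have cells: "{z. r z = (a, b, c)}
        = {x. mesh_round s n x = a} \<times> {x. mesh_round s n x = b} \<times> {x. mesh_round s n x = c}" for a b c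
      by (auto simp: r_def)
    have cell_sets: "{x. mesh_round s n x = a} \<in> sets borel" for a
      using borel_mesh_round[OF n, of s] by measurable
    have rM: "{z. r z \<in> ?M \<times> ?M \<times> ?M} = {x. mesh_round s n x \<in> ?M} \<times> {x. mesh_round s n x \<in> ?M} \<times> {x. mesh_round s n x \<in> ?M}"
      by (auto simp: r_def)
    have "ennreal (norm ((LINT z:zone3|lborel. h z) - of_real w * (\<Sum>k\<in>?M \<times> ?M \<times> ?M. h k)))
      \<le> ennreal (B / n) * J"
      unfolding J_def
    proof (rule recip3.lattice_sum_error[where r = r and C = C])
      show "tiles reciprocal3 {z. r z \<in> ?M \<times> ?M \<times> ?M}"
        unfolding rM by (intro tiles_Times tiles_mesh_round n)
      show "finite (?M \<times> ?M \<times> ?M)" using finite_mesh[OF n] by simp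
      show "emeasure lborel zone3 < \<infinity>" by (simp add: emeasure_zone3)
      fix k assume k: "k \<in> ?M \<times> ?M \<times> ?M"
      then obtain a b c where k': "k = (a, b, c)" "a \<in> ?M" "b \<in> ?M" "c \<in> ?M" by auto
      show "{z. r z = k} \<in> sets borel"
        unfolding k' cells using cell_sets by (simp add: borel_prod[symmetric])
      show "emeasure lborel {z. r z = k} = ennreal w"
        unfolding k' cells using cell_sets k'(2-) n
        by (simp add: emeasure_lborel_Times3 emeasure_mesh_cell w_def power3_eq_cube
            ennreal_mult[symmetric])
    next
      fix z :: "vec3 \<times> vec3 \<times> vec3"
      obtain x y v where z: "z = (x, y, v)" by (cases z) auto
      have "dist z (r z) \<le> dist x (mesh_round s n x) + (dist y (mesh_round s n y) + dist v (mesh_round s n v))"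
      proof -
        have "dist z (r z) \<le> dist x (mesh_round s n x) + dist (y, v) (mesh_round s n y, mesh_round s n v)"
          by (simp add: z r_def dist_norm norm_Pair_le)
        also have "dist (y, v) (mesh_round s n y, mesh_round s n v) \<le> dist y (mesh_round s n y) + dist v (mesh_round s n v)"
          by (simp add: dist_norm norm_Pair_le)
        finally show ?thesis by simp
      qed
      also have "\<dots> \<le> 3 * zone_radius / n"
        using dist_mesh_round[OF n, of x s] dist_mesh_round[OF n, of y s] dist_mesh_round[OF n, of v s]
        by simp
      finally have "C * dist z (r z) \<le> C * (3 * zone_radius / n)" using C(1) by (intro mult_left_mono) auto
      also have "\<dots> = B / n" by (simp add: B_def)
      finally show "norm (h z - h (r z)) * sing_dist z \<le> B / n" using C(3)[of z "r z"] by linarith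
    qed (use zone3_tiles C(2) per sing_dist_nonneg sing_dist_periodic h(1) B n measure_zone_pos in
        \<open>auto simp: w_def\<close>)
    also have "\<dots> = ennreal (B / n * enn2real J)"
      using B n by (subst J, intro ennreal_mult[symmetric]) auto
    finally have e: "norm ((LINT z:zone3|lborel. h z) - of_real w * (\<Sum>k\<in>?M \<times> ?M \<times> ?M. h k)) \<le> B / n * enn2real J"
      using B n by (subst (asm) ennreal_le_iff) auto
    have "(LINT z:zone3|lborel. h z) / of_real ?V ^ 3 - (\<Sum>k\<in>?M \<times> ?M \<times> ?M. h k) / of_nat (card ?M) ^ 3
        = ((LINT z:zone3|lborel. h z) - of_real w * (\<Sum>k\<in>?M \<times> ?M \<times> ?M. h k)) / of_real (?V ^ 3)"
      using measure_zone_pos n by (simp add: card_mesh w_def field_simps)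
    then have "norm ((LINT z:zone3|lborel. h z) / of_real ?V ^ 3 - (\<Sum>k\<in>?M \<times> ?M \<times> ?M. h k) / of_nat (card ?M) ^ 3)
        = norm ((LINT z:zone3|lborel. h z) - of_real w * (\<Sum>k\<in>?M \<times> ?M \<times> ?M. h k)) / ?V ^ 3"
      using measure_zone_pos by (simp add: norm_divide norm_power)
    also have "\<dots> \<le> B / n * enn2real J / ?V ^ 3"
      using e measure_zone_pos by (intro divide_right_mono) auto
    finally show "norm ((LINT z:zone3|lborel. h z) / of_real ?V ^ 3 - (\<Sum>k\<in>?M \<times> ?M \<times> ?M. h k) / of_nat (card ?M) ^ 3)
        \<le> B * enn2real J / ?V ^ 3 / n"
      by (simp add: field_simps)
  qed
qed

end

section \<open>Fourier coefficients on the unit cell\<close>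

lemma norm_cis_diff_le: "norm (cis a - cis b) \<le> \<bar>a - b\<bar>"
proof -
  have "norm (cis x - 1) \<le> \<bar>x\<bar>" for x
  proof -
    have "(norm (cis x - 1))\<^sup>2 = (cos x - 1)\<^sup>2 + (sin x)\<^sup>2" by (simp add: cmod_power2)
    also have "\<dots> = (2 * sin (x / 2))\<^sup>2"
      using cos_double_sin[of "x / 2"] sin_cos_squared_add[of x]
      by (simp add: power2_eq_square algebra_simps)
    finally have "norm (cis x - 1) = \<bar>2 * sin (x / 2)\<bar>"
      by (metis abs_norm_cancel power2_abs power2_eq_iff_nonneg abs_ge_zero norm_ge_zero)
    then show ?thesis using abs_sin_x_le_abs_x[of "x / 2"] by simp
  qed
  moreover have "cis a - cis b = cis b * (cis (a - b) - 1)"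
    by (simp add: algebra_simps cis_mult)
  ultimately show ?thesis by (simp add: norm_mult)
qed

lemma norm_frechet_derivative_le:
  fixes f :: "'a::euclidean_space \<Rightarrow> 'b::real_normed_vector"
  assumes f: "f differentiable at x"
    and c: "\<And>e. e \<in> Basis \<Longrightarrow> norm (frechet_derivative f (at x) e) \<le> c"
  shows "norm (frechet_derivative f (at x) v) \<le> real DIM('a) * c * norm v"
proof -
  let ?D = "frechet_derivative f (at x)"
  have lin: "linear ?D" by (rule linear_frechet_derivative[OF f])
  have "?D v = ?D (\<Sum>e\<in>Basis. (v \<bullet> e) *\<^sub>R e)" by (simp add: euclidean_representation)
  also have "\<dots> = (\<Sum>e\<in>Basis. (v \<bullet> e) *\<^sub>R ?D e)"
    by (simp add: linear_sum[OF lin] linear_cmul[OF lin])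
  also have "norm \<dots> \<le> (\<Sum>e\<in>(Basis :: 'a set). norm v * c)"
  proof (rule sum_norm_le)
    fix e :: 'a assume e: "e \<in> Basis"
    show "norm ((v \<bullet> e) *\<^sub>R ?D e) \<le> norm v * c"
      using Basis_le_norm[OF e, of v] c[OF e] by (auto intro!: mult_mono)
  qed
  finally show ?thesis by (simp add: algebra_simps)
qed

lemma set_integral_sum:
  fixes f :: "'i \<Rightarrow> 'a \<Rightarrow> 'b::{banach, second_countable_topology}"
  assumes "\<And>i. i \<in> I \<Longrightarrow> set_integrable M A (f i)"
  shows "(LINT x:A|M. (\<Sum>i\<in>I. f i x)) = (\<Sum>i\<in>I. LINT x:A|M. f i x)"
    and "set_integrable M A (\<lambda>x. \<Sum>i\<in>I. f i x)"
  using assms unfolding set_lebesgue_integral_def set_integrable_def scaleR_sum_right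
  by (auto intro!: Bochner_Integration.integral_sum Bochner_Integration.integrable_sum)

context insulating_system
begin

sublocale direct: translation_lattice "bravais S"
proof
  have eq: "bravais S = range (\<lambda>m :: int ^ 3. \<Sum>i\<in>UNIV. of_int (m $ i) *\<^sub>R (basis S $ i))"
    by (simp add: bravais_def)
  show "countable (bravais S)" unfolding eq by auto
  show "0 \<in> bravais S" unfolding eq by (rule range_eqI[of _ _ 0]) simp
  show "x - y \<in> bravais S" if x: "x \<in> bravais S" and y: "y \<in> bravais S" for x y
  proof -
    from x obtain a :: "int ^ 3" where "x = (\<Sum>i\<in>UNIV. of_int (a $ i) *\<^sub>R (basis S $ i))"
      by (auto simp: eq)
    moreover from y obtain b :: "int ^ 3" where "y = (\<Sum>i\<in>UNIV. of_int (b $ i) *\<^sub>R (basis S $ i))"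
      by (auto simp: eq)
    ultimately have "x - y = (\<Sum>i\<in>UNIV. of_int ((a - b) $ i) *\<^sub>R (basis S $ i))"
      by (simp add: scaleR_diff_left sum_subtractf)
    then show ?thesis unfolding eq by (rule range_eqI)
  qed
qed

lemma cell_tiles: "tiles (bravais S) (cell S)" and cell_bounded: "bounded (cell S)"
  using system by (auto simp: insulator_def unit_cell_iff_tiles)

lemma borel_cell [measurable]: "cell S \<in> sets borel"
  using cell_tiles by (simp add: tiles_def)

abbreviation vol :: real where "vol \<equiv> measure lborel (cell S)"

lemma emeasure_cell_finite: "emeasure lborel (cell S) < \<infinity>"
  by (rule emeasure_bounded_finite[OF cell_bounded])

lemma vol_pos: "0 < vol"
  using direct.emeasure_tiles_pos[OF cell_tiles] emeasure_cell_finite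
  by (simp add: measure_def enn2real_positive_iff)

definition bounded_on_cell :: "real \<Rightarrow> (vec3 \<Rightarrow> complex) \<Rightarrow> bool" where
  "bounded_on_cell A f \<longleftrightarrow> f \<in> borel_measurable borel \<and> (\<forall>r\<in>cell S. norm (f r) \<le> A)"

lemma set_integrable_cell:
  assumes "bounded_on_cell A f"
  shows "set_integrable lborel (cell S) f"
  unfolding set_integrable_def
proof (rule Bochner_Integration.integrable_bound)
  have [measurable]: "f \<in> borel_measurable borel" using assms by (simp add: bounded_on_cell_def)
  show "integrable lborel (\<lambda>x. indicat_real (cell S) x *\<^sub>R A)"
    using emeasure_cell_finite by (intro integrable_scaleR_left integrable_real_indicator) auto
  show "(\<lambda>x. indicat_real (cell S) x *\<^sub>R f x) \<in> borel_measurable lborel" by measurable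
  show "AE x in lborel. norm (indicat_real (cell S) x *\<^sub>R f x) \<le> norm (indicat_real (cell S) x *\<^sub>R A)"
    using assms by (auto simp: bounded_on_cell_def indicator_def intro!: AE_I2 intro: order_trans[OF _ abs_ge_self])
qed

lemma bounded_on_cell_nonneg: "bounded_on_cell A f \<Longrightarrow> 0 \<le> A"
proof -
  assume "bounded_on_cell A f"
  moreover have "cell S \<noteq> {}" using vol_pos by auto
  ultimately show ?thesis unfolding bounded_on_cell_def
    by (meson ex_in_conv norm_ge_zero order_trans)
qed

lemma bounded_on_cell_mult:
  assumes "bounded_on_cell A f" "bounded_on_cell B g"
  shows "bounded_on_cell (A * B) (\<lambda>r. f r * g r)"
  using assms bounded_on_cell_nonneg[OF assms(1)] bounded_on_cell_nonneg[OF assms(2)]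
  by (auto simp: bounded_on_cell_def norm_mult intro!: mult_mono)

lemma borel_cis_inner [measurable]: "(\<lambda>r. cis (G \<bullet> r)) \<in> borel_measurable (borel :: vec3 measure)"
  by (intro borel_measurable_continuous_onI continuous_intros)

lemma bounded_on_cell_cis: "bounded_on_cell 1 (\<lambda>r. cis (G \<bullet> r))" "bounded_on_cell 1 (\<lambda>r. cis (- (G \<bullet> r)))"
  using borel_cis_inner[of G] borel_cis_inner[of "- G"] by (auto simp: bounded_on_cell_def)

text \<open>The shift by the vector \<open>a\<close> with \<open>G \<bullet> a = \<pi>\<close> changes the sign of the exponential but, the shifted cell
  being another tile, does not change the integral.\<close>

lemma integral_exponential:
  assumes G: "G \<in> reciprocal S"
  shows "(LINT r:cell S|lborel. cis (G \<bullet> r)) = (if G = 0 then of_real vol else 0)"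
proof (cases "G = 0")
  case True
  have "integrable lborel (indicat_real (cell S))"
    using emeasure_cell_finite by (intro integrable_real_indicator) auto
  then have "(\<integral>r. indicat_real (cell S) r *\<^sub>R (1 :: complex) \<partial>lborel) = of_real vol"
    by (subst integral_scaleR_left) (simp_all add: scaleR_conv_of_real)
  with True show ?thesis by (simp add: set_lebesgue_integral_def)
next
  case False
  define a where "a = (pi / (G \<bullet> G)) *\<^sub>R G"
  have Ga: "G \<bullet> a = pi" using False by (simp add: a_def)
  let ?I = "LINT r:cell S|lborel. cis (G \<bullet> r)"
  let ?D = "(\<lambda>x. x + a) -` cell S"
  have D: "tiles (bravais S) ?D" by (rule direct.tiles_shift[OF cell_tiles])
  have per: "cis (G \<bullet> (R + r)) = cis (G \<bullet> r)" if "R \<in> bravais S" for R r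
  proof -
    have "\<exists>m::int. G \<bullet> R = 2 * pi * of_int m" using G that by (simp add: reciprocal_def)
    then obtain m :: int where "G \<bullet> R = 2 * pi * of_int m" ..
    then show ?thesis by (simp add: inner_add_right cis_mult[symmetric] cis_multiple_2pi)
  qed
  have Dint: "set_integrable lborel ?D (\<lambda>r. cis (G \<bullet> r))"
    unfolding set_integrable_def
  proof (rule Bochner_Integration.integrable_bound)
    have [measurable]: "?D \<in> sets borel" using D by (simp add: tiles_def)
    have "emeasure lborel ?D < \<infinity>"
      using direct.emeasure_tiles_eq[OF D cell_tiles] emeasure_cell_finite by simp
    then show "integrable lborel (indicat_real ?D)" by (intro integrable_real_indicator) auto
    show "(\<lambda>x. indicat_real ?D x *\<^sub>R cis (G \<bullet> x)) \<in> borel_measurable lborel" by measurable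
  qed (auto simp: indicator_def)
  have "?I = (LINT r:?D|lborel. cis (G \<bullet> r))"
    by (intro direct.set_integral_tiles_eq[OF cell_tiles D] per Dint
        set_integrable_cell[OF bounded_on_cell_cis(1)]) auto
  also have "\<dots> = (\<integral>r. indicator (cell S) (a + r) *\<^sub>R (cis (- pi) * cis (G \<bullet> (a + r))) \<partial>lborel)"
    unfolding set_lebesgue_integral_def
    by (intro Bochner_Integration.integral_cong)
       (auto simp: indicator_def inner_add_right Ga cis_mult add.commute)
  also have "\<dots> = (\<integral>r. indicator (cell S) r *\<^sub>R (cis (- pi) * cis (G \<bullet> r)) \<partial>distr lborel borel ((+) a))"
    by (intro integral_distr[symmetric]) auto
  also have "\<dots> = cis (- pi) * ?I"
    by (simp add: lborel_distr_plus set_lebesgue_integral_def mult_scaleR_right[symmetric] del: mult_scaleR_right)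
  also have "cis (- pi) = - 1" by (simp add: complex_eq_iff)
  finally have "?I = - ?I" by simp
  with False show ?thesis by simp
qed

definition fourier :: "(vec3 \<Rightarrow> complex) \<Rightarrow> vec3 \<Rightarrow> complex" where
  "fourier f G = (LINT r:cell S|lborel. f r * cis (- (G \<bullet> r)))"

lemma fourier_diff:
  assumes "bounded_on_cell A f" "bounded_on_cell B g"
  shows "fourier (\<lambda>r. f r - g r) G = fourier f G - fourier g G"
  unfolding fourier_def left_diff_distrib
  by (rule set_integral_diff[OF set_integrable_cell[OF bounded_on_cell_mult[OF assms(1) bounded_on_cell_cis(2)]]
      set_integrable_cell[OF bounded_on_cell_mult[OF assms(2) bounded_on_cell_cis(2)]]])

text \<open>With \<open>p = \<Sum> c\<^sub>G e\<^sub>G\<close> and \<open>\<sigma> = \<Sum> |c\<^sub>G|\<^sup>2\<close>, the integral of \<open>f\<close> times the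
  conjugate of \<open>p\<close> is \<open>\<sigma>\<close>, and by orthogonality that of \<open>|p|\<^sup>2\<close> is \<open>vol \<sigma>\<close>. Integrating the pointwise inequality
  \<open>|f p| \<le> vol |f|\<^sup>2 / 2 + |p|\<^sup>2 / (2 vol)\<close> yields \<open>\<sigma> \<le> (vol A)\<^sup>2 / 2 + \<sigma> / 2\<close>.\<close>

lemma bessel:
  assumes f: "bounded_on_cell A f" and F: "finite F" "F \<subseteq> reciprocal S"
  shows "(\<Sum>G\<in>F. (norm (fourier f G))\<^sup>2) \<le> (vol * A)\<^sup>2"
proof -
  have A: "0 \<le> A" by (rule bounded_on_cell_nonneg[OF f])
  define c where "c = fourier f"
  define \<sigma> where "\<sigma> = (\<Sum>G\<in>F. (norm (c G))\<^sup>2)"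
  define p where "p = (\<lambda>r. \<Sum>G\<in>F. c G * cis (G \<bullet> r))"
  have [measurable]: "f \<in> borel_measurable borel" using f by (simp add: bounded_on_cell_def)
  have p_meas [measurable]: "p \<in> borel_measurable borel" unfolding p_def by measurable
  define P where "P = (\<Sum>G\<in>F. norm (c G))"
  have p_bd: "bounded_on_cell P p"
  proof -
    have "norm (p r) \<le> P" for r
      unfolding p_def P_def by (rule order_trans[OF norm_sum]) (simp add: norm_mult)
    then show ?thesis by (auto simp: bounded_on_cell_def)
  qed
  moreover have "(\<lambda>r. cnj (p r)) \<in> borel_measurable borel"
    by (rule measurable_compose[OF p_meas]) (intro borel_measurable_continuous_onI continuous_intros)
  ultimately have cp_bd: "bounded_on_cell P (\<lambda>r. cnj (p r))" by (auto simp: bounded_on_cell_def)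
  have fp: "(LINT r:cell S|lborel. f r * cnj (p r)) = of_real \<sigma>"
  proof -
    have "(LINT r:cell S|lborel. f r * cnj (p r))
        = (LINT r:cell S|lborel. (\<Sum>G\<in>F. cnj (c G) * (f r * cis (- (G \<bullet> r)))))"
      by (simp add: p_def sum_distrib_left cis_cnj algebra_simps)
    also have "\<dots> = (\<Sum>G\<in>F. cnj (c G) * c G)"
    proof (subst set_integral_sum)
      show "set_integrable lborel (cell S) (\<lambda>r. cnj (c G) * (f r * cis (- (G \<bullet> r))))" if "G \<in> F" for G
        by (intro set_integrable_mult_right set_integrable_cell[OF bounded_on_cell_mult[OF f bounded_on_cell_cis(2)]])
    qed (use F in \<open>simp_all add: c_def fourier_def\<close>)
    also have "\<dots> = of_real \<sigma>"
      unfolding \<sigma>_def of_real_sum by (intro sum.cong refl) (simp only: complex_norm_square mult.commute)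
    finally show ?thesis .
  qed
  have pp: "(LINT r:cell S|lborel. p r * cnj (p r)) = of_real (vol * \<sigma>)"
  proof -
    have "(LINT r:cell S|lborel. p r * cnj (p r))
        = (LINT r:cell S|lborel. (\<Sum>G\<in>F. \<Sum>H\<in>F. (c G * cnj (c H)) * cis ((G - H) \<bullet> r)))"
      by (simp add: p_def sum_product cis_cnj cis_mult inner_diff_left algebra_simps cis_divide[symmetric])
    also have "\<dots> = (\<Sum>G\<in>F. \<Sum>H\<in>F. (c G * cnj (c H)) * (LINT r:cell S|lborel. cis ((G - H) \<bullet> r)))"
    proof -
      have i: "set_integrable lborel (cell S) (\<lambda>r. (c G * cnj (c H)) * cis ((G - H) \<bullet> r))" for G H
        by (intro set_integrable_mult_right set_integrable_cell[OF bounded_on_cell_cis(1)])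
      have "(LINT r:cell S|lborel. (\<Sum>G\<in>F. \<Sum>H\<in>F. (c G * cnj (c H)) * cis ((G - H) \<bullet> r)))
        = (\<Sum>G\<in>F. (LINT r:cell S|lborel. (\<Sum>H\<in>F. (c G * cnj (c H)) * cis ((G - H) \<bullet> r))))"
        by (intro set_integral_sum i)
      also have "\<dots> = (\<Sum>G\<in>F. \<Sum>H\<in>F. (LINT r:cell S|lborel. (c G * cnj (c H)) * cis ((G - H) \<bullet> r)))"
        by (intro sum.cong set_integral_sum i refl)
      finally show ?thesis by simp
    qed
    also have "\<dots> = (\<Sum>G\<in>F. \<Sum>H\<in>F. if G = H then of_real (vol * (norm (c G))\<^sup>2) else 0)"
    proof (intro sum.cong refl)
      fix G H assume "G \<in> F" "H \<in> F"
      then have "G - H \<in> reciprocal S" using F recip.diff by blast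
      then show "(c G * cnj (c H)) * (LINT r:cell S|lborel. cis ((G - H) \<bullet> r))
          = (if G = H then of_real (vol * (norm (c G))\<^sup>2) else 0)"
        by (auto simp: integral_exponential complex_norm_square[symmetric])
    qed
    also have "\<dots> = of_real (vol * \<sigma>)"
      using F by (simp add: \<sigma>_def sum_distrib_left)
    finally show ?thesis .
  qed
  have int_fp: "set_integrable lborel (cell S) (\<lambda>r. f r * cnj (p r))"
    by (rule set_integrable_cell[OF bounded_on_cell_mult[OF f cp_bd]])
  have int_pp: "set_integrable lborel (cell S) (\<lambda>r. p r * cnj (p r))"
    by (rule set_integrable_cell[OF bounded_on_cell_mult[OF p_bd cp_bd]])
  have "\<sigma> = Re (LINT r:cell S|lborel. f r * cnj (p r))" by (simp add: fp)
  also have "\<dots> = (\<integral>r. indicator (cell S) r * Re (f r * cnj (p r)) \<partial>lborel)"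
    using integral_Re[OF int_fp[unfolded set_integrable_def]]
    by (simp add: set_lebesgue_integral_def del: times_complex.simps)
  also have "\<dots> \<le> (\<integral>r. indicator (cell S) r * (vol * A\<^sup>2 / 2) + indicator (cell S) r * Re (p r * cnj (p r)) / (2 * vol) \<partial>lborel)"
  proof (rule integral_mono)
    show "integrable lborel (\<lambda>r. indicator (cell S) r * Re (f r * cnj (p r)))"
      using integrable_Re[OF int_fp[unfolded set_integrable_def]] by (simp del: times_complex.simps)
    show "integrable lborel (\<lambda>r. indicator (cell S) r * (vol * A\<^sup>2 / 2) + indicator (cell S) r * Re (p r * cnj (p r)) / (2 * vol))"
      using integrable_Re[OF int_pp[unfolded set_integrable_def]] emeasure_cell_finite
      by (intro Bochner_Integration.integrable_add integrable_divide integrable_mult_left integrable_real_indicator)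
        (auto simp del: times_complex.simps)
    fix r
    show "indicator (cell S) r * Re (f r * cnj (p r))
        \<le> indicator (cell S) r * (vol * A\<^sup>2 / 2) + indicator (cell S) r * Re (p r * cnj (p r)) / (2 * vol)"
    proof (cases "r \<in> cell S")
      case True
      then have fA: "norm (f r) \<le> A" using f by (simp add: bounded_on_cell_def)
      have "Re (f r * cnj (p r)) \<le> norm (f r * cnj (p r))" by (rule complex_Re_le_cmod)
      also have "\<dots> = norm (f r) * norm (p r)" by (simp add: norm_mult)
      also have "\<dots> \<le> A * norm (p r)" using fA by (intro mult_right_mono) auto
      also have "\<dots> \<le> vol * A\<^sup>2 / 2 + (norm (p r))\<^sup>2 / (2 * vol)"
      proof -
        have "0 \<le> (vol * A - norm (p r))\<^sup>2 / (2 * vol)" using vol_pos by simp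
        also have "\<dots> = vol * A\<^sup>2 / 2 + (norm (p r))\<^sup>2 / (2 * vol) - A * norm (p r)"
          using vol_pos by (simp add: field_simps power2_eq_square)
        finally show ?thesis by simp
      qed
      also have "(norm (p r))\<^sup>2 = Re (p r * cnj (p r))"
        using complex_norm_square[of "p r"] by (metis Re_complex_of_real)
      finally show ?thesis using True by simp
    qed simp
  qed
  also have "\<dots> = vol * (vol * A\<^sup>2 / 2) + Re (LINT r:cell S|lborel. p r * cnj (p r)) / (2 * vol)"
  proof -
    have i1: "integrable lborel (\<lambda>r. indicat_real (cell S) r * (vol * A\<^sup>2 / 2))"
      using emeasure_cell_finite by (intro integrable_mult_left integrable_real_indicator) auto
    have i2: "integrable lborel (\<lambda>r. indicator (cell S) r * Re (p r * cnj (p r)))"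
      using integrable_Re[OF int_pp[unfolded set_integrable_def]] by (simp del: times_complex.simps)
    show ?thesis
      using integral_Re[OF int_pp[unfolded set_integrable_def]] i1 i2
      by (subst Bochner_Integration.integral_add)
        (simp_all add: set_lebesgue_integral_def del: times_complex.simps)
  qed
  also have "\<dots> = (vol * A)\<^sup>2 / 2 + \<sigma> / 2"
    using vol_pos by (simp add: pp power2_eq_square)
  finally have "\<sigma> \<le> (vol * A)\<^sup>2" by simp
  then show ?thesis by (simp add: \<sigma>_def c_def)
qed

lemma norm_fourier_le:
  assumes "bounded_on_cell A f" "G \<in> reciprocal S"
  shows "norm (fourier f G) \<le> vol * A"
proof -
  have "(norm (fourier f G))\<^sup>2 \<le> (vol * A)\<^sup>2" using bessel[OF assms(1), of "{G}"] assms(2) by simp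
  then show ?thesis using bounded_on_cell_nonneg[OF assms(1)] vol_pos
    by (simp add: power_mono_iff)
qed

text \<open>The Coulomb sum of an electron repulsion integral with a general weight in place of
  \<open>1/|q + G|\<^sup>2\<close>, so that its \<open>G = 0\<close> term can be removed and weights can be compared.\<close>

definition coulomb_sum :: "(vec3 \<Rightarrow> real) \<Rightarrow> (vec3 \<Rightarrow> complex) \<Rightarrow> (vec3 \<Rightarrow> complex) \<Rightarrow> complex" where
  "coulomb_sum w f g = (\<Sum>\<^sub>\<infinity>G\<in>reciprocal S. of_real (w G) * fourier f G * fourier g (- G))"

text \<open>Cauchy--Schwarz and Bessel bound the sum by the sup norms of \<open>f\<close> and \<open>g\<close> alone.\<close>

lemma coulomb_sum:
  assumes f: "bounded_on_cell A f" and g: "bounded_on_cell B g"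
    and w: "\<And>G. G \<in> reciprocal S \<Longrightarrow> \<bar>w G\<bar> \<le> W"
  shows summable_coulomb_sum: "(\<lambda>G. of_real (w G) * fourier f G * fourier g (- G)) summable_on reciprocal S"
    and norm_coulomb_sum_le: "norm (coulomb_sum w f g) \<le> W * (vol * A) * (vol * B)"
proof -
  let ?t = "\<lambda>G. of_real (w G) * fourier f G * fourier g (- G)"
  have W: "0 \<le> W" using w[OF recip.zero] by linarith
  have fin: "(\<Sum>G\<in>F. norm (?t G)) \<le> W * (vol * A) * (vol * B)" if F: "finite F" "F \<subseteq> reciprocal S" for F
  proof -
    have "(\<Sum>G\<in>F. norm (?t G)) \<le> (\<Sum>G\<in>F. W * (norm (fourier f G) * norm (fourier g (- G))))"
      using F w by (intro sum_mono) (auto simp: norm_mult mult.assoc intro!: mult_right_mono)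
    also have "\<dots> = W * (\<Sum>G\<in>F. norm (fourier f G) * norm (fourier g (- G)))"
      by (simp add: sum_distrib_left)
    also have "(\<Sum>G\<in>F. norm (fourier f G) * norm (fourier g (- G)))
        \<le> L2_set (\<lambda>G. norm (fourier f G)) F * L2_set (\<lambda>G. norm (fourier g (- G))) F"
      using L2_set_mult_ineq[of "\<lambda>G. norm (fourier f G)" "\<lambda>G. norm (fourier g (- G))" F] by simp
    also have "\<dots> \<le> (vol * A) * (vol * B)"
    proof (intro mult_mono)
      have nn: "0 \<le> vol * A" "0 \<le> vol * B"
        using bounded_on_cell_nonneg[OF f] bounded_on_cell_nonneg[OF g] vol_pos by auto
      show "L2_set (\<lambda>G. norm (fourier f G)) F \<le> vol * A"
        unfolding L2_set_def using bessel[OF f F] nn by (intro real_le_lsqrt) (auto simp: sum_nonneg)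
      have "(\<Sum>G\<in>F. (norm (fourier g (- G)))\<^sup>2) = (\<Sum>G\<in>uminus ` F. (norm (fourier g G))\<^sup>2)"
        by (subst sum.reindex) (auto simp: inj_on_def)
      also have "\<dots> \<le> (vol * B)\<^sup>2"
        using F recip.uminus by (intro bessel[OF g]) auto
      finally show "L2_set (\<lambda>G. norm (fourier g (- G))) F \<le> vol * B"
        unfolding L2_set_def using nn by (intro real_le_lsqrt) (auto simp: sum_nonneg)
    qed (use bounded_on_cell_nonneg[OF f] vol_pos in \<open>auto simp: L2_set_nonneg\<close>)
    finally show ?thesis using W by (simp add: mult.assoc mult_left_mono)
  qed
  have abs: "(\<lambda>G. norm (?t G)) summable_on reciprocal S"
    using fin by (intro abs_summable_iff_bdd_above[THEN iffD2] bdd_aboveI2) auto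
  then show "?t summable_on reciprocal S" by (rule abs_summable_summable)
  have "norm (coulomb_sum w f g) \<le> (\<Sum>\<^sub>\<infinity>G\<in>reciprocal S. norm (?t G))"
    unfolding coulomb_sum_def by (rule norm_infsum_bound[OF abs])
  also have "\<dots> \<le> W * (vol * A) * (vol * B)"
    using fin by (intro infsum_le_finite_sums abs) auto
  finally show "norm (coulomb_sum w f g) \<le> W * (vol * A) * (vol * B)" .
qed

text \<open>The sum is trilinear, so it depends in a Lipschitz way on the weight and on both functions in the
  sup norm.\<close>

lemma coulomb_sum_diff:
  assumes f: "bounded_on_cell A f" "bounded_on_cell A f'" and g: "bounded_on_cell B g" "bounded_on_cell B g'"
    and w: "\<And>G. G \<in> reciprocal S \<Longrightarrow> \<bar>w G\<bar> \<le> W" "\<And>G. G \<in> reciprocal S \<Longrightarrow> \<bar>w' G\<bar> \<le> W"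
    and dw: "\<And>G. G \<in> reciprocal S \<Longrightarrow> \<bar>w G - w' G\<bar> \<le> dW"
    and df: "\<And>r. r \<in> cell S \<Longrightarrow> norm (f r - f' r) \<le> dA"
    and dg: "\<And>r. r \<in> cell S \<Longrightarrow> norm (g r - g' r) \<le> dB"
  shows "norm (coulomb_sum w f g - coulomb_sum w' f' g')
    \<le> dW * (vol * A) * (vol * B) + W * (vol * dA) * (vol * B) + W * (vol * A) * (vol * dB)"
proof -
  have dfb: "bounded_on_cell dA (\<lambda>r. f r - f' r)" and dgb: "bounded_on_cell dB (\<lambda>r. g r - g' r)"
    using f g df dg by (auto simp: bounded_on_cell_def)
  let ?t = "\<lambda>w f g G. of_real (w G) * fourier f G * fourier g (- G)"
  let ?dw = "\<lambda>G. w G - w' G" and ?df = "\<lambda>r. f r - f' r" and ?dg = "\<lambda>r. g r - g' r"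
  note s1 = summable_coulomb_sum[where w = ?dw, OF f(1) g(1) dw]
  note s2 = summable_coulomb_sum[where w = w', OF dfb g(1) w(2)]
  note s3 = summable_coulomb_sum[where w = w', OF f(2) dgb w(2)]
  note s4 = summable_coulomb_sum[where w = w', OF f(2) g(2) w(2)]
  have "coulomb_sum w f g = (\<Sum>\<^sub>\<infinity>G\<in>reciprocal S. ?t ?dw f g G + ?t w' ?df g G + ?t w' f' ?dg G + ?t w' f' g' G)"
    unfolding coulomb_sum_def
    by (intro infsum_cong) (simp add: fourier_diff[OF f] fourier_diff[OF g] algebra_simps)
  also have "\<dots> = coulomb_sum ?dw f g + coulomb_sum w' ?df g + coulomb_sum w' f' ?dg + coulomb_sum w' f' g'"
    unfolding coulomb_sum_def using s1 s2 s3 s4 by (simp add: infsum_add summable_on_add)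
  finally have "norm (coulomb_sum w f g - coulomb_sum w' f' g')
      = norm (coulomb_sum ?dw f g + coulomb_sum w' ?df g + coulomb_sum w' f' ?dg)" by simp
  also have "\<dots> \<le> norm (coulomb_sum ?dw f g) + norm (coulomb_sum w' ?df g) + norm (coulomb_sum w' f' ?dg)"
    by (intro order_trans[OF norm_triangle_ineq] add_right_mono norm_triangle_ineq)
  also have "\<dots> \<le> dW * (vol * A) * (vol * B) + W * (vol * dA) * (vol * B) + W * (vol * A) * (vol * dB)"
    using norm_coulomb_sum_le[where w = ?dw, OF f(1) g(1) dw] norm_coulomb_sum_le[where w = w', OF dfb g(1) w(2)]
      norm_coulomb_sum_le[where w = w', OF f(2) dgb w(2)] by linarith
  finally show ?thesis .
qed

lemma coulomb_sum_split:
  assumes f: "bounded_on_cell A f" and g: "bounded_on_cell B g"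
    and w: "\<And>G. G \<in> reciprocal S \<Longrightarrow> G \<noteq> 0 \<Longrightarrow> \<bar>w G\<bar> \<le> W"
  shows "coulomb_sum w f g = of_real (w 0) * fourier f 0 * fourier g 0 + coulomb_sum (w(0 := 0)) f g"
proof -
  let ?t = "\<lambda>w G. of_real (w G) * fourier f G * fourier g (- G)"
  have "\<bar>(w(0 := 0)) G\<bar> \<le> \<bar>W\<bar>" if "G \<in> reciprocal S" for G
    using w[OF that] by (auto intro: order_trans)
  note s = summable_coulomb_sum[OF f g this]
  have "coulomb_sum w f g = (\<Sum>\<^sub>\<infinity>G\<in>reciprocal S. (if G = 0 then ?t w 0 else 0) + ?t (w(0 := 0)) G)"
    unfolding coulomb_sum_def by (intro infsum_cong) auto
  also have "\<dots> = (\<Sum>\<^sub>\<infinity>G\<in>reciprocal S. if G = 0 then ?t w 0 else 0) + coulomb_sum (w(0 := 0)) f g"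
    unfolding coulomb_sum_def
  proof (intro infsum_add s)
    have "(\<lambda>G. if G = 0 then ?t w 0 else 0) summable_on {0 :: vec3}" by simp
    then show "(\<lambda>G. if G = 0 then ?t w 0 else 0) summable_on reciprocal S"
      using recip.zero by (subst summable_on_cong_neutral[of "{0}"]) auto
  qed
  also have "(\<Sum>\<^sub>\<infinity>G\<in>reciprocal S. if G = 0 then ?t w 0 else 0) = (\<Sum>\<^sub>\<infinity>G\<in>{0 :: vec3}. if G = 0 then ?t w 0 else 0)"
    using recip.zero by (intro infsum_cong_neutral) auto
  finally show ?thesis by (simp add: fun_upd_def)
qed

end

section \<open>Regularity of the electron repulsion integrals\<close>

lemma norm_components_le_dist:
  fixes x x' :: "'a::real_normed_vector" and y y' :: "'b::real_normed_vector" and z z' :: "'c::real_normed_vector"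
  shows "norm (x - x') \<le> dist (x, y, z) (x', y', z')" "norm (y - y') \<le> dist (x, y, z) (x', y', z')"
    "norm (z - z') \<le> dist (x, y, z) (x', y', z')"
  using dist_fst_le[of "(x, y, z)" "(x', y', z')"] dist_snd_le[of "(x, y, z)" "(x', y', z')"]
    dist_fst_le[of "(y, z)" "(y', z')"] dist_snd_le[of "(y, z)" "(y', z')"]
  by (auto simp: dist_norm)

lemma dist_triple_le:
  fixes x x' :: "'a::real_normed_vector" and y y' :: "'b::real_normed_vector" and z z' :: "'c::real_normed_vector"
  shows "dist (x, y, z) (x', y', z') \<le> norm (x - x') + (norm (y - y') + norm (z - z'))"
proof -
  have "dist (x, y, z) (x', y', z') \<le> norm (x - x') + norm ((y, z) - (y', z'))"
    by (simp add: dist_norm norm_Pair_le)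
  also have "norm ((y, z) - (y', z')) \<le> norm (y - y') + norm (z - z')"
    by (simp add: norm_Pair_le)
  finally show ?thesis by simp
qed

lemma inverse_square_diff:
  fixes a b :: real
  assumes "0 < c" "c \<le> a" "c \<le> b"
  shows "\<bar>1 / a\<^sup>2 - 1 / b\<^sup>2\<bar> \<le> 2 / c ^ 3 * \<bar>a - b\<bar>"
proof -
  have ab: "a > 0" "b > 0" using assms by auto
  have "1 / a\<^sup>2 - 1 / b\<^sup>2 = (b - a) * (1 / (a * b\<^sup>2) + 1 / (a\<^sup>2 * b))"
    using ab by (simp add: field_simps power2_eq_square)
  moreover have "c * c\<^sup>2 \<le> a * b\<^sup>2" "c\<^sup>2 * c \<le> a\<^sup>2 * b"
    using assms ab by (auto intro!: mult_mono power_mono)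
  then have "1 / (a * b\<^sup>2) \<le> 1 / c ^ 3" "1 / (a\<^sup>2 * b) \<le> 1 / c ^ 3"
    using assms ab by (auto simp: power2_eq_square power3_eq_cube mult.assoc intro!: divide_left_mono mult_pos_pos)
  moreover have "0 \<le> 1 / (a * b\<^sup>2) + 1 / (a\<^sup>2 * b)" using ab by simp
  ultimately show ?thesis
    using mult_left_mono[of "1 / (a * b\<^sup>2) + 1 / (a\<^sup>2 * b)" "2 / c ^ 3" "\<bar>a - b\<bar>"]
    by (simp add: abs_mult abs_minus_commute mult.commute)
qed

context insulating_system
begin

lemma orbital_add_reciprocal: "G \<in> reciprocal S \<Longrightarrow> orbital S n (k + G) r = orbital S n k r"
  using system by (simp add: insulator_def)

lemma bloch_eq_orbital: "bloch S n k r = cis (- (k \<bullet> r)) * orbital S n k r"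
  by (simp add: orbital_def mult.assoc[symmetric] cis_mult)

lemma orbital_derivs_continuous:
  "set vs \<subseteq> Basis \<Longrightarrow> continuous_on UNIV (\<lambda>(k, r). iter_deriv vs (\<lambda>k. orbital S n k r) k)"
  using system by (simp add: insulator_def)

text \<open>The \<open>k\<close>-derivatives are jointly continuous, hence bounded for \<open>k\<close> in a ball and \<open>r\<close> in the closed cell;
  periodicity in \<open>k\<close> makes the Lipschitz estimate global.\<close>

lemma orbital_bounded_Lipschitz:
  "\<exists>A. (\<forall>k. \<forall>r\<in>cell S. norm (orbital S n k r) \<le> A) \<and>
    (\<forall>k k'. \<forall>r\<in>cell S. norm (orbital S n k r - orbital S n k' r) \<le> A * norm (k - k'))"
proof -
  \<comment> \<open>The extra 1 leaves room for a second momentum at distance at most 1.\<close>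
  let ?K = "cball (0::vec3) (zone_radius + 1)"
  let ?X = "?K \<times> closure (cell S)"
  have cX: "compact ?X" using cell_bounded by (intro compact_Times) auto
  note jc = orbital_derivs_continuous
  have bd: "\<exists>B. \<forall>k\<in>?K. \<forall>r\<in>cell S. norm (iter_deriv vs (\<lambda>k. orbital S n k r) k) \<le> B"
    if "set vs \<subseteq> Basis" for vs
  proof -
    have "bounded ((\<lambda>(k, r). iter_deriv vs (\<lambda>k. orbital S n k r) k) ` ?X)"
      using jc[OF that] by (intro compact_imp_bounded compact_continuous_image cX) (auto intro: continuous_on_subset)
    then obtain B where "\<forall>x\<in>(\<lambda>(k, r). iter_deriv vs (\<lambda>k. orbital S n k r) k) ` ?X. norm x \<le> B"
      by (auto simp: bounded_iff)
    then have "\<forall>k\<in>?K. \<forall>r\<in>cell S. norm (iter_deriv vs (\<lambda>k. orbital S n k r) k) \<le> B"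
      using closure_subset[of "cell S"] by force
    then show ?thesis ..
  qed
  obtain A0 where A0: "\<And>k r. k \<in> ?K \<Longrightarrow> r \<in> cell S \<Longrightarrow> norm (orbital S n k r) \<le> A0"
  proof -
    obtain B where "\<forall>k\<in>?K. \<forall>r\<in>cell S. norm (orbital S n k r) \<le> B" using bd[of "[]"] by auto
    then show ?thesis by (intro that[of B]) blast
  qed
  have "\<forall>e\<in>Basis. \<exists>B. \<forall>k\<in>?K. \<forall>r\<in>cell S. norm (frechet_derivative (\<lambda>k. orbital S n k r) (at k) e) \<le> B"
    using bd[of "[_]"] by simp
  then obtain A1 where A1: "\<And>e k r. e \<in> Basis \<Longrightarrow> k \<in> ?K \<Longrightarrow> r \<in> cell S \<Longrightarrow>
      norm (frechet_derivative (\<lambda>k. orbital S n k r) (at k) e) \<le> A1 e" by metis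
  define M where "M = (\<Sum>e\<in>(Basis :: vec3 set). \<bar>A1 e\<bar>)"
  have M: "A1 e \<le> M" if "e \<in> Basis" for e
    using member_le_sum[OF that, of "\<lambda>e. \<bar>A1 e\<bar>"] by (simp add: M_def)
  have diffable: "(\<lambda>k. orbital S n k r) differentiable at k" for k r
  proof -
    have "smooth_on UNIV (\<lambda>k. orbital S n k r)" using system by (simp add: insulator_def)
    then have "iter_deriv [] (\<lambda>k. orbital S n k r) differentiable_on UNIV"
      unfolding smooth_on_def by (metis empty_set empty_subsetI)
    then show ?thesis by (simp add: differentiable_on_def)
  qed
  define A where "A = \<bar>A0\<bar> * 2 + \<bar>real DIM(vec3) * M\<bar>"
  have folded: "\<exists>G\<in>reciprocal S. norm (k + G) \<le> zone_radius" for k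
    using fold_zone[of k] zone_radius(2)[OF fold_zone(1)[of k]]
    by (intro bexI[of _ "- (k - fold_zone S k)"] recip.uminus) auto
  have bound: "norm (orbital S n k r) \<le> \<bar>A0\<bar>" if "r \<in> cell S" for k r
  proof -
    obtain G where G: "G \<in> reciprocal S" "norm (k + G) \<le> zone_radius" using folded by blast
    have "norm (orbital S n (k + G) r) \<le> A0" using G that by (intro A0) auto
    then show ?thesis using G by (simp add: orbital_add_reciprocal)
  qed
  have lip: "norm (orbital S n k r - orbital S n k' r) \<le> A * norm (k - k')" if r: "r \<in> cell S" for k k' r
  proof (cases "norm (k - k') \<le> 1")
    case True
    obtain G where G: "G \<in> reciprocal S" "norm (k + G) \<le> zone_radius" using folded by blast
    have k: "k + G \<in> ?K" using G by simp
    have k': "k' + G \<in> ?K"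
      using norm_triangle_ineq4[of "k + G" "k - k'"] G True by (simp add: algebra_simps)
    have "norm (orbital S n (k + G) r - orbital S n (k' + G) r)
        \<le> (real DIM(vec3) * M) * norm ((k + G) - (k' + G))"
    proof (rule differentiable_bound[OF convex_cball _ _ k k'])
      fix x assume x: "x \<in> ?K"
      show "((\<lambda>k. orbital S n k r) has_derivative frechet_derivative (\<lambda>k. orbital S n k r) (at x)) (at x within ?K)"
        using diffable frechet_derivative_works has_derivative_at_withinI by blast
      show "onorm (frechet_derivative (\<lambda>k. orbital S n k r) (at x)) \<le> real DIM(vec3) * M"
        using A1[OF _ x r] M by (intro onorm_le norm_frechet_derivative_le diffable) (auto intro: order_trans)
    qed
    also have "\<dots> \<le> A * norm ((k + G) - (k' + G))"
      unfolding A_def by (intro mult_right_mono) auto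
    finally show ?thesis using G by (simp add: orbital_add_reciprocal)
  next
    case False
    have "norm (orbital S n k r - orbital S n k' r) \<le> \<bar>A0\<bar> * 2"
      using norm_triangle_ineq4[of "orbital S n k r" "orbital S n k' r"] bound[OF r, of k] bound[OF r, of k'] by linarith
    also have "\<dots> \<le> A * 1" by (simp add: A_def)
    also have "\<dots> \<le> A * norm (k - k')" using False by (intro mult_left_mono) (auto simp: A_def)
    finally show ?thesis .
  qed
  have "norm (orbital S n k r) \<le> A" if "r \<in> cell S" for k r
    using bound[OF that, of k] by (simp add: A_def)
  with lip show ?thesis by blast
qed

text \<open>The factor \<open>cis (- (k \<bullet> r))\<close> is not periodic in \<open>k\<close>, but its Lipschitz constant \<open>|r|\<close> is bounded on the cell.\<close>

lemma bloch_bounded_Lipschitz1: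
  "\<exists>A. (\<forall>k. \<forall>r\<in>cell S. norm (bloch S n k r) \<le> A) \<and>
    (\<forall>k k'. \<forall>r\<in>cell S. norm (bloch S n k r - bloch S n k' r) \<le> A * norm (k - k'))"
proof -
  obtain A where A: "\<And>k r. r \<in> cell S \<Longrightarrow> norm (orbital S n k r) \<le> A"
      "\<And>k k' r. r \<in> cell S \<Longrightarrow> norm (orbital S n k r - orbital S n k' r) \<le> A * norm (k - k')"
    using orbital_bounded_Lipschitz[of n] by blast
  obtain R where R: "\<And>r. r \<in> cell S \<Longrightarrow> norm r \<le> R" using cell_bounded by (auto simp: bounded_iff)
  define B where "B = \<bar>R\<bar> * \<bar>A\<bar> + \<bar>A\<bar>"
  have "norm (bloch S n k r) \<le> B" if "r \<in> cell S" for k r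
  proof -
    have "0 \<le> \<bar>R\<bar> * \<bar>A\<bar>" by simp
    moreover have "norm (bloch S n k r) \<le> A" using A(1)[OF that, of k] by (simp add: bloch_eq_orbital norm_mult)
    ultimately show ?thesis unfolding B_def by linarith
  qed
  moreover have "norm (bloch S n k r - bloch S n k' r) \<le> B * norm (k - k')" if r: "r \<in> cell S" for k k' r
  proof -
    let ?o = "orbital S n k r" and ?o' = "orbital S n k' r"
    have "bloch S n k r - bloch S n k' r
        = (cis (- (k \<bullet> r)) - cis (- (k' \<bullet> r))) * ?o + cis (- (k' \<bullet> r)) * (?o - ?o')"
      by (simp add: bloch_eq_orbital algebra_simps)
    then have "norm (bloch S n k r - bloch S n k' r)
        \<le> norm (cis (- (k \<bullet> r)) - cis (- (k' \<bullet> r))) * norm ?o + norm (?o - ?o')"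
      by (metis norm_triangle_ineq norm_mult norm_cis mult_1)
    also have "\<dots> \<le> (norm (k - k') * \<bar>R\<bar>) * \<bar>A\<bar> + \<bar>A\<bar> * norm (k - k')"
    proof (intro add_mono mult_mono)
      have "norm (cis (- (k \<bullet> r)) - cis (- (k' \<bullet> r))) \<le> \<bar>(k' - k) \<bullet> r\<bar>"
        using norm_cis_diff_le[of "- (k \<bullet> r)" "- (k' \<bullet> r)"] by (simp add: inner_diff_left)
      also have "\<dots> \<le> norm (k' - k) * norm r" by (rule Cauchy_Schwarz_ineq2)
      also have "\<dots> \<le> norm (k - k') * \<bar>R\<bar>"
        using R[OF r] by (simp add: norm_minus_commute mult_left_mono)
      finally show "norm (cis (- (k \<bullet> r)) - cis (- (k' \<bullet> r))) \<le> norm (k - k') * \<bar>R\<bar>" .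
      show "norm ?o \<le> \<bar>A\<bar>" using A(1)[OF r, of k] by linarith
      have "A * norm (k - k') \<le> \<bar>A\<bar> * norm (k - k')" by (intro mult_right_mono) auto
      with A(2)[OF r, of k k'] show "norm (?o - ?o') \<le> \<bar>A\<bar> * norm (k - k')" by linarith
    qed auto
    finally show ?thesis by (simp add: B_def algebra_simps)
  qed
  ultimately show ?thesis by blast
qed

definition bloch_const :: real where
  "bloch_const = (SOME A. A > 0 \<and> (\<forall>n k. \<forall>r\<in>cell S. norm (bloch S n k r) \<le> A) \<and>
    (\<forall>n k k'. \<forall>r\<in>cell S. norm (bloch S n k r - bloch S n k' r) \<le> A * norm (k - k')))"

lemma bloch_const: "bloch_const > 0" "r \<in> cell S \<Longrightarrow> norm (bloch S n k r) \<le> bloch_const"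
  "r \<in> cell S \<Longrightarrow> norm (bloch S n k r - bloch S n k' r) \<le> bloch_const * norm (k - k')"
proof -
  obtain A where A: "\<And>n k r. r \<in> cell S \<Longrightarrow> norm (bloch S n k r) \<le> A n"
      "\<And>n k k' r. r \<in> cell S \<Longrightarrow> norm (bloch S n k r - bloch S n k' r) \<le> A n * norm (k - k')"
    using bloch_bounded_Lipschitz1 by metis
  define M where "M = 1 + (\<Sum>n\<in>UNIV. \<bar>A n\<bar>)"
  have M: "A n \<le> M" for n
    using member_le_sum[of n UNIV "\<lambda>n. \<bar>A n\<bar>"] by (simp add: M_def)
  have "0 \<le> (\<Sum>n\<in>UNIV. \<bar>A n\<bar>)" by (intro sum_nonneg) simp
  then have "M > 0" unfolding M_def by linarith
  moreover have "norm (bloch S n k r) \<le> M" if "r \<in> cell S" for n k r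
    using A(1)[OF that, of n k] M[of n] by linarith
  moreover have "norm (bloch S n k r - bloch S n k' r) \<le> M * norm (k - k')" if "r \<in> cell S" for n k k' r
    using A(2)[OF that, of n k k'] mult_right_mono[OF M[of n], of "norm (k - k')"] by simp
  ultimately have "\<exists>A. A > 0 \<and> (\<forall>n k. \<forall>r\<in>cell S. norm (bloch S n k r) \<le> A) \<and>
    (\<forall>n k k'. \<forall>r\<in>cell S. norm (bloch S n k r - bloch S n k' r) \<le> A * norm (k - k'))" by blast
  from someI_ex[OF this, folded bloch_const_def]
  show "bloch_const > 0" "r \<in> cell S \<Longrightarrow> norm (bloch S n k r) \<le> bloch_const"
    "r \<in> cell S \<Longrightarrow> norm (bloch S n k r - bloch S n k' r) \<le> bloch_const * norm (k - k')"
    by auto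
qed

lemma borel_bloch: "bloch S n k \<in> borel_measurable borel"
proof -
  have "continuous_on UNIV (\<lambda>(k, r). iter_deriv [] (\<lambda>k. orbital S n k r) k)"
    using orbital_derivs_continuous[of "[]"] by simp
  then have "continuous_on UNIV (\<lambda>(k, r). orbital S n k r)" by simp
  from continuous_on_compose2[OF this, of UNIV "\<lambda>r. (k, r)"]
  have "continuous_on UNIV (\<lambda>r. orbital S n k r)" by (simp add: continuous_intros)
  then have "continuous_on UNIV (\<lambda>r. cis (- (k \<bullet> r)) * orbital S n k r)"
    by (intro continuous_intros) simp
  then show ?thesis
    by (intro borel_measurable_continuous_onI) (simp add: bloch_eq_orbital)
qed

lemma bloch_add_reciprocal:
  assumes "G \<in> reciprocal S"
  shows "bloch S n (k + G) r = cis (- (G \<bullet> r)) * bloch S n k r"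
proof -
  have "cis (- ((k + G) \<bullet> r)) = cis (- (G \<bullet> r)) * cis (- (k \<bullet> r))"
    unfolding cis_mult by (rule arg_cong[of _ _ cis]) (simp add: inner_add_left)
  then show ?thesis by (simp add: bloch_eq_orbital orbital_add_reciprocal[OF assms])
qed

definition codensity :: "'o + 'v \<Rightarrow> 'o + 'v \<Rightarrow> vec3 \<Rightarrow> vec3 \<Rightarrow> vec3 \<Rightarrow> complex" where
  "codensity n m k k' r = cnj (bloch S n k r) * bloch S m k' r"

lemma bounded_codensity: "bounded_on_cell (bloch_const\<^sup>2) (codensity n m k k')"
proof -
  have "(\<lambda>r. cnj (bloch S n k r)) \<in> borel_measurable borel"
    by (rule measurable_compose[OF borel_bloch]) (intro borel_measurable_continuous_onI continuous_intros)
  then have "bounded_on_cell bloch_const (\<lambda>r. cnj (bloch S n k r))" "bounded_on_cell bloch_const (bloch S m k')"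
    using bloch_const(2) borel_bloch by (auto simp: bounded_on_cell_def)
  from bounded_on_cell_mult[OF this] show ?thesis by (simp add: codensity_def[abs_def] power2_eq_square)
qed

lemma codensity_Lipschitz:
  assumes r: "r \<in> cell S"
  shows "norm (codensity n m k k' r - codensity n m p p' r) \<le> bloch_const\<^sup>2 * (norm (k - p) + norm (k' - p'))"
proof -
  have "codensity n m k k' r - codensity n m p p' r
      = cnj (bloch S n k r - bloch S n p r) * bloch S m k' r + cnj (bloch S n p r) * (bloch S m k' r - bloch S m p' r)"
    by (simp add: codensity_def algebra_simps)
  then have "norm (codensity n m k k' r - codensity n m p p' r)
      \<le> norm (bloch S n k r - bloch S n p r) * norm (bloch S m k' r) + norm (bloch S n p r) * norm (bloch S m k' r - bloch S m p' r)"
    by (metis norm_triangle_ineq norm_mult complex_mod_cnj)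
  also have "\<dots> \<le> (bloch_const * norm (k - p)) * bloch_const + bloch_const * (bloch_const * norm (k' - p'))"
    using bloch_const(1) bloch_const(2,3)[OF r] by (intro add_mono mult_mono) auto
  finally show ?thesis by (simp add: power2_eq_square algebra_simps)
qed

lemma fourier_codensity_zero:
  "fourier (codensity n m k k) 0 = (if n = m then 1 else 0)"
  using system by (simp add: insulator_def fourier_def codensity_def)

text \<open>A Lipschitz constant of the pair densities at \<open>G = 0\<close> with respect to the larger displacement of their
  two momenta.\<close>

definition coulomb_const :: real where "coulomb_const = 2 * vol * bloch_const\<^sup>2"

lemma coulomb_const_pos: "coulomb_const > 0"
  using vol_pos bloch_const(1) by (simp add: coulomb_const_def)

lemma fourier_codensity_diff:
  "norm (fourier (codensity n m k k') 0 - fourier (codensity n m p p') 0)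
    \<le> vol * (bloch_const\<^sup>2 * (norm (k - p) + norm (k' - p')))"
proof -
  have "bounded_on_cell (bloch_const\<^sup>2 * (norm (k - p) + norm (k' - p')))
      (\<lambda>r. codensity n m k k' r - codensity n m p p' r)"
    using bounded_codensity[of n m k k'] bounded_codensity[of n m p p'] codensity_Lipschitz
    by (auto simp: bounded_on_cell_def)
  from norm_fourier_le[OF this recip.zero] show ?thesis
    by (simp add: fourier_diff[OF bounded_codensity bounded_codensity])
qed

definition coulomb_weight :: "vec3 \<Rightarrow> vec3 \<Rightarrow> real" where
  "coulomb_weight q G = 1 / (norm (q + G))\<^sup>2"

lemma codensity_periodic:
  assumes "H \<in> reciprocal S"
  shows "codensity n m (k + H) (k' + H) = codensity n m k k'"
proof
  fix r
  have "cnj (cis (- (H \<bullet> r))) * cis (- (H \<bullet> r)) = 1" by (simp add: cis_cnj cis_mult)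
  moreover have "codensity n m (k + H) (k' + H) r
      = (cnj (cis (- (H \<bullet> r))) * cis (- (H \<bullet> r))) * codensity n m k k' r"
    unfolding codensity_def bloch_add_reciprocal[OF assms] complex_cnj_mult by (simp only: ac_simps)
  ultimately show "codensity n m (k + H) (k' + H) r = codensity n m k k' r" by (simp only: mult_1)
qed

context
  fixes n1 n2 n3 n4 :: "'o + 'v"
begin

text \<open>A repulsion integral as a function of \<open>k\<^sub>1\<close>, \<open>k\<^sub>2\<close> and the transferred momentum \<open>q\<close>. The weight is \<open>0\<close> at
  \<open>G = - q\<close>, as \<open>1 / 0 = 0\<close>, so the term excluded from the integral may be kept.\<close>

definition interaction :: "vec3 \<times> vec3 \<times> vec3 \<Rightarrow> complex" where
  "interaction = (\<lambda>(k1, k2, q).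
     coulomb_sum (coulomb_weight q) (codensity n1 n3 k1 (k1 + q)) (codensity n2 n4 k2 (k2 - q)))"

text \<open>Shifting \<open>q\<close> by \<open>H\<close> multiplies the orbitals by phases which shift the index of both Fourier
  coefficients by \<open>H\<close>; this reindexes the sum.\<close>

lemma interaction_periodic_q:
  assumes H: "H \<in> reciprocal S"
  shows "interaction (k1, k2, q + H) = interaction (k1, k2, q)"
proof -
  have e: "cis (- ((H + G) \<bullet> r)) = cis (- (H \<bullet> r)) * cis (- (G \<bullet> r))"
    "cis (- (- (H + G) \<bullet> r)) = cis (- (- H \<bullet> r)) * cis (- (- G \<bullet> r))" for G r
    unfolding cis_mult by (rule arg_cong[of _ _ cis]; simp add: inner_add_left inner_diff_left)+
  have f1: "fourier (codensity n1 n3 k1 (k1 + (q + H))) G = fourier (codensity n1 n3 k1 (k1 + q)) (H + G)" for G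
  proof -
    have "bloch S n3 (k1 + (q + H)) r = cis (- (H \<bullet> r)) * bloch S n3 (k1 + q) r" for r
      using bloch_add_reciprocal[OF H, of n3 "k1 + q"] by (simp add: add.assoc)
    then show ?thesis unfolding fourier_def codensity_def e by (simp only: ac_simps)
  qed
  have f2: "fourier (codensity n2 n4 k2 (k2 - (q + H))) (- G) = fourier (codensity n2 n4 k2 (k2 - q)) (- (H + G))" for G
  proof -
    have "bloch S n4 (k2 - (q + H)) r = cis (- (- H \<bullet> r)) * bloch S n4 (k2 - q) r" for r
      using bloch_add_reciprocal[OF recip.uminus[OF H], of n4 "k2 - q"] by (simp add: algebra_simps)
    then show ?thesis unfolding fourier_def codensity_def e by (simp only: ac_simps)
  qed
  have bij: "bij_betw (\<lambda>G. H + G) (reciprocal S) (reciprocal S)"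
    by (rule bij_betw_byWitness[of _ "\<lambda>G. G - H"]) (auto intro: recip.add recip.diff H)
  show ?thesis
    unfolding interaction_def split_conv coulomb_sum_def f1 f2
    by (subst infsum_reindex_bij_betw[OF bij, symmetric]) (simp add: coulomb_weight_def add.assoc)
qed

lemma interaction_periodic:
  assumes "R \<in> reciprocal3"
  shows "interaction (R + z) = interaction z"
proof -
  obtain a b c where R: "R = (a, b, c)" "a \<in> reciprocal S" "b \<in> reciprocal S" "c \<in> reciprocal S"
    using assms by auto
  obtain k1 k2 q where z: "z = (k1, k2, q)" by (cases z) auto
  have "interaction (R + z) = interaction (k1 + a, k2 + b, q)"
    using interaction_periodic_q[OF R(4), of "k1 + a" "k2 + b" q] by (simp add: R z ac_simps)
  also have "\<dots> = interaction z"
    using codensity_periodic[OF R(2), of n1 n3 k1 "k1 + q"] codensity_periodic[OF R(3), of n2 n4 k2 "k2 - q"]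
    by (simp add: interaction_def z algebra_simps)
  finally show ?thesis .
qed

text \<open>Near \<open>q = 0\<close> only the term \<open>G = 0\<close> is singular. By periodicity in \<open>q\<close> it is enough to consider \<open>q\<close> whose
  nearest lattice point is \<open>0\<close>; then all other lattice points keep a fixed distance from \<open>q\<close>.\<close>

definition regular_part :: "vec3 \<times> vec3 \<times> vec3 \<Rightarrow> complex" where
  "regular_part = (\<lambda>(k1, k2, q).
     coulomb_sum ((coulomb_weight q)(0 := 0)) (codensity n1 n3 k1 (k1 + q)) (codensity n2 n4 k2 (k2 - q)))"

definition singular_part :: "vec3 \<times> vec3 \<times> vec3 \<Rightarrow> complex" where
  "singular_part = (\<lambda>(k1, k2, q).
     of_real (1 / (norm q)\<^sup>2) * fourier (codensity n1 n3 k1 (k1 + q)) 0 * fourier (codensity n2 n4 k2 (k2 - q)) 0)"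

definition recip_gap :: real where
  "recip_gap = (SOME c. c > 0 \<and> (\<forall>G\<in>reciprocal S. G \<noteq> 0 \<longrightarrow> c \<le> norm G))"

lemma recip_gap: "recip_gap > 0" "G \<in> reciprocal S \<Longrightarrow> G \<noteq> 0 \<Longrightarrow> recip_gap \<le> norm G"
proof -
  have "\<exists>c. c > 0 \<and> (\<forall>G\<in>reciprocal S. G \<noteq> 0 \<longrightarrow> c \<le> norm G)" using reciprocal_separated by blast
  from someI_ex[OF this, folded recip_gap_def]
  show "recip_gap > 0" "G \<in> reciprocal S \<Longrightarrow> G \<noteq> 0 \<Longrightarrow> recip_gap \<le> norm G" by auto
qed

lemma shifted_lattice_far:
  assumes q: "norm q = lat_dist q" and q': "norm (q' - q) \<le> norm q / 2"
    and G: "G \<in> reciprocal S" "G \<noteq> 0"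
  shows "recip_gap / 2 \<le> norm (q + G)" "recip_gap / 4 \<le> norm (q' + G)"
proof -
  have a: "norm q \<le> norm (q + G)" using lat_dist_le[OF G(1), of q] q by simp
  have "norm G \<le> norm (q + G) + norm q" using norm_triangle_ineq4[of "q + G" q] by simp
  with a recip_gap(2)[OF G] show *: "recip_gap / 2 \<le> norm (q + G)" by linarith
  have "norm (q + G) \<le> norm (q' + G) + norm (q' - q)"
    using norm_triangle_ineq4[of "q' + G" "q' - q"] by (simp add: add.commute)
  with a q' * show "recip_gap / 4 \<le> norm (q' + G)" by linarith
qed

lemma coulomb_weight_bound:
  assumes "0 < c" "c \<le> norm (q + G)"
  shows "\<bar>coulomb_weight q G\<bar> \<le> 1 / c\<^sup>2"
  using assms by (auto simp: coulomb_weight_def intro!: divide_left_mono power_mono mult_pos_pos)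

lemma interaction_split:
  assumes q: "norm q = lat_dist q" and q': "norm (q' - q) \<le> norm q / 2"
  shows "interaction (k1, k2, q') = singular_part (k1, k2, q') + regular_part (k1, k2, q')"
proof -
  have "\<bar>coulomb_weight q' G\<bar> \<le> 1 / (recip_gap / 4)\<^sup>2" if "G \<in> reciprocal S" "G \<noteq> 0" for G
    using recip_gap(1) shifted_lattice_far(2)[OF q q' that] by (intro coulomb_weight_bound) auto
  from coulomb_sum_split[where w = "coulomb_weight q'", OF bounded_codensity bounded_codensity this]
  have "coulomb_sum (coulomb_weight q') (codensity n1 n3 k1 (k1 + q')) (codensity n2 n4 k2 (k2 - q'))
      = of_real (coulomb_weight q' 0) * fourier (codensity n1 n3 k1 (k1 + q')) 0 * fourier (codensity n2 n4 k2 (k2 - q')) 0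
        + coulomb_sum ((coulomb_weight q')(0 := 0)) (codensity n1 n3 k1 (k1 + q')) (codensity n2 n4 k2 (k2 - q'))" .
  moreover have "coulomb_weight q' 0 = 1 / (norm q')\<^sup>2" by (simp add: coulomb_weight_def)
  ultimately show ?thesis unfolding interaction_def singular_part_def regular_part_def split_conv by simp
qed

text \<open>For \<open>q = 0\<close> the coefficient is the inner product of two different bands and vanishes.\<close>

lemma fourier_codensity_small:
  assumes "n \<noteq> m"
  shows "norm (fourier (codensity n m k (k + q)) 0) \<le> coulomb_const * norm q"
    "norm (fourier (codensity n m k (k - q)) 0) \<le> coulomb_const * norm q"
proof -
  have "vol * (bloch_const\<^sup>2 * norm q) \<le> coulomb_const * norm q"
    using vol_pos by (simp add: coulomb_const_def)
  then show "norm (fourier (codensity n m k (k + q)) 0) \<le> coulomb_const * norm q"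
    "norm (fourier (codensity n m k (k - q)) 0) \<le> coulomb_const * norm q"
    using fourier_codensity_diff[of n m k "k + q" k k] fourier_codensity_diff[of n m k "k - q" k k] assms
    by (auto simp: fourier_codensity_zero)
qed

lemma singular_part_bound:
  assumes n: "n1 \<noteq> n3" "n2 \<noteq> n4"
  shows "norm (singular_part z) \<le> coulomb_const\<^sup>2"
proof -
  obtain k1 k2 q where z: "z = (k1, k2, q)" by (cases z) auto
  show ?thesis
  proof (cases "q = 0")
    case False
    have "norm (singular_part z)
        = 1 / (norm q)\<^sup>2 * norm (fourier (codensity n1 n3 k1 (k1 + q)) 0) * norm (fourier (codensity n2 n4 k2 (k2 - q)) 0)"
      by (simp add: singular_part_def z norm_mult norm_divide norm_power)
    also have "\<dots> \<le> 1 / (norm q)\<^sup>2 * (coulomb_const * norm q) * (coulomb_const * norm q)"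
      using fourier_codensity_small n coulomb_const_pos by (intro mult_mono) auto
    also have "\<dots> = coulomb_const\<^sup>2" using False by (simp add: field_simps power2_eq_square)
    finally show ?thesis .
  qed (simp add: z singular_part_def)
qed

text \<open>Both densities are \<open>O(|q|)\<close> and vary by \<open>O(\<delta>)\<close>, so their product over \<open>|q|\<^sup>2\<close> varies by
  \<open>O(\<delta> / |q|)\<close>. The condition on \<open>q'\<close> keeps \<open>|q'|\<close> comparable with \<open>|q|\<close>.\<close>

lemma singular_part_near:
  assumes n: "n1 \<noteq> n3" "n2 \<noteq> n4" and q': "norm (q' - q) \<le> norm q / 2"
    and \<delta>: "norm (k1 - k1') \<le> \<delta>" "norm (k2 - k2') \<le> \<delta>" "norm (q - q') \<le> \<delta>"
  shows "norm (singular_part (k1, k2, q) - singular_part (k1', k2', q')) * norm q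
    \<le> 10 * coulomb_const\<^sup>2 * \<delta>"
proof (cases "q = 0")
  case True
  moreover have "0 \<le> \<delta>" using \<delta>(1) norm_ge_zero order_trans by blast
  ultimately show ?thesis by simp
next
  case False
  let ?M = coulomb_const
  define a where "a = norm q" define a' where "a' = norm q'"
  have a: "a > 0" using False by (simp add: a_def)
  have aa': "a / 2 \<le> a'" "a' \<le> 3 / 2 * a" "\<bar>a - a'\<bar> \<le> \<delta>"
    using norm_triangle_ineq3[of q q'] q' \<delta>(3) by (auto simp: a_def a'_def norm_minus_commute)
  have a': "a' > 0" using a aa' by linarith
  have M: "?M > 0" by (rule coulomb_const_pos)
  have \<delta>0: "\<delta> \<ge> 0" using \<delta>(1) norm_ge_zero order_trans by blast
  define g where "g = fourier (codensity n1 n3 k1 (k1 + q)) 0"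
  define g' where "g' = fourier (codensity n1 n3 k1' (k1' + q')) 0"
  define h where "h = fourier (codensity n2 n4 k2 (k2 - q)) 0"
  define h' where "h' = fourier (codensity n2 n4 k2' (k2' - q')) 0"
  have gb: "norm g \<le> ?M * a" "norm g' \<le> ?M * a'" "norm h \<le> ?M * a" "norm h' \<le> ?M * a'"
    using fourier_codensity_small n by (auto simp: g_def g'_def h_def h'_def a_def a'_def)
  have "norm (k1 + q - (k1' + q')) \<le> norm (k1 - k1') + norm (q - q')"
    by (metis add_diff_add norm_triangle_ineq)
  then have "vol * (bloch_const\<^sup>2 * (norm (k1 - k1') + norm (k1 + q - (k1' + q')))) \<le> vol * (bloch_const\<^sup>2 * (4 * \<delta>))"
    using \<delta> \<delta>0 vol_pos by (intro mult_left_mono) auto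
  then have dg: "norm (g - g') \<le> 2 * ?M * \<delta>"
    using fourier_codensity_diff[of n1 n3 k1 "k1 + q" k1' "k1' + q'"]
    by (simp add: g_def g'_def coulomb_const_def algebra_simps)
  have "norm (k2 - q - (k2' - q')) \<le> norm (k2 - k2') + norm (q - q')"
    using norm_triangle_ineq4[of "k2 - k2'" "q - q'"] by (simp add: algebra_simps)
  then have "vol * (bloch_const\<^sup>2 * (norm (k2 - k2') + norm (k2 - q - (k2' - q')))) \<le> vol * (bloch_const\<^sup>2 * (4 * \<delta>))"
    using \<delta> \<delta>0 vol_pos by (intro mult_left_mono) auto
  then have dh: "norm (h - h') \<le> 2 * ?M * \<delta>"
    using fourier_codensity_diff[of n2 n4 k2 "k2 - q" k2' "k2' - q'"]
    by (simp add: h_def h'_def coulomb_const_def algebra_simps)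
  have "singular_part (k1, k2, q) - singular_part (k1', k2', q')
      = of_real (1 / a\<^sup>2) * ((g - g') * h) + of_real (1 / a\<^sup>2) * (g' * (h - h')) + of_real (1 / a\<^sup>2 - 1 / a'\<^sup>2) * (g' * h')"
    by (simp add: singular_part_def g_def g'_def h_def h'_def a_def a'_def algebra_simps)
  also have "norm \<dots> \<le> 1 / a\<^sup>2 * (norm (g - g') * norm h) + 1 / a\<^sup>2 * (norm g' * norm (h - h'))
      + \<bar>1 / a\<^sup>2 - 1 / a'\<^sup>2\<bar> * (norm g' * norm h')"
    by (intro order_trans[OF norm_triangle_ineq] add_mono) (auto simp only: norm_mult norm_of_real abs_divide power2_abs abs_one abs_power2)
  also have "\<dots> \<le> 1 / a\<^sup>2 * ((2 * ?M * \<delta>) * (?M * a)) + 1 / a\<^sup>2 * ((?M * (3 / 2 * a)) * (2 * ?M * \<delta>))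
      + (\<delta> * (a + a') / (a\<^sup>2 * a'\<^sup>2)) * ((?M * a') * (?M * a'))"
  proof (intro add_mono mult_mono)
    show "norm g' \<le> ?M * (3 / 2 * a)" using gb(2) mult_left_mono[OF aa'(2), of ?M] M by linarith
    have "1 / a\<^sup>2 - 1 / a'\<^sup>2 = (a' - a) * ((a + a') / (a\<^sup>2 * a'\<^sup>2))"
      using a a' by (simp add: field_simps power2_eq_square)
    then have "\<bar>1 / a\<^sup>2 - 1 / a'\<^sup>2\<bar> = \<bar>a - a'\<bar> * ((a + a') / (a\<^sup>2 * a'\<^sup>2))"
      using a a' by (simp add: abs_mult abs_minus_commute)
    also have "\<dots> \<le> \<delta> * ((a + a') / (a\<^sup>2 * a'\<^sup>2))"
      using aa'(3) a a' by (intro mult_right_mono) auto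
    finally show "\<bar>1 / a\<^sup>2 - 1 / a'\<^sup>2\<bar> \<le> \<delta> * (a + a') / (a\<^sup>2 * a'\<^sup>2)" by simp
  qed (use a a' M \<delta>0 gb dg dh in auto)
  finally have main: "norm (singular_part (k1, k2, q) - singular_part (k1', k2', q')) \<le> \<dots>" .
  \<comment> \<open>The three terms contribute 2, 3 and at most 5 times \<open>?M\<^sup>2 * \<delta>\<close>.\<close>
  have "(1 / a\<^sup>2 * ((2 * ?M * \<delta>) * (?M * a)) + 1 / a\<^sup>2 * ((?M * (3 / 2 * a)) * (2 * ?M * \<delta>))
      + (\<delta> * (a + a') / (a\<^sup>2 * a'\<^sup>2)) * ((?M * a') * (?M * a'))) * a
      = 5 * ?M\<^sup>2 * \<delta> + ?M\<^sup>2 * \<delta> * ((a + a') / a)"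
    using a a' by (simp add: field_simps power2_eq_square)
  also have "(a + a') / a \<le> 5" using aa' a by (simp add: field_simps)
  then have "5 * ?M\<^sup>2 * \<delta> + ?M\<^sup>2 * \<delta> * ((a + a') / a) \<le> 5 * ?M\<^sup>2 * \<delta> + ?M\<^sup>2 * \<delta> * 5"
    using \<delta>0 by (intro add_left_mono mult_left_mono) auto
  finally show ?thesis
    using mult_right_mono[OF main, of a] a by (simp add: a_def algebra_simps)
qed

text \<open>In terms of a lower bound \<open>c\<close> of the distance to the other lattice points and the bound \<open>A\<close> of the densities: the first
  summand bounds the regular part, the others collect its Lipschitz constants in the weight and in
  the two densities.\<close>

definition regular_const :: real where
  "regular_const = (let c = recip_gap / 4; A = bloch_const\<^sup>2 in
     1 / c\<^sup>2 * (vol * A) * (vol * A) +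
     (2 / c ^ 3 * (vol * A) * (vol * A) + 1 / c\<^sup>2 * (vol * (A * 3)) * (vol * A) + 1 / c\<^sup>2 * (vol * A) * (vol * (A * 3))))"

lemma regular_const_nonneg: "0 \<le> regular_const"
  using recip_gap(1) vol_pos by (simp add: regular_const_def Let_def)

lemma regular_part_near:
  assumes q: "norm q = lat_dist q" and q': "norm (q' - q) \<le> norm q / 2"
    and \<delta>: "norm (k1 - k1') \<le> \<delta>" "norm (k2 - k2') \<le> \<delta>" "norm (q - q') \<le> \<delta>"
  shows "norm (regular_part (k1, k2, q)) \<le> regular_const"
    and "norm (regular_part (k1, k2, q) - regular_part (k1', k2', q')) \<le> regular_const * \<delta>"
proof -
  define c where "c = recip_gap / 4"
  have c: "c > 0" using recip_gap(1) by (simp add: c_def)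
  define A where "A = bloch_const\<^sup>2"
  have A: "A > 0" using bloch_const(1) by (simp add: A_def)
  define K1 where "K1 = 1 / c\<^sup>2 * (vol * A) * (vol * A)"
  define K2 where "K2 = 2 / c ^ 3 * (vol * A) * (vol * A) + 1 / c\<^sup>2 * (vol * (A * 3)) * (vol * A) + 1 / c\<^sup>2 * (vol * A) * (vol * (A * 3))"
  have K: "K1 \<ge> 0" "K2 \<ge> 0" using c A vol_pos by (auto simp: K1_def K2_def)
  have rc: "regular_const = K1 + K2" by (simp only: regular_const_def K1_def K2_def c_def A_def Let_def)
  have \<delta>0: "\<delta> \<ge> 0" using \<delta>(1) norm_ge_zero order_trans by blast
  let ?w = "(coulomb_weight q)(0 := 0)" and ?w' = "(coulomb_weight q')(0 := 0)"
  have far: "c \<le> norm (q + G)" "c \<le> norm (q' + G)" if "G \<in> reciprocal S" "G \<noteq> 0" for G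
    using shifted_lattice_far[OF q q' that] recip_gap(1) by (auto simp: c_def)
  have w: "\<bar>?w G\<bar> \<le> 1 / c\<^sup>2" "\<bar>?w' G\<bar> \<le> 1 / c\<^sup>2" if "G \<in> reciprocal S" for G
    using coulomb_weight_bound[OF c] far[OF that] by auto
  have dw: "\<bar>?w G - ?w' G\<bar> \<le> 2 / c ^ 3 * \<delta>" if G: "G \<in> reciprocal S" for G
  proof (cases "G = 0")
    case False
    have "\<bar>?w G - ?w' G\<bar> \<le> 2 / c ^ 3 * \<bar>norm (q + G) - norm (q' + G)\<bar>"
      using inverse_square_diff[OF c far[OF G False]] False by (simp add: coulomb_weight_def)
    also have "\<bar>norm (q + G) - norm (q' + G)\<bar> \<le> \<delta>"
      using norm_triangle_ineq3[of "q + G" "q' + G"] \<delta>(3) by simp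
    then have "2 / c ^ 3 * \<bar>norm (q + G) - norm (q' + G)\<bar> \<le> 2 / c ^ 3 * \<delta>"
      using c by (intro mult_left_mono) auto
    finally show ?thesis .
  qed (use \<delta>0 c in simp)
  have "norm (regular_part (k1, k2, q)) \<le> K1"
    unfolding regular_part_def split_conv K1_def A_def
    by (intro norm_coulomb_sum_le bounded_codensity w)
  then show "norm (regular_part (k1, k2, q)) \<le> regular_const" using K rc by simp
  have d1: "norm (codensity n1 n3 k1 (k1 + q) r - codensity n1 n3 k1' (k1' + q') r) \<le> A * 3 * \<delta>"
    if "r \<in> cell S" for r
  proof -
    have "norm (k1 + q - (k1' + q')) \<le> norm (k1 - k1') + norm (q - q')"
      by (metis add_diff_add norm_triangle_ineq)
    then have "A * (norm (k1 - k1') + norm (k1 + q - (k1' + q'))) \<le> A * (3 * \<delta>)"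
      using \<delta> A by (intro mult_left_mono) auto
    then show ?thesis using codensity_Lipschitz[OF that, of n1 n3 k1 "k1 + q" k1' "k1' + q'"] by (simp add: A_def)
  qed
  have d2: "norm (codensity n2 n4 k2 (k2 - q) r - codensity n2 n4 k2' (k2' - q') r) \<le> A * 3 * \<delta>"
    if "r \<in> cell S" for r
  proof -
    have "norm (k2 - q - (k2' - q')) \<le> norm (k2 - k2') + norm (q - q')"
      using norm_triangle_ineq4[of "k2 - k2'" "q - q'"] by (simp add: algebra_simps)
    then have "A * (norm (k2 - k2') + norm (k2 - q - (k2' - q'))) \<le> A * (3 * \<delta>)"
      using \<delta> A by (intro mult_left_mono) auto
    then show ?thesis using codensity_Lipschitz[OF that, of n2 n4 k2 "k2 - q" k2' "k2' - q'"] by (simp add: A_def)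
  qed
  have "norm (regular_part (k1, k2, q) - regular_part (k1', k2', q'))
    \<le> (2 / c ^ 3 * \<delta>) * (vol * A) * (vol * A) + 1 / c\<^sup>2 * (vol * (A * 3 * \<delta>)) * (vol * A)
      + 1 / c\<^sup>2 * (vol * A) * (vol * (A * 3 * \<delta>))"
    unfolding regular_part_def split_conv A_def
    by (intro coulomb_sum_diff bounded_codensity w dw d1[unfolded A_def] d2[unfolded A_def])
  also have "\<dots> = K2 * \<delta>" by (simp add: K2_def algebra_simps)
  also have "\<dots> \<le> regular_const * \<delta>" unfolding rc using K \<delta>0 by (intro mult_right_mono) auto
  finally show "norm (regular_part (k1, k2, q) - regular_part (k1', k2', q')) \<le> regular_const * \<delta>" .
qed

text \<open>A lattice shift of \<open>q\<close> in both arguments makes \<open>0\<close> the lattice point nearest to \<open>q\<close>, where the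
  interaction splits into its singular and its regular part.\<close>

lemma mild_interaction:
  assumes n: "n1 \<noteq> n3" "n2 \<noteq> n4"
  shows "mild (\<lambda>(k1, k2, q). lat_dist q) (interaction)"
proof -
  let ?K = regular_const
  show ?thesis
  proof (rule mildI_near[where c = "1/2" and B = "coulomb_const\<^sup>2 + ?K" and K = "10 * coulomb_const\<^sup>2 + ?K * zone_radius"])
    fix z :: "vec3 \<times> vec3 \<times> vec3"
    obtain k1 k2 q where z: "z = (k1, k2, q)" by (cases z) auto
    obtain H where H: "H \<in> reciprocal S" "lat_dist q = norm (q + H)" using lat_dist_attained by blast
    have p: "norm (q + H) = lat_dist (q + H)" using H lat_dist_add[OF H(1), of q] by (simp add: add.commute)
    have "norm (interaction (k1, k2, q + H)) \<le> coulomb_const\<^sup>2 + ?K"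
      using singular_part_bound[OF n, of "(k1, k2, q + H)"]
        regular_part_near(1)[OF p, of "q + H" k1 k1 0 k2 k2] interaction_split[OF p, of "q + H" k1 k2]
      by (auto intro: norm_triangle_mono)
    then show "norm (interaction z) \<le> coulomb_const\<^sup>2 + ?K"
      by (simp add: z interaction_periodic_q[OF H(1)])
    fix w :: "vec3 \<times> vec3 \<times> vec3"
    obtain k1' k2' q' where w: "w = (k1', k2', q')" by (cases w) auto
    assume "dist z w \<le> 1 / 2 * (case z of (k1, k2, q) \<Rightarrow> lat_dist q)"
    then have near: "dist z w \<le> norm (q + H) / 2" using H by (simp add: z)
    have c: "norm (k1 - k1') \<le> dist z w" "norm (k2 - k2') \<le> dist z w" "norm (q + H - (q' + H)) \<le> dist z w"
      using norm_components_le_dist[where x = k1 and y = k2 and z = q and x' = k1' and y' = k2' and z' = q'] by (auto simp: z w)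
    have q'q: "norm (q' + H - (q + H)) \<le> norm (q + H) / 2"
      using c(3) near by (simp add: norm_minus_commute)
    let ?E = "interaction" and ?s = "singular_part" and ?r = "regular_part"
    let ?z = "(k1, k2, q + H)" and ?w = "(k1', k2', q' + H)"
    have "?E z - ?E w = (?s ?z - ?s ?w) + (?r ?z - ?r ?w)"
      using interaction_split[OF p, of "q + H" k1 k2] interaction_split[OF p q'q, of k1' k2']
      by (simp add: z w interaction_periodic_q[OF H(1)])
    then have "norm (?E z - ?E w) \<le> norm (?s ?z - ?s ?w) + norm (?r ?z - ?r ?w)"
      by (metis norm_triangle_ineq)
    then have "norm (?E z - ?E w) * norm (q + H) \<le> (norm (?s ?z - ?s ?w) + norm (?r ?z - ?r ?w)) * norm (q + H)"
      by (intro mult_right_mono) auto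
    also have "\<dots> \<le> 10 * coulomb_const\<^sup>2 * dist z w + (?K * dist z w) * zone_radius"
    proof -
      have "norm (?r ?z - ?r ?w) * norm (q + H) \<le> (?K * dist z w) * zone_radius"
        using regular_part_near(2)[OF p q'q c] regular_const_nonneg lat_dist_le_radius[of q] H by (intro mult_mono) auto
      with singular_part_near[OF n q'q c] show ?thesis by (simp add: distrib_right)
    qed
    finally show "norm (?E z - ?E w) * (case z of (k1, k2, q) \<Rightarrow> lat_dist q) \<le> (10 * coulomb_const\<^sup>2 + ?K * zone_radius) * dist z w"
      using H by (simp add: z algebra_simps)
  qed (auto simp: lat_dist_nonneg)
qed

text \<open>At lattice vectors \<open>q\<close> the singular part vanishes, and the integral equals the continuous regular
  part at \<open>q = 0\<close>.\<close>

lemma borel_interaction: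
  assumes n: "n1 \<noteq> n3" "n2 \<noteq> n4"
  shows "interaction \<in> borel_measurable borel"
proof (rule mild_borel[OF mild_interaction[OF n]])
  let ?r = "regular_part"
  have 0: "norm (0::vec3) = lat_dist 0" using lat_dist_zero_iff[of 0] recip.zero by simp
  have "norm (?r (k1, k2, 0) - ?r (k1', k2', 0)) \<le> regular_const * dist (k1, k2, q) (k1', k2', q')" for k1 k2 q k1' k2' q' :: vec3
    using norm_components_le_dist[where x = k1 and y = k2 and z = q and x' = k1' and y' = k2' and z' = q']
    by (intro regular_part_near(2)[OF 0]) auto
  note lip = this
  have "regular_const-lipschitz_on UNIV (\<lambda>(k1, k2, q :: vec3). ?r (k1, k2, 0))"
    by (intro lipschitz_onI regular_const_nonneg) (auto simp: dist_norm[where 'a = complex] intro!: lip)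
  then show "continuous_on UNIV (\<lambda>(k1, k2, q :: vec3). ?r (k1, k2, 0))" by (rule lipschitz_on_continuous_on)
  fix z :: "vec3 \<times> vec3 \<times> vec3"
  obtain k1 k2 q where z: "z = (k1, k2, q)" by (cases z) auto
  assume "(case z of (k1, k2, q) \<Rightarrow> lat_dist q) = 0"
  then have q: "q \<in> reciprocal S" by (simp add: z lat_dist_zero_iff)
  have "interaction z = interaction (k1, k2, 0)"
    using interaction_periodic_q[OF q, of k1 k2 0] by (simp add: z)
  also have "\<dots> = ?r (k1, k2, 0)"
    using interaction_split[of 0 0 k1 k2] recip.zero
    by (simp add: lat_dist_zero_iff singular_part_def)
  finally show "interaction z = (case z of (k1, k2, q) \<Rightarrow> ?r (k1, k2, 0))" by (simp add: z)
next
  show "continuous_on UNIV (\<lambda>(k1, k2, q). lat_dist q)"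
    unfolding split_beta by (intro continuous_intros)
qed (auto simp: lat_dist_nonneg)

end

lemma eri_eq_interaction:
  "eri S P1 P2 P3 P4 = of_real (4 * pi / vol) *
     interaction (fst P1) (fst P2) (fst P3) (fst P4) (snd P1, snd P2, snd P3 - snd P1)"
proof -
  have pd: "pair_density S P Q G = fourier (codensity (fst P) (fst Q) (snd P) (snd Q)) G" for P Q G
    by (simp add: pair_density_def fourier_def codensity_def)
  show ?thesis
    unfolding eri_def interaction_def coulomb_sum_def Let_def pd coulomb_weight_def split_conv fst_conv snd_conv
    by (intro arg_cong2[of _ _ _ _ "(*)"] refl infsum_cong_neutral) auto
qed

text \<open>The coefficient of the amplitude in the energy functionals.\<close>

definition W_density :: "'o \<Rightarrow> 'o \<Rightarrow> 'v \<Rightarrow> 'v \<Rightarrow> vec3 \<times> vec3 \<times> vec3 \<Rightarrow> complex" where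
  "W_density i j a b = (\<lambda>(ki, kj, ka). eri_w S (i, ki) (j, kj) (a, ka) (b, fold_zone S (ki + kj - ka)))"

text \<open>The exchange integral transfers the momentum \<open>k\<^sub>b - k\<^sub>i\<close>, which is \<open>k\<^sub>j - k\<^sub>a\<close> up to a reciprocal vector;
  periodicity thus removes the folding, which is discontinuous.\<close>

lemma W_density_eq:
  "W_density i j a b = (\<lambda>(ki, kj, ka).
     of_real (8 * pi / vol) * interaction (Inl i) (Inl j) (Inr a) (Inr b) (ki, kj, ka - ki)
   - of_real (4 * pi / vol) * interaction (Inl i) (Inl j) (Inr b) (Inr a) (ki, kj, kj - ka))"
proof -
  have "interaction n1 n2 n3 n4 (ki, kj, fold_zone S (ki + kj - ka) - ki) = interaction n1 n2 n3 n4 (ki, kj, kj - ka)"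
    for n1 n2 n3 n4 ki kj ka
  proof -
    have "kj - ka - (fold_zone S (ki + kj - ka) - ki) \<in> reciprocal S"
      using fold_zone(2)[of "ki + kj - ka"] by (simp add: algebra_simps)
    from interaction_periodic_q[OF this, of n1 n2 n3 n4 ki kj "fold_zone S (ki + kj - ka) - ki"]
    show ?thesis by simp
  qed
  then show ?thesis
    by (auto simp: W_density_def eri_w_def eri_eq_interaction occ_def vir_def fun_eq_iff algebra_simps)
qed

lemma mild_W_density: "mild sing_dist (W_density i j a b)"
  and borel_W_density: "W_density i j a b \<in> borel_measurable borel"
proof -
  let ?\<phi> = "\<lambda>(ki, kj, ka). (ki, kj, ka - ki :: vec3)" and ?\<psi> = "\<lambda>(ki, kj, ka). (ki, kj, kj - ka :: vec3)"
  have \<phi>: "dist (?\<phi> z) (?\<phi> w) \<le> 4 * dist z w" and \<psi>: "dist (?\<psi> z) (?\<psi> w) \<le> 4 * dist z w" for z w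
  proof -
    obtain x y u where z: "z = (x, y, u)" by (cases z) auto
    obtain x' y' u' where w: "w = (x', y', u')" by (cases w) auto
    note c = norm_components_le_dist[where x = x and y = y and z = u and x' = x' and y' = y' and z' = u']
    have "norm (u - x - (u' - x')) \<le> norm (u - u') + norm (x - x')"
      using norm_triangle_ineq4[of "u - u'" "x - x'"] by (simp add: algebra_simps)
    with c dist_triple_le[of x y "u - x" x' y' "u' - x'"] show "dist (?\<phi> z) (?\<phi> w) \<le> 4 * dist z w"
      by (simp add: z w)
    have "norm (y - u - (y' - u')) \<le> norm (y - y') + norm (u - u')"
      using norm_triangle_ineq4[of "y - y'" "u - u'"] by (simp add: algebra_simps)
    with c dist_triple_le[of x y "y - u" x' y' "y' - u'"] show "dist (?\<psi> z) (?\<psi> w) \<le> 4 * dist z w"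
      by (simp add: z w)
  qed
  have m\<phi>: "mild sing_dist (\<lambda>z. interaction (Inl i) (Inl j) (Inr a) (Inr b) (?\<phi> z))"
    by (rule mild_mono[OF mild_compose[OF mild_interaction \<phi>]]) (auto simp: sing_dist_def)
  have m\<psi>: "mild sing_dist (\<lambda>z. interaction (Inl i) (Inl j) (Inr b) (Inr a) (?\<psi> z))"
    by (rule mild_mono[OF mild_compose[OF mild_interaction \<psi>]]) (auto simp: sing_dist_def)
  have "W_density i j a b = (\<lambda>z. of_real (8 * pi / vol) * interaction (Inl i) (Inl j) (Inr a) (Inr b) (?\<phi> z)
     - of_real (4 * pi / vol) * interaction (Inl i) (Inl j) (Inr b) (Inr a) (?\<psi> z))"
    by (auto simp: W_density_eq fun_eq_iff)
  note eq = this
  show "mild sing_dist (W_density i j a b)"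
    unfolding eq by (intro mild_diff mild_cmult m\<phi> m\<psi> sing_dist_nonneg)
  have b\<phi>: "?\<phi> \<in> borel_measurable borel" and b\<psi>: "?\<psi> \<in> borel_measurable borel"
    unfolding split_beta by (intro borel_measurable_continuous_onI continuous_intros)+
  have "(\<lambda>z. interaction (Inl i) (Inl j) (Inr a) (Inr b) (?\<phi> z)) \<in> borel_measurable borel"
    by (rule measurable_compose[OF b\<phi> borel_interaction]) auto
  moreover have "(\<lambda>z. interaction (Inl i) (Inl j) (Inr b) (Inr a) (?\<psi> z)) \<in> borel_measurable borel"
    by (rule measurable_compose[OF b\<psi> borel_interaction]) auto
  ultimately show "W_density i j a b \<in> borel_measurable borel"
    unfolding eq by (intro borel_measurable_diff borel_measurable_times borel_measurable_const)
qed

lemma W_density_periodic: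
  assumes "R \<in> reciprocal3"
  shows "W_density i j a b (R + z) = W_density i j a b z"
proof -
  obtain x y u where R: "R = (x, y, u)" "x \<in> reciprocal S" "y \<in> reciprocal S" "u \<in> reciprocal S"
    using assms by auto
  obtain ki kj ka where z: "z = (ki, kj, ka)" by (cases z) auto
  have "(x, y, u - x) \<in> reciprocal3" "(x, y, y - u) \<in> reciprocal3" using R recip.diff by auto
  note this[THEN interaction_periodic]
  from this(1)[of _ _ _ _ "(ki, kj, ka - ki)"] this(2)[of _ _ _ _ "(ki, kj, kj - ka)"]
  show ?thesis by (simp add: W_density_eq R z algebra_simps)
qed

end

section \<open>The amplitude space\<close>

lemma has_derivative_shift_invariant:
  assumes "\<And>x. f (x + a) = f x" "(f has_derivative D) (at (x + a))"
  shows "(f has_derivative D) (at x)"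
proof -
  have "((\<lambda>x. x + a) has_derivative (\<lambda>h. h)) (at x)" by (auto intro!: derivative_eq_intros)
  from has_derivative_compose[OF this assms(2)] show ?thesis by (simp add: assms(1))
qed

lemma smooth_on_imp_differentiable:
  assumes "smooth_on U f"
  shows "f differentiable_on U"
  using assms[unfolded smooth_on_def, rule_format, of "[]"] by simp

lemma smooth_on_imp_partial_differentiable:
  assumes "smooth_on U f" "e \<in> Basis"
  shows "(\<lambda>x. frechet_derivative f (at x) e) differentiable_on U"
  using assms(1)[unfolded smooth_on_def, rule_format, of "[e]"] assms(2) by simp

context insulating_system
begin

definition diag_dist :: "vec3 \<times> vec3 \<times> vec3 \<Rightarrow> real" where
  "diag_dist = (\<lambda>(ki, kj, ka). lat_dist (ka - ki))"

lemma diag_dist_nonneg: "0 \<le> diag_dist z"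
  by (auto simp: diag_dist_def lat_dist_nonneg split: prod.split)

lemma sing_dist_le_diag_dist: "sing_dist z \<le> diag_dist z"
  by (auto simp: sing_dist_def diag_dist_def split: prod.split)

lemma continuous_diag_dist: "continuous_on UNIV diag_dist"
  unfolding diag_dist_def split_beta by (intro continuous_intros)

lemma diag_dist_pos_iff: "0 < diag_dist z \<longleftrightarrow> snd (snd z) - fst z \<notin> reciprocal S"
  using lat_dist_nonneg lat_dist_zero_iff[of "snd (snd z) - fst z"]
  by (auto simp: diag_dist_def split_beta less_le)

lemma off_diagonal_eq: "{(ki, kj, ka). ka - ki \<notin> reciprocal S} = {z. 0 < diag_dist z}"
  by (auto simp: diag_dist_pos_iff)

lemma open_off_diagonal: "open {z. 0 < diag_dist z}"
  using open_Collect_less[OF continuous_on_const continuous_diag_dist] by simp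

lemma diag_dist_Lipschitz: "diag_dist z \<le> diag_dist w + 2 * dist z w"
proof -
  obtain x y u where z: "z = (x, y, u)" by (cases z) auto
  obtain x' y' u' where w: "w = (x', y', u')" by (cases w) auto
  have "dist (u - x) (u' - x') \<le> norm (u - u') + norm (x - x')"
    using norm_triangle_ineq4[of "u - u'" "x - x'"] by (simp add: dist_norm algebra_simps)
  then show ?thesis
    using lat_dist_triangle[of "u - x" "u' - x'"]
      norm_components_le_dist[where x = x and y = y and z = u and x' = x' and y' = y' and z' = u']
    by (simp add: diag_dist_def z w)
qed

text \<open>Here \<open>k\<^sub>i\<close> and \<open>k\<^sub>j\<close> are folded into the zone and \<open>q\<close> is the shortest representative of \<open>k\<^sub>a - k\<^sub>i\<close>. At such
  triples the derivative bounds of an algebraic singularity are available.\<close>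

lemma representative:
  "\<exists>R\<in>reciprocal3. \<exists>ki\<in>zone S. \<exists>kj\<in>zone S. \<exists>q. R + z = (ki, kj, ki + q) \<and> norm q = diag_dist z \<and> lat_dist q = norm q"
proof -
  obtain x y u where z: "z = (x, y, u)" by (cases z) auto
  obtain G where G: "G \<in> reciprocal S" "lat_dist (u - x) = norm (u - x + G)"
    using lat_dist_attained by blast
  let ?a = "fold_zone S x - x" and ?b = "fold_zone S y - y"
  have ab: "?a \<in> reciprocal S" "?b \<in> reciprocal S"
    using fold_zone(2)[of x] fold_zone(2)[of y] recip.minus_commute_iff by blast+
  have R: "(?a, ?b, ?a + G) \<in> reciprocal3" using ab G recip.add by auto
  have eq: "(?a, ?b, ?a + G) + z = (fold_zone S x, fold_zone S y, fold_zone S x + (u - x + G))"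
    by (simp add: z algebra_simps)
  have "lat_dist (u - x + G) = norm (u - x + G)"
    using lat_dist_add[OF G(1), of "u - x"] G(2) by (simp add: add.commute)
  then show ?thesis
    using R eq fold_zone(1) G(2)
    by (intro bexI[of _ "(?a, ?b, ?a + G)"] bexI[of _ "fold_zone S x"] bexI[of _ "fold_zone S y"] exI[of _ "u - x + G"])
      (auto simp: diag_dist_def z)
qed

context
  fixes f assumes f: "f \<in> T_space S"
begin

lemma T_space_periodic:
  assumes "R \<in> reciprocal3" shows "f (R + z) = f z"
proof -
  obtain a b c where R: "R = (a, b, c)" "a \<in> reciprocal S" "b \<in> reciprocal S" "c \<in> reciprocal S"
    using assms by auto
  obtain x y u where z: "z = (x, y, u)" by (cases z) auto
  have 1: "f (ki + G, kj, ka) = f (ki, kj, ka)" and 2: "f (ki, kj + G, ka) = f (ki, kj, ka)"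
    and 3: "f (ki, kj, ka + G) = f (ki, kj, ka)" if "G \<in> reciprocal S" for G ki kj ka
    using f that unfolding T_space_def by blast+
  have "f (x + a, y + b, u + c) = f (x, y + b, u + c)" by (rule 1[OF R(2)])
  also have "\<dots> = f (x, y, u + c)" by (rule 2[OF R(3)])
  also have "\<dots> = f (x, y, u)" by (rule 3[OF R(4)])
  finally show ?thesis by (simp add: R(1) z add.commute)
qed

lemma T_space_smooth: "smooth_on {z. 0 < diag_dist z} f"
  using f unfolding T_space_def off_diagonal_eq by blast

lemma T_space_differentiable: "0 < diag_dist z \<Longrightarrow> f differentiable (at z)"
proof -
  assume z: "0 < diag_dist z"
  have "f differentiable (at z within {z. 0 < diag_dist z})"
    using z smooth_on_imp_differentiable[OF T_space_smooth] unfolding differentiable_on_def by blast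
  then show ?thesis using at_within_open[OF _ open_off_diagonal, of z] z by simp
qed

lemma T_space_continuous: "continuous_on {z. 0 < diag_dist z} f"
  using T_space_differentiable
  by (intro differentiable_imp_continuous_on) (auto simp: differentiable_on_def intro: differentiable_at_withinI)

lemma T_space_partial_continuous:
  assumes e: "e \<in> Basis" shows "continuous_on {z. 0 < diag_dist z} (\<lambda>z. frechet_derivative f (at z) e)"
  by (intro differentiable_imp_continuous_on smooth_on_imp_partial_differentiable[OF T_space_smooth e])

lemma T_space_diagonal_continuous: "continuous_on UNIV (\<lambda>(ki, kj). f (ki, kj, ki))"
proof -
  have "smooth_on UNIV (\<lambda>(ki, kj). f (ki, kj, ki))" using f unfolding T_space_def by blast
  then show ?thesis by (intro differentiable_imp_continuous_on smooth_on_imp_differentiable)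
qed

lemma T_space_on_diagonal: "diag_dist (ki, kj, ka) = 0 \<Longrightarrow> f (ki, kj, ka) = f (ki, kj, ki)"
proof -
  assume "diag_dist (ki, kj, ka) = 0"
  then have "(0, 0, ka - ki) \<in> reciprocal3" by (simp add: diag_dist_def lat_dist_zero_iff recip.zero)
  from T_space_periodic[OF this, of "(ki, kj, ki)"] show ?thesis by simp
qed

text \<open>A compact set of representatives of the triples with \<open>diag_dist\<close> at least \<open>\<delta>\<close>.\<close>

definition away :: "real \<Rightarrow> (vec3 \<times> vec3 \<times> vec3) set" where
  "away \<delta> = {z. \<delta> \<le> diag_dist z} \<inter> cball 0 zone_radius \<times> cball 0 zone_radius \<times> cball 0 (2 * zone_radius)"

lemma compact_away: "compact (away \<delta>)"
  unfolding away_def Int_commute[of "{z. \<delta> \<le> diag_dist z}"]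
  by (intro compact_Int_closed compact_Times compact_cball closed_Collect_le continuous_intros continuous_diag_dist)

lemma away_bound:
  fixes g :: "vec3 \<times> vec3 \<times> vec3 \<Rightarrow> complex"
  assumes "\<delta> > 0" "continuous_on {z. 0 < diag_dist z} g"
  shows "\<exists>B. \<forall>z\<in>away \<delta>. norm (g z) \<le> B"
proof -
  have "away \<delta> \<subseteq> {z. 0 < diag_dist z}" using assms(1) by (auto simp: away_def)
  then have "bounded (g ` away \<delta>)"
    using assms(2) by (intro compact_imp_bounded compact_continuous_image compact_away) (rule continuous_on_subset)
  then show ?thesis by (auto simp: bounded_iff)
qed

lemma in_away:
  assumes "ki \<in> zone S" "kj \<in> zone S" "\<delta> \<le> lat_dist q" "lat_dist q = norm q"
  shows "(ki, kj, ki + q) \<in> away \<delta>"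
  using zone_radius(2)[OF assms(1)] zone_radius(2)[OF assms(2)] assms(3,4) lat_dist_le_radius[of q] norm_triangle_ineq[of ki q]
  by (simp add: away_def diag_dist_def)

text \<open>The radius \<open>\<delta>\<close> of an algebraic singularity, fixed so that the bounds for different multi-indices hold on
  a common neighbourhood.\<close>

definition singular_radius :: "real \<Rightarrow> bool" where
  "singular_radius \<delta> \<longleftrightarrow> \<delta> > 0 \<and> (\<forall>\<alpha> \<beta>. set \<alpha> \<subseteq> {e \<in> Basis. fst e = 0 \<and> fst (snd e) = 0} \<longrightarrow>
       set \<beta> \<subseteq> {e \<in> Basis. snd (snd e) = 0} \<longrightarrow>
       (\<exists>C. \<forall>ki\<in>zone S. \<forall>kj\<in>zone S. \<forall>q. 0 < norm q \<and> norm q < \<delta> \<longrightarrow>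
          norm (iter_deriv \<alpha> (iter_deriv \<beta> (\<lambda>(ki, kj, q). f (ki, kj, ki + q))) (ki, kj, q))
            \<le> C * norm q powr (0 - real (length \<alpha>))))"

lemma singular_radius_exists: "\<exists>\<delta>. singular_radius \<delta>"
  using f unfolding T_space_def algebraic_singularity_def singular_radius_def by blast

text \<open>Near the singularity the order is 0, on it the function is a continuous periodic function of
  \<open>(k\<^sub>i, k\<^sub>j)\<close>, and away from it compactness applies.\<close>

lemma T_space_bounded: "\<exists>B. \<forall>z. norm (f z) \<le> B"
proof -
  obtain \<delta> where \<delta>: "singular_radius \<delta>" using singular_radius_exists by blast
  then have \<delta>0: "\<delta> > 0" by (simp add: singular_radius_def)
  obtain C where C: "\<And>ki kj q. ki \<in> zone S \<Longrightarrow> kj \<in> zone S \<Longrightarrow> 0 < norm q \<Longrightarrow> norm q < \<delta> \<Longrightarrow>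
      norm (f (ki, kj, ki + q)) \<le> C * norm q powr (0 - real (length []))"
    using \<delta>[unfolded singular_radius_def, THEN conjunct2, rule_format, of "[]" "[]"] by auto
  obtain B1 where B1: "\<And>z. z \<in> away \<delta> \<Longrightarrow> norm (f z) \<le> B1"
    using away_bound[OF \<delta>0 T_space_continuous] by blast
  have "bounded ((\<lambda>(ki, kj). f (ki, kj, ki)) ` (cball 0 zone_radius \<times> cball 0 zone_radius))"
    by (intro compact_imp_bounded compact_continuous_image compact_Times compact_cball)
      (rule continuous_on_subset[OF T_space_diagonal_continuous], simp)
  then obtain B2 where B2: "\<And>ki kj. ki \<in> zone S \<Longrightarrow> kj \<in> zone S \<Longrightarrow> norm (f (ki, kj, ki)) \<le> B2"
    using zone_radius(2) by (fastforce simp: bounded_iff)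
  have "norm (f z) \<le> \<bar>C\<bar> + \<bar>B1\<bar> + \<bar>B2\<bar>" for z
  proof -
    obtain R ki kj q where R: "R \<in> reciprocal3" "ki \<in> zone S" "kj \<in> zone S" "R + z = (ki, kj, ki + q)" "lat_dist q = norm q"
      using representative[of z] by blast
    have "norm (f (ki, kj, ki + q)) \<le> \<bar>C\<bar> + \<bar>B1\<bar> + \<bar>B2\<bar>"
    proof (cases "q = 0")
      case True
      then show ?thesis using B2[OF R(2,3)] by simp
    next
      case False
      show ?thesis
      proof (cases "norm q < \<delta>")
        case True
        then show ?thesis using C[OF R(2,3) _ True] False by simp
      next
        case F: False
        then show ?thesis using B1[OF in_away[OF R(2,3), of \<delta> q]] R(5) by simp
      qed
    qed
    then show ?thesis using T_space_periodic[OF R(1), of z] R(4) by simp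
  qed
  then show ?thesis by blast
qed

text \<open>The singularity is described in the variables \<open>(k\<^sub>i, k\<^sub>j, q)\<close>, in which every coordinate vector is either
  a \<open>q\<close>-direction (derivative \<open>O(1/|q|)\<close>) or a \<open>(k\<^sub>i, k\<^sub>j)\<close>-direction (derivative \<open>O(1)\<close>). The linear change
  to \<open>(k\<^sub>i, k\<^sub>j, k\<^sub>a)\<close> costs a constant factor.\<close>

lemma T_space_gradient_near:
  assumes \<delta>: "singular_radius \<delta>"
  shows "\<exists>C\<ge>0. \<forall>ki\<in>zone S. \<forall>kj\<in>zone S. \<forall>q. 0 < norm q \<longrightarrow> norm q < \<delta> \<longrightarrow> lat_dist q = norm q \<longrightarrow>
    (\<forall>v. norm (frechet_derivative f (at (ki, kj, ki + q)) v) * norm q \<le> C * norm v)"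
proof -
  let ?g = "\<lambda>(ki, kj, q). f (ki, kj, ki + q)"
  have ex: "\<exists>C. \<forall>ki\<in>zone S. \<forall>kj\<in>zone S. \<forall>q. 0 < norm q \<and> norm q < \<delta> \<longrightarrow>
      norm (frechet_derivative ?g (at (ki, kj, q)) e) * norm q \<le> C" if e: "e \<in> Basis" for e
  proof -
    have "e \<in> {e \<in> Basis. fst e = 0 \<and> fst (snd e) = 0} \<or> e \<in> {e \<in> Basis. snd (snd e) = 0}"
      using e by (auto simp: Basis_prod_def)
    then show ?thesis
    proof
      assume "e \<in> {e \<in> Basis. fst e = 0 \<and> fst (snd e) = 0}"
      then obtain C where C: "\<And>ki kj q. ki \<in> zone S \<Longrightarrow> kj \<in> zone S \<Longrightarrow> 0 < norm q \<and> norm q < \<delta> \<Longrightarrow>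
          norm (frechet_derivative ?g (at (ki, kj, q)) e) \<le> C * norm q powr (0 - real (length [e]))"
        using \<delta>[unfolded singular_radius_def, THEN conjunct2, rule_format, of "[e]" "[]"] by auto
      have "norm (frechet_derivative ?g (at (ki, kj, q)) e) * norm q \<le> C"
        if "ki \<in> zone S" "kj \<in> zone S" "0 < norm q \<and> norm q < \<delta>" for ki kj q
      proof -
        have "norm (frechet_derivative ?g (at (ki, kj, q)) e) \<le> C / norm q"
          using C[OF that] that(3) by (simp add: powr_minus_divide)
        then show ?thesis using that(3) by (simp add: field_simps)
      qed
      then show ?thesis by blast
    next
      assume "e \<in> {e \<in> Basis. snd (snd e) = 0}"
      then obtain C where C: "\<And>ki kj q. ki \<in> zone S \<Longrightarrow> kj \<in> zone S \<Longrightarrow> 0 < norm q \<and> norm q < \<delta> \<Longrightarrow>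
          norm (frechet_derivative ?g (at (ki, kj, q)) e) \<le> C * norm q powr (0 - real (length []))"
        using \<delta>[unfolded singular_radius_def, THEN conjunct2, rule_format, of "[]" "[e]"] by auto
      have "norm (frechet_derivative ?g (at (ki, kj, q)) e) * norm q \<le> \<bar>C\<bar> * \<delta>"
        if "ki \<in> zone S" "kj \<in> zone S" "0 < norm q \<and> norm q < \<delta>" for ki kj q
        using C[OF that] that(3) by (intro mult_mono) auto
      then show ?thesis by blast
    qed
  qed
  then have "\<forall>e\<in>Basis. \<exists>C. \<forall>ki\<in>zone S. \<forall>kj\<in>zone S. \<forall>q. 0 < norm q \<and> norm q < \<delta> \<longrightarrow>
      norm (frechet_derivative ?g (at (ki, kj, q)) e) * norm q \<le> C" by blast
  from bchoice[OF this] obtain C where C: "\<forall>e\<in>Basis. \<forall>ki\<in>zone S. \<forall>kj\<in>zone S. \<forall>q. 0 < norm q \<and> norm q < \<delta> \<longrightarrow>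
      norm (frechet_derivative ?g (at (ki, kj, q)) e) * norm q \<le> C e" ..
  define M where "M = (\<Sum>e\<in>(Basis :: (vec3 \<times> vec3 \<times> vec3) set). \<bar>C e\<bar>)"
  have M: "C e \<le> M" if "e \<in> Basis" for e
    using member_le_sum[OF that, of "\<lambda>e. \<bar>C e\<bar>"] by (simp add: M_def)
  have M0: "M \<ge> 0" by (auto simp: M_def intro: sum_nonneg)
  let ?n = "real DIM(vec3 \<times> vec3 \<times> vec3)"
  show ?thesis
  proof (intro exI[of _ "?n * M * 4"] conjI ballI allI impI)
    show "0 \<le> ?n * M * 4" using M0 by simp
    fix ki kj q v
    assume k: "ki \<in> zone S" "kj \<in> zone S" and q: "0 < norm q" "norm q < \<delta>" "lat_dist q = norm q"
    let ?w = "(ki, kj, q)" and ?z = "(ki, kj, ki + q)"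
    let ?L = "\<lambda>(x, y, u). (x, y, x + u :: vec3)" and ?L' = "\<lambda>(x, y, u). (x, y, u - x :: vec3)"
    have dz: "0 < diag_dist ?z" using q by (simp add: diag_dist_def)
    have L: "(?L has_derivative ?L) (at p)" and L': "(?L' has_derivative ?L') (at p)" for p
      unfolding split_beta by (auto intro!: derivative_eq_intros)
    have "(f has_derivative frechet_derivative f (at ?z)) (at (?L ?w))"
      using T_space_differentiable[OF dz] frechet_derivative_works by auto
    from has_derivative_compose[OF L this] have "(?g has_derivative (\<lambda>h. frechet_derivative f (at ?z) (?L h))) (at ?w)"
      by (simp add: case_prod_unfold)
    then have gd: "?g differentiable (at ?w)" by (auto simp: differentiable_def)
    then have "(?g has_derivative frechet_derivative ?g (at ?w)) (at (?L' ?z))"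
      using frechet_derivative_works by auto
    from has_derivative_compose[OF L' this]
    have "(f has_derivative (\<lambda>h. frechet_derivative ?g (at ?w) (?L' h))) (at ?z)"
      by (simp add: case_prod_unfold)
    from fun_cong[OF frechet_derivative_at[OF this], of v]
    have eq: "frechet_derivative f (at ?z) v = frechet_derivative ?g (at ?w) (?L' v)" by (rule sym)
    have "norm (frechet_derivative ?g (at ?w) e) \<le> M / norm q" if "e \<in> Basis" for e
    proof -
      have "norm (frechet_derivative ?g (at ?w) e) * norm q \<le> C e" using C that k q by blast
      then show ?thesis using M[OF that] q by (simp add: field_simps)
    qed
    from norm_frechet_derivative_le[OF gd this]
    have "norm (frechet_derivative f (at ?z) v) \<le> ?n * (M / norm q) * norm (?L' v)" unfolding eq .
    moreover have "norm (?L' v) \<le> 4 * norm v"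
    proof -
      obtain x y u where v: "v = (x, y, u)" by (cases v) auto
      have "norm (u - x) \<le> norm u + norm x" by (rule norm_triangle_ineq4)
      then show ?thesis
        using dist_triple_le[of x y "u - x" 0 0 0]
          norm_components_le_dist[where x = x and y = y and z = u and x' = 0 and y' = 0 and z' = 0]
        by (simp add: v dist_norm zero_prod_def[symmetric])
    qed
    then have "?n * (M / norm q) * norm (?L' v) \<le> ?n * (M / norm q) * (4 * norm v)"
      using M0 by (intro mult_left_mono) auto
    ultimately have "norm (frechet_derivative f (at ?z) v) \<le> ?n * (M / norm q) * (4 * norm v)"
      by linarith
    then show "norm (frechet_derivative f (at ?z) v) * norm q \<le> ?n * M * 4 * norm v"
      using q(1) by (simp add: field_simps)
  qed
qed

lemma T_space_gradient:
  "\<exists>C\<ge>0. \<forall>z. 0 < diag_dist z \<longrightarrow> (\<forall>v. norm (frechet_derivative f (at z) v) * diag_dist z \<le> C * norm v)"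
proof -
  obtain \<delta> where \<delta>: "singular_radius \<delta>" using singular_radius_exists by blast
  then have \<delta>0: "\<delta> > 0" by (simp add: singular_radius_def)
  obtain C where C: "C \<ge> 0" "\<And>ki kj q v. ki \<in> zone S \<Longrightarrow> kj \<in> zone S \<Longrightarrow> 0 < norm q \<Longrightarrow> norm q < \<delta> \<Longrightarrow> lat_dist q = norm q \<Longrightarrow>
    norm (frechet_derivative f (at (ki, kj, ki + q)) v) * norm q \<le> C * norm v"
    using T_space_gradient_near[OF \<delta>] by blast
  have "\<forall>e\<in>Basis. \<exists>B. \<forall>z\<in>away \<delta>. norm (frechet_derivative f (at z) e) \<le> B"
    using away_bound[OF \<delta>0 T_space_partial_continuous] by blast
  from bchoice[OF this] obtain B where B: "\<forall>e\<in>Basis. \<forall>z\<in>away \<delta>. norm (frechet_derivative f (at z) e) \<le> B e" ..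
  define M where "M = (\<Sum>e\<in>(Basis :: (vec3 \<times> vec3 \<times> vec3) set). \<bar>B e\<bar>)"
  have M: "B e \<le> M" if "e \<in> Basis" for e
    using member_le_sum[OF that, of "\<lambda>e. \<bar>B e\<bar>"] by (simp add: M_def)
  have M0: "M \<ge> 0" by (auto simp: M_def intro: sum_nonneg)
  let ?n = "real DIM(vec3 \<times> vec3 \<times> vec3)"
  have "norm (frechet_derivative f (at z) v) * diag_dist z \<le> (C + ?n * M * zone_radius) * norm v"
    if z: "0 < diag_dist z" for z v
  proof -
    obtain R ki kj q where R: "R \<in> reciprocal3" "ki \<in> zone S" "kj \<in> zone S" "R + z = (ki, kj, ki + q)"
        "norm q = diag_dist z" "lat_dist q = norm q"
      using representative[of z] by blast
    let ?z = "(ki, kj, ki + q)"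
    have dz: "0 < diag_dist ?z" using R z by (simp add: diag_dist_def)
    have "(f has_derivative frechet_derivative f (at ?z)) (at (z + R))"
    proof -
      have "z + R = ?z" using R(4) by (simp add: add.commute)
      then show ?thesis using frechet_derivative_works[THEN iffD1, OF T_space_differentiable[OF dz]] by (simp only:)
    qed
    then have "(f has_derivative frechet_derivative f (at ?z)) (at z)"
    proof (rule has_derivative_shift_invariant[rotated])
      show "f (x + R) = f x" for x using T_space_periodic[OF R(1), of x] by (simp only: add.commute)
    qed
    then have eq: "frechet_derivative f (at z) = frechet_derivative f (at ?z)"
      by (rule frechet_derivative_at[symmetric])
    have "norm (frechet_derivative f (at ?z) v) * norm q \<le> (C + ?n * M * zone_radius) * norm v"
    proof (cases "norm q < \<delta>")
      case True
      have "norm (frechet_derivative f (at ?z) v) * norm q \<le> C * norm v"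
        using C(2)[OF R(2,3) _ True R(6)] z R(5) by simp
      also have "\<dots> \<le> (C + ?n * M * zone_radius) * norm v"
        using M0 zone_radius(1) by (intro mult_right_mono) auto
      finally show ?thesis .
    next
      case False
      have "norm (frechet_derivative f (at ?z) e) \<le> M" if "e \<in> Basis" for e
        using B[rule_format, OF that in_away[OF R(2,3) _ R(6), of \<delta>]] M[OF that] False R(6) by simp
      from norm_frechet_derivative_le[OF T_space_differentiable[OF dz] this]
      have "norm (frechet_derivative f (at ?z) v) * norm q \<le> (?n * M * norm v) * zone_radius"
        using R(6) lat_dist_le_radius[of q] M0 by (intro mult_mono) auto
      also have "\<dots> \<le> (C + ?n * M * zone_radius) * norm v"
        using C(1) by (simp add: algebra_simps)
      finally show ?thesis .
    qed
    then show ?thesis using eq R(5) by simp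
  qed
  moreover have "0 \<le> C + ?n * M * zone_radius" using C(1) M0 zone_radius(1) by simp
  ultimately show ?thesis by blast
qed

text \<open>On the ball of radius \<open>diag_dist z / 4\<close> the distance to the singular set is at least half of its value
  at \<open>z\<close>, so the gradient bound gives the Lipschitz bound.\<close>

lemma mild_T_space: "mild diag_dist f"
proof -
  obtain B where B: "\<And>z. norm (f z) \<le> B" using T_space_bounded by blast
  obtain C where C: "C \<ge> 0" "\<And>z v. 0 < diag_dist z \<Longrightarrow> norm (frechet_derivative f (at z) v) * diag_dist z \<le> C * norm v"
    using T_space_gradient by blast
  show ?thesis
  proof (rule mildI_near[OF B diag_dist_nonneg, where c = "1/4" and K = "2 * C"])
    fix z w assume d: "dist z w \<le> 1 / 4 * diag_dist z"
    show "norm (f z - f w) * diag_dist z \<le> 2 * C * dist z w"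
    proof (cases "diag_dist z = 0")
      case False
      then have dz: "0 < diag_dist z" using diag_dist_nonneg[of z] by linarith
      let ?X = "cball z (diag_dist z / 4)"
      have half: "diag_dist z / 2 \<le> diag_dist x" if "x \<in> ?X" for x
        using diag_dist_Lipschitz[of z x] that by simp
      have "norm (f z - f w) \<le> (2 * C / diag_dist z) * norm (z - w)"
      proof (rule differentiable_bound[OF convex_cball])
        show "z \<in> ?X" "w \<in> ?X" using d dz by auto
        fix x assume x: "x \<in> ?X"
        have dx: "0 < diag_dist x" using half[OF x] dz by linarith
        show "(f has_derivative frechet_derivative f (at x)) (at x within ?X)"
          using T_space_differentiable[OF dx] frechet_derivative_works has_derivative_at_withinI by blast
        show "onorm (frechet_derivative f (at x)) \<le> 2 * C / diag_dist z"
        proof (rule onorm_le)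
          fix v
          have "norm (frechet_derivative f (at x) v) * (diag_dist z / 2) \<le> norm (frechet_derivative f (at x) v) * diag_dist x"
            using half[OF x] by (intro mult_left_mono) auto
          also have "\<dots> \<le> C * norm v" by (rule C(2)[OF dx])
          finally show "norm (frechet_derivative f (at x) v) \<le> 2 * C / diag_dist z * norm v"
            using dz by (simp add: field_simps)
        qed
      qed
      then show ?thesis using dz by (simp add: dist_norm field_simps)
    qed (use C(1) in simp)
  qed simp
qed

lemma borel_T_space: "f \<in> borel_measurable borel"
proof (rule mild_borel[OF mild_T_space continuous_diag_dist diag_dist_nonneg])
  have "continuous_on UNIV (\<lambda>z. (\<lambda>(ki, kj). f (ki, kj, ki)) (fst z, fst (snd z)))"
    by (rule continuous_on_compose2[OF T_space_diagonal_continuous]) (auto intro!: continuous_intros)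
  then show "continuous_on UNIV (\<lambda>z. f (fst z, fst (snd z), fst z))" by simp
  show "f z = f (fst z, fst (snd z), fst z)" if "diag_dist z = 0" for z
    using T_space_on_diagonal[of "fst z" "fst (snd z)" "snd (snd z)"] that by simp
qed

end

text \<open>By periodicity the almost-everywhere bound on the zone holds almost everywhere in space, and a
  violation at \<open>z\<close> would persist in a ball by continuity.\<close>

lemma norm_le_esssup:
  fixes f :: "vec3 \<times> vec3 \<times> vec3 \<Rightarrow> complex"
  assumes f [measurable]: "f \<in> borel_measurable borel" and per: "\<And>R z. R \<in> reciprocal3 \<Longrightarrow> f (R + z) = f z"
    and cont: "continuous_on {z. 0 < diag_dist z} f" and z: "0 < diag_dist z"
  shows "ereal (norm (f z)) \<le> esssup (restrict_space lborel zone3) (\<lambda>k. ereal (norm (f k)))"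
proof (rule ccontr)
  let ?M = "esssup (restrict_space lborel zone3) (\<lambda>k. ereal (norm (f k)))"
  assume "\<not> ereal (norm (f z)) \<le> ?M"
  then have zM: "?M < ereal (norm (f z))" by simp
  have [measurable]: "zone3 \<in> sets borel" using zone3_tiles by (simp add: tiles_def)
  have "AE x in restrict_space lborel zone3. ereal (norm (f x)) \<le> ?M" by (rule esssup_AE)
  then have "AE x in lborel. x \<in> zone3 \<longrightarrow> ereal (norm (f x)) \<le> ?M"
    by (subst (asm) AE_restrict_space_iff) auto
  have AE: "AE x in lborel. ereal (norm (f x)) \<le> ?M"
  proof (rule recip3.AE_from_tile[OF zone3_tiles])
    show "Measurable.pred borel (\<lambda>x. ereal (norm (f x)) \<le> ?M)" by measurable
    show "(ereal (norm (f (R + x))) \<le> ?M) = (ereal (norm (f x)) \<le> ?M)" if "R \<in> reciprocal3" for R x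
      by (simp only: per[OF that])
    show "AE x in lborel. x \<in> zone3 \<longrightarrow> ereal (norm (f x)) \<le> ?M" by fact
  qed
  have "continuous_on {z. 0 < diag_dist z} (\<lambda>x. ereal (norm (f x)))"
    by (intro continuous_intros cont)
  then have "open ({z. 0 < diag_dist z} \<inter> (\<lambda>x. ereal (norm (f x))) -` {?M<..})"
    by (rule continuous_open_preimage[OF _ open_off_diagonal]) simp
  moreover have "z \<in> {z. 0 < diag_dist z} \<inter> (\<lambda>x. ereal (norm (f x))) -` {?M<..}" using z zM by simp
  ultimately obtain e where e: "e > 0" "ball z e \<subseteq> (\<lambda>x. ereal (norm (f x))) -` {?M<..}"
    unfolding open_contains_ball by blast
  have "AE x in lborel. x \<notin> ball z e"
    using AE by eventually_elim (use e(2) in force)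
  then have "emeasure lborel (ball z e) = 0"
    by (subst (asm) AE_iff_measurable[of "ball z e"]) auto
  then show False using content_ball_pos[OF e(1), of z] by (simp add: measure_def)
qed

lemma T_families_le_Linf_norm:
  assumes t: "t \<in> T_families S" and u: "u \<in> T_families S" and z: "0 < diag_dist z"
  shows "ereal (norm (t i j a b z - u i j a b z)) \<le> Linf_norm S (t - u)"
proof -
  let ?e = "\<lambda>i j a b. esssup (restrict_space lborel zone3) (\<lambda>k. ereal (norm ((t - u) i j a b k)))"
  have T: "t i j a b \<in> T_space S" "u i j a b \<in> T_space S" using t u by (auto simp: T_families_def)
  have "ereal (norm ((t - u) i j a b z)) \<le> ?e i j a b"
  proof (rule norm_le_esssup[OF _ _ _ z])
    show "(t - u) i j a b \<in> borel_measurable borel"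
      using borel_T_space[OF T(1)] borel_T_space[OF T(2)] by (simp add: fun_diff_def)
    show "(t - u) i j a b (R + w) = (t - u) i j a b w" if "R \<in> reciprocal3" for R w
      using T_space_periodic[OF T(1) that] T_space_periodic[OF T(2) that] by simp
    show "continuous_on {z. 0 < diag_dist z} ((t - u) i j a b)"
      using T_space_continuous[OF T(1)] T_space_continuous[OF T(2)]
      by (simp add: fun_diff_def continuous_on_diff)
  qed
  also have "?e i j a b \<le> Linf_norm S (t - u)"
  proof -
    have "{?e i j a b | i j a b. True} = (\<lambda>(i, j, a, b). ?e i j a b) ` UNIV" by (auto simp: image_iff) metis
    then have "finite {?e i j a b | i j a b. True}" by simp
    then show ?thesis unfolding Linf_norm_def by (rule Max_ge) blast
  qed
  finally show ?thesis by simp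
qed

end

section \<open>Energy functionals\<close>

context insulating_system
begin

lemma energy_density_eq:
  "energy_density S t z = (\<Sum>i\<in>UNIV. \<Sum>j\<in>UNIV. \<Sum>a\<in>UNIV. \<Sum>b\<in>UNIV. W_density i j a b z * t i j a b z)"
  by (cases z) (simp add: energy_density_def W_density_def)

lemma G_tdl_quadrature_error:
  assumes "t \<in> T_families S"
  shows "\<exists>K. \<forall>s n. n > 0 \<longrightarrow> norm (G_tdl S t - G_finite S (mesh S s n) t) \<le> K / n"
proof -
  have t: "t i j a b \<in> T_space S" for i j a b using assms by (simp add: T_families_def)
  have "energy_density S t \<in> borel_measurable borel"
    unfolding energy_density_eq[abs_def]
    by (intro borel_measurable_sum borel_measurable_times borel_W_density borel_T_space t)
  moreover have "mild sing_dist (energy_density S t)"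
    unfolding energy_density_eq[abs_def]
    by (intro mild_sum mild_mult mild_W_density mild_mono[OF mild_T_space[OF t] sing_dist_le_diag_dist] sing_dist_nonneg)
  moreover have "energy_density S t (R + z) = energy_density S t z" if "R \<in> reciprocal3" for R z
    unfolding energy_density_eq by (simp only: W_density_periodic[OF that] T_space_periodic[OF t that])
  ultimately show ?thesis
    using mesh_quadrature_error[of "energy_density S t"] unfolding G_tdl_def G_finite_def by blast
qed

lemma W_density_bounded: "\<exists>B>0. \<forall>i j a b z. norm (W_density i j a b z) \<le> B"
proof -
  have "\<exists>B. \<forall>z. norm (W_density i j a b z) \<le> B" for i j a b
    using mild_W_density[of i j a b] unfolding mild_def by blast
  then obtain B where B: "\<And>i j a b z. norm (W_density i j a b z) \<le> B i j a b" by metis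
  define M where "M = 1 + (\<Sum>(i, j, a, b)\<in>UNIV. \<bar>B i j a b\<bar>)"
  have M: "B i j a b \<le> M" for i j a b
    using member_le_sum[of "(i, j, a, b)" UNIV "\<lambda>(i, j, a, b). \<bar>B i j a b\<bar>"] by (auto simp: M_def)
  have "0 \<le> (\<Sum>(i, j, a, b)\<in>UNIV. \<bar>B i j a b\<bar>)" by (intro sum_nonneg) auto
  then have "M > 0" unfolding M_def by linarith
  moreover have "norm (W_density i j a b z) \<le> M" for i j a b z
    using B[of i j a b z] M[of i j a b] by linarith
  ultimately show ?thesis by blast
qed

lemma zone_reciprocal_eq:
  assumes "k \<in> zone S" "k' \<in> zone S" "k' - k \<in> reciprocal S"
  shows "k' = k"
  using fold_zone_eqI[OF assms(2), of k'] fold_zone_eqI[OF assms(1,3)] recip.zero by simp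

text \<open>The mesh triples with \<open>k\<^sub>a = k\<^sub>i\<close> number \<open>N\<^sup>2\<close> out of \<open>N\<^sup>3\<close>, where \<open>N = n\<^sup>3\<close>, so the weaker bound \<open>D\<close> enters
  with the factor \<open>1/N\<close>. In the zone, \<open>k\<^sub>a - k\<^sub>i\<close> is a lattice vector only if \<open>k\<^sub>a = k\<^sub>i\<close>.\<close>

lemma G_finite_diff_le:
  assumes n: "n > 0"
    and B: "B \<ge> 0" "\<And>i j a b z. norm (W_density i j a b z) \<le> B"
    and \<epsilon>: "\<epsilon> \<ge> 0" and D: "D \<ge> 0"
    and off: "\<And>i j a b z. z \<in> mesh S s n \<times> mesh S s n \<times> mesh S s n \<Longrightarrow> 0 < diag_dist z \<Longrightarrow>
      norm (t i j a b z - T i j a b z) \<le> \<epsilon>"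
    and diag: "\<And>i j a b z. z \<in> mesh S s n \<times> mesh S s n \<times> mesh S s n \<Longrightarrow>
      norm (t i j a b z - T i j a b z) \<le> D"
  shows "norm (G_finite S (mesh S s n) t - G_finite S (mesh S s n) T)
    \<le> real (CARD('o) ^ 2 * CARD('v) ^ 2) * B * (\<epsilon> + D / real n ^ 3)"
proof -
  let ?K = "mesh S s n" and ?b = "real (CARD('o) ^ 2 * CARD('v) ^ 2)"
  let ?d = "\<lambda>z :: vec3 \<times> vec3 \<times> vec3. \<epsilon> + (if snd (snd z) = fst z then D else 0)"
  have fin: "finite ?K" and card: "card ?K = n ^ 3" using finite_mesh[OF n] card_mesh[OF n] by auto
  have diff: "norm (t i j a b z - T i j a b z) \<le> ?d z" if z: "z \<in> ?K \<times> ?K \<times> ?K" for i j a b z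
  proof (cases "snd (snd z) = fst z")
    case True
    then show ?thesis using diag[OF z, of i j a b] \<epsilon> by simp
  next
    case False
    have "fst z \<in> zone S" "snd (snd z) \<in> zone S" using z by (auto simp: mesh_def)
    then have "0 < diag_dist z" using zone_reciprocal_eq False by (auto simp: diag_dist_pos_iff)
    then show ?thesis using off[OF z] False by simp
  qed
  have dens: "norm (energy_density S t z - energy_density S T z) \<le> ?b * B * ?d z" if z: "z \<in> ?K \<times> ?K \<times> ?K" for z
  proof -
    have "energy_density S t z - energy_density S T z
        = (\<Sum>i\<in>UNIV. \<Sum>j\<in>UNIV. \<Sum>a\<in>UNIV. \<Sum>b\<in>UNIV. W_density i j a b z * (t i j a b z - T i j a b z))"
      by (simp add: energy_density_eq sum_subtractf right_diff_distrib)
    also have "norm \<dots> \<le> (\<Sum>i\<in>(UNIV :: 'o set). \<Sum>j\<in>(UNIV :: 'o set). \<Sum>a\<in>(UNIV :: 'v set). \<Sum>b\<in>(UNIV :: 'v set). B * ?d z)"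
    proof (intro sum_norm_le)
      show "norm (W_density i j a b z * (t i j a b z - T i j a b z)) \<le> B * ?d z" for i j a b
        unfolding norm_mult by (intro mult_mono B diff[OF z] norm_ge_zero)
    qed
    also have "\<dots> = ?b * B * ?d z" by (simp add: power2_eq_square)
    finally show ?thesis .
  qed
  have "norm ((\<Sum>z\<in>?K \<times> ?K \<times> ?K. energy_density S t z) - (\<Sum>z\<in>?K \<times> ?K \<times> ?K. energy_density S T z))
      \<le> (\<Sum>z\<in>?K \<times> ?K \<times> ?K. ?b * B * ?d z)"
    unfolding sum_subtractf[symmetric] by (intro sum_norm_le dens)
  also have "\<dots> = ?b * B * (\<Sum>z\<in>?K \<times> ?K \<times> ?K. ?d z)" by (simp add: sum_distrib_left)
  also have "(\<Sum>z\<in>?K \<times> ?K \<times> ?K. ?d z) = (\<Sum>ki\<in>?K. \<Sum>kj\<in>?K. \<Sum>ka\<in>?K. \<epsilon> + (if ka = ki then D else 0))"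
    unfolding sum.cartesian_product by (simp add: case_prod_unfold)
  also have "\<dots> = real (card ?K) ^ 3 * \<epsilon> + real (card ?K) ^ 2 * D"
    using fin by (simp add: sum.distrib sum.delta power3_eq_cube power2_eq_square algebra_simps)
  also have "\<dots> = (real (n ^ 3)) ^ 3 * (\<epsilon> + D / real n ^ 3)"
    using n by (simp add: card field_simps power3_eq_cube power2_eq_square)
  finally have main: "norm ((\<Sum>z\<in>?K \<times> ?K \<times> ?K. energy_density S t z) - (\<Sum>z\<in>?K \<times> ?K \<times> ?K. energy_density S T z))
      \<le> ?b * B * ((real (n ^ 3)) ^ 3 * (\<epsilon> + D / real n ^ 3))" .
  have "norm (G_finite S ?K t - G_finite S ?K T)
      = norm ((\<Sum>z\<in>?K \<times> ?K \<times> ?K. energy_density S t z) - (\<Sum>z\<in>?K \<times> ?K \<times> ?K. energy_density S T z)) / (real (n ^ 3)) ^ 3"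
    by (simp add: G_finite_def card diff_divide_distrib[symmetric] norm_divide norm_power)
  also have "\<dots> \<le> ?b * B * ((real (n ^ 3)) ^ 3 * (\<epsilon> + D / real n ^ 3)) / (real (n ^ 3)) ^ 3"
    by (intro divide_right_mono main) simp
  also have "\<dots> = ?b * B * (\<epsilon> + D / real n ^ 3)" using n by simp
  finally show ?thesis .
qed

end

section \<open>Fixed-point iteration on the mesh\<close>

lemma finite_tensor_norm_set:
  fixes T :: "('o::finite, 'v::finite) amplitude"
  assumes "finite K"
  shows "finite {norm (T i j a b k) | i j a b k. k \<in> K \<times> K \<times> K}"
proof -
  have "{norm (T i j a b k) | i j a b k. k \<in> K \<times> K \<times> K}
      \<subseteq> (\<lambda>(i, j, a, b, k). norm (T i j a b k)) ` (UNIV \<times> UNIV \<times> UNIV \<times> UNIV \<times> (K \<times> K \<times> K))"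
    by force
  then show ?thesis by (rule finite_subset) (simp add: assms)
qed

lemma norm_le_tensor_norm:
  fixes T :: "('o::finite, 'v::finite) amplitude"
  assumes "finite K" "k \<in> K \<times> K \<times> K"
  shows "norm (T i j a b k) \<le> tensor_norm K T"
  unfolding tensor_norm_def using assms(2) by (intro Max_ge finite_tensor_norm_set assms(1)) blast

lemma tensor_norm_leI:
  fixes T :: "('o::finite, 'v::finite) amplitude"
  assumes "finite K" "K \<noteq> {}" "\<And>i j a b k. k \<in> K \<times> K \<times> K \<Longrightarrow> norm (T i j a b k) \<le> c"
  shows "tensor_norm K T \<le> c"
  unfolding tensor_norm_def
proof (rule Max.boundedI[OF finite_tensor_norm_set[OF assms(1)]])
  obtain k where "k \<in> K" using assms(2) by blast
  then have "norm (T undefined undefined undefined undefined (k, k, k))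
      \<in> {norm (T i j a b k) | i j a b k. k \<in> K \<times> K \<times> K}" by blast
  then show "{norm (T i j a b k) | i j a b k. k \<in> K \<times> K \<times> K} \<noteq> {}" by blast
  show "r \<le> c" if "r \<in> {norm (T i j a b k) | i j a b k. k \<in> K \<times> K \<times> K}" for r
    using that assms(3) by blast
qed

lemma tensor_norm_nonneg:
  fixes T :: "('o::finite, 'v::finite) amplitude"
  assumes "finite K" "K \<noteq> {}"
  shows "0 \<le> tensor_norm K T"
proof -
  obtain k where "k \<in> K" using assms(2) by blast
  then have "norm (T undefined undefined undefined undefined (k, k, k)) \<le> tensor_norm K T"
    by (intro norm_le_tensor_norm assms(1)) simp
  then show ?thesis by (rule order_trans[OF norm_ge_zero])
qed

lemma tensor_norm_triangle:
  fixes T U :: "('o::finite, 'v::finite) amplitude"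
  assumes "finite K" "K \<noteq> {}"
  shows "tensor_norm K (T - U) \<le> tensor_norm K (T - V) + tensor_norm K (V - U)"
proof (rule tensor_norm_leI[OF assms])
  fix i j a b k assume k: "k \<in> K \<times> K \<times> K"
  have "norm ((T - U) i j a b k) \<le> norm ((T - V) i j a b k) + norm ((V - U) i j a b k)"
    using norm_triangle_ineq[of "(T - V) i j a b k" "(V - U) i j a b k"] by simp
  also have "\<dots> \<le> tensor_norm K (T - V) + tensor_norm K (V - U)"
    by (intro add_mono norm_le_tensor_norm[OF assms(1) k])
  finally show "norm ((T - U) i j a b k) \<le> tensor_norm K (T - V) + tensor_norm K (V - U)" .
qed

text \<open>Every term of the amplitude map except the bare integral contains the amplitude, so the value
  at zero is the same for the mesh average and the zone average.\<close>

lemma ccd_map_zero: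
  assumes "av (\<lambda>_. 0) = 0"
  shows "ccd_map S av 0 i j a b (ki, kj, ka) =
    eri S (vir (a, ka)) (vir (b, fold_zone S (ki + kj - ka))) (occ (i, ki)) (occ (j, kj)) /
    of_real (energy S (Inl i) ki + energy S (Inl j) kj - energy S (Inr a) ka
      - energy S (Inr b) (fold_zone S (ki + kj - ka)))"
proof -
  have amp0: "amp 0 I J A B = 0" for I J A B by (simp add: amp_def)
  show ?thesis
    by (simp add: ccd_map_def Let_def exchange_sym_def ccd_linear_def ccd_ring_def amp0 assms)
qed

lemma on_mesh_ccd_tdl_zero: "on_mesh K (ccd_tdl S 0) = ccd_finite S K 0"
proof -
  have "zone_average S (\<lambda>_. 0) = 0" "mesh_average K (\<lambda>_. 0) = 0"
    by (simp_all add: zone_average_def mesh_average_def set_lebesgue_integral_def)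
  then have "ccd_map S (zone_average S) 0 i j a b z = ccd_map S (mesh_average K) 0 i j a b z" for i j a b z
    by (cases z) (simp only: ccd_map_zero)
  then show ?thesis by (simp only: fun_eq_iff on_mesh_def ccd_tdl_def ccd_finite_def) simp
qed

text \<open>The errors satisfy \<open>e\<^sub>m\<^sub>+\<^sub>1 \<le> c + L e\<^sub>m\<close>, and \<open>c / (1 - L)\<close> is the fixed point of this recursion.\<close>

lemma iteration_error:
  fixes F :: "('o::finite, 'v::finite) amplitude \<Rightarrow> ('o, 'v) amplitude" and G :: "('o, 'v) amplitude \<Rightarrow> ('o, 'v) amplitude"
  assumes K: "finite K" "K \<noteq> {}" and L: "0 \<le> L" "L < 1" and c: "0 \<le> c"
    and B: "0 \<in> B" "\<And>T. T \<in> B \<Longrightarrow> G T \<in> B"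
    and lip: "\<And>T U. T \<in> B \<Longrightarrow> U \<in> B \<Longrightarrow> tensor_norm K (G T - G U) \<le> L * tensor_norm K (T - U)"
    and proj: "\<And>m. on_mesh K ((F ^^ m) 0) \<in> B"
    and cons: "\<And>m. tensor_norm K (on_mesh K (F ((F ^^ m) 0)) - G (on_mesh K ((F ^^ m) 0))) \<le> c"
  shows "tensor_norm K (on_mesh K ((F ^^ m) 0) - (G ^^ m) 0) \<le> c / (1 - L)"
proof (induction m)
  case 0
  have "on_mesh K 0 = (0 :: ('o, 'v) amplitude)" by (simp add: on_mesh_def fun_eq_iff)
  then have "tensor_norm K (on_mesh K ((F ^^ 0) 0) - (G ^^ 0) 0) \<le> 0"
    by (intro tensor_norm_leI K) simp
  then show ?case using L c by (meson order_trans divide_nonneg_nonneg diff_ge_0_iff_ge less_imp_le)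
next
  case (Suc m)
  have GB: "(G ^^ m) 0 \<in> B" for m
  proof (induction m)
    case 0
    show ?case unfolding funpow.simps id_apply by (rule B(1))
  qed (simp add: B(2))
  have "tensor_norm K (on_mesh K ((F ^^ Suc m) 0) - (G ^^ Suc m) 0)
      \<le> tensor_norm K (on_mesh K (F ((F ^^ m) 0)) - G (on_mesh K ((F ^^ m) 0)))
        + tensor_norm K (G (on_mesh K ((F ^^ m) 0)) - G ((G ^^ m) 0))"
    using tensor_norm_triangle[OF K, of "on_mesh K ((F ^^ Suc m) 0)" "(G ^^ Suc m) 0" "G (on_mesh K ((F ^^ m) 0))"] by simp
  also have "\<dots> \<le> c + L * tensor_norm K (on_mesh K ((F ^^ m) 0) - (G ^^ m) 0)"
    by (intro add_mono cons lip proj GB)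
  also have "\<dots> \<le> c + L * (c / (1 - L))" using Suc L by (intro add_left_mono mult_left_mono)
  also have "\<dots> = c / (1 - L)" using L by (simp add: field_simps)
  finally show ?case .
qed

text \<open>In \<open>T = (G T - G 0) + G 0\<close> the first summand is absorbed by the left-hand side. For the mesh map,
  \<open>G 0\<close> is the first iterate of the limit map evaluated on the mesh, which is bounded independently of
  the mesh.\<close>

lemma tensor_norm_fixed_point:
  fixes T :: "('o::finite, 'v::finite) amplitude"
  assumes K: "finite K" "K \<noteq> {}" and L: "L < 1" and T: "G T = T"
    and lip: "tensor_norm K (G T - G 0) \<le> L * tensor_norm K (T - 0)"
  shows "tensor_norm K T \<le> tensor_norm K (G 0) / (1 - L)"
proof -
  have "tensor_norm K T \<le> tensor_norm K (T - G 0) + tensor_norm K (G 0)"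
    using tensor_norm_triangle[OF K, of T 0 "G 0"] by simp
  also have "\<dots> \<le> L * tensor_norm K T + tensor_norm K (G 0)" using lip T by simp
  finally show ?thesis using L by (simp add: field_simps)
qed

theorem corollary3:
  fixes S :: "('o::finite, 'v::finite) crystal"
    and s :: "nat \<Rightarrow> real ^ 3"
    and t_star :: "('o, 'v) amplitude"
    and T_star :: "nat \<Rightarrow> ('o, 'v) amplitude"
    and B_tdl :: "('o, 'v) amplitude set"
    and B_fin :: "nat \<Rightarrow> ('o, 'v) amplitude set"
    and L :: real
  assumes system: "insulator S"
    and t_star: "t_star \<in> T_families S" "ccd_tdl S t_star = t_star"
      "\<And>t. t \<in> T_families S \<Longrightarrow> ccd_tdl S t = t \<Longrightarrow> t = t_star"
    and T_star: "\<forall>\<^sub>F n in sequentially.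
        T_star n \<in> mesh_tensors (mesh S s n) \<and>
        ccd_finite S (mesh S s n) (T_star n) = T_star n \<and>
        (\<forall>T \<in> mesh_tensors (mesh S s n). ccd_finite S (mesh S s n) T = T \<longrightarrow> T = T_star n)"
    and T_iteration: "\<forall>\<^sub>F n in sequentially.
        (\<lambda>m. tensor_norm (mesh S s n) ((ccd_finite S (mesh S s n) ^^ m) 0 - T_star n)) \<longlonglongrightarrow> 0"
    and t_iteration: "(\<lambda>m. Linf_norm S ((ccd_tdl S ^^ m) 0 - t_star)) \<longlonglongrightarrow> 0"
    and L: "L < 1"
    and contraction_tdl: "B_tdl \<subseteq> T_families S" "t_star \<in> B_tdl" "0 \<in> B_tdl"
      "\<And>t. t \<in> B_tdl \<Longrightarrow> ccd_tdl S t \<in> B_tdl"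
      "\<And>t u. t \<in> B_tdl \<Longrightarrow> u \<in> B_tdl \<Longrightarrow>
         Linf_norm S (ccd_tdl S t - ccd_tdl S u) \<le> ereal L * Linf_norm S (t - u)"
    and contraction_fin: "\<forall>\<^sub>F n in sequentially.
        B_fin n \<subseteq> mesh_tensors (mesh S s n) \<and> T_star n \<in> B_fin n \<and> 0 \<in> B_fin n \<and>
        (\<forall>T \<in> B_fin n. ccd_finite S (mesh S s n) T \<in> B_fin n) \<and>
        (\<forall>T \<in> B_fin n. \<forall>U \<in> B_fin n.
           tensor_norm (mesh S s n) (ccd_finite S (mesh S s n) T - ccd_finite S (mesh S s n) U)
             \<le> L * tensor_norm (mesh S s n) (T - U))"
    and evaluation: "\<forall>\<^sub>F n in sequentially. on_mesh (mesh S s n) ` B_tdl \<subseteq> B_fin n"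
    and consistency: "\<exists>C. \<forall>\<^sub>F n in sequentially. \<forall>m>0.
        tensor_norm (mesh S s n)
          (on_mesh (mesh S s n) (ccd_tdl S ((ccd_tdl S ^^ m) 0))
           - ccd_finite S (mesh S s n) (on_mesh (mesh S s n) ((ccd_tdl S ^^ m) 0)))
        \<le> C * real (n ^ 3) powr (- 1 / 3)"
  shows "(\<lambda>n. norm (G_tdl S t_star - G_finite S (mesh S s n) (T_star n)))
           \<in> O(\<lambda>n. real (n ^ 3) powr (- 1 / 3))"
proof -
  interpret insulating_system S by unfold_locales (rule system)
  define t where "t = (\<lambda>m. (ccd_tdl S ^^ m) 0)"
  have tB: "t m \<in> B_tdl" for m
    unfolding t_def
  proof (induction m)
    case 0
    show ?case unfolding funpow.simps id_apply by (rule contraction_tdl(3))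
  qed (simp add: contraction_tdl(4))
  then have tT: "t m \<in> T_families S" for m using contraction_tdl(1) by blast
  have rate: "real (n ^ 3) powr (- 1 / 3) = 1 / real n" if "n > 0" for n
  proof -
    have "real (n ^ 3) = real n powr 3" using powr_realpow[of "real n" 3] that by simp
    then have "real (n ^ 3) powr (- 1 / 3) = (real n powr 3) powr (- 1 / 3)" by (rule arg_cong)
    also have "\<dots> = real n powr (- 1)" by (simp only: powr_powr) simp
    finally show ?thesis using that by (simp add: powr_minus_divide)
  qed
  \<comment> \<open>\<open>L\<close> may be negative, but inequalities are going to be multiplied by the contraction constant.\<close>
  define \<mu> where "\<mu> = max L 0"
  have \<mu>: "0 \<le> \<mu>" "\<mu> < 1" "L \<le> \<mu>" using L by (auto simp: \<mu>_def)
  obtain C0 where C0: "\<forall>\<^sub>F n in sequentially. \<forall>m>0.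
        tensor_norm (mesh S s n) (on_mesh (mesh S s n) (ccd_tdl S (t m))
           - ccd_finite S (mesh S s n) (on_mesh (mesh S s n) (t m))) \<le> C0 * real (n ^ 3) powr (- 1 / 3)"
    using consistency unfolding t_def by blast
  define C where "C = \<bar>C0\<bar>"
  obtain Q where Q: "\<And>n. n > 0 \<Longrightarrow> norm (G_tdl S t_star - G_finite S (mesh S s n) t_star) \<le> Q / n"
    using G_tdl_quadrature_error[OF t_star(1)] by blast
  obtain B where B: "B > 0" "\<And>i j a b z. norm (W_density i j a b z) \<le> B" using W_density_bounded by blast
  have bounded: "\<exists>D\<ge>0. \<forall>i j a b z. norm (u i j a b z) \<le> D" if "u \<in> T_families S" for u
  proof -
    have "\<exists>D. \<forall>z. norm (u i j a b z) \<le> D" for i j a b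
      using that by (intro T_space_bounded) (simp add: T_families_def)
    then obtain D where D: "\<And>i j a b z. norm (u i j a b z) \<le> D i j a b" by metis
    define M where "M = (\<Sum>(i, j, a, b)\<in>UNIV. \<bar>D i j a b\<bar>)"
    have "D i j a b \<le> M" for i j a b
      using member_le_sum[of "(i, j, a, b)" UNIV "\<lambda>(i, j, a, b). \<bar>D i j a b\<bar>"] by (auto simp: M_def)
    then have "norm (u i j a b z) \<le> M" for i j a b z using D order_trans by blast
    moreover have "M \<ge> 0" unfolding M_def by (intro sum_nonneg) auto
    ultimately show ?thesis by blast
  qed
  obtain D0 where D0: "D0 \<ge> 0" "\<And>i j a b z. norm (t_star i j a b z) \<le> D0" using bounded[OF t_star(1)] by blast
  obtain D1 where D1: "D1 \<ge> 0" "\<And>i j a b z. norm (t 1 i j a b z) \<le> D1" using bounded[OF tT[of 1]] by blast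
  define D where "D = D0 + D1 / (1 - \<mu>)"
  have D: "D \<ge> 0" using D0 D1 \<mu> by (simp add: D_def)
  define E where "E = real (CARD('o) ^ 2 * CARD('v) ^ 2) * B"
  have E: "E \<ge> 0" using B by (simp add: E_def)
  have pointwise: "(\<lambda>m. norm (t m i j a b z - t_star i j a b z)) \<longlonglongrightarrow> 0" if z: "0 < diag_dist z" for i j a b z
  proof -
    have "(\<lambda>m. ereal (norm (t m i j a b z - t_star i j a b z))) \<longlonglongrightarrow> 0"
    proof (rule tendsto_sandwich[OF _ _ tendsto_const])
      show "\<forall>\<^sub>F m in sequentially. ereal (norm (t m i j a b z - t_star i j a b z)) \<le> Linf_norm S (t m - t_star)"
        by (intro always_eventually allI T_families_le_Linf_norm tT t_star(1) z)
      show "(\<lambda>m. Linf_norm S (t m - t_star)) \<longlonglongrightarrow> 0" using t_iteration by (simp add: t_def)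
    qed simp
    then show ?thesis by (simp add: zero_ereal_def)
  qed
  have "\<forall>\<^sub>F n in sequentially. norm (G_tdl S t_star - G_finite S (mesh S s n) (T_star n))
      \<le> (\<bar>Q\<bar> + E * (C / (1 - \<mu>) + D)) * norm (real (n ^ 3) powr (- 1 / 3))"
    using T_star T_iteration contraction_fin evaluation C0 eventually_gt_at_top[of 0]
  proof eventually_elim
    case (elim n)
    let ?K = "mesh S s n" and ?T = "\<lambda>m. (ccd_finite S (mesh S s n) ^^ m) 0"
    note n = \<open>0 < n\<close>
    have K: "finite ?K" "?K \<noteq> {}" using finite_mesh[OF n] mesh_nonempty[OF n] by auto
    have lip: "tensor_norm ?K (ccd_finite S ?K T - ccd_finite S ?K U) \<le> \<mu> * tensor_norm ?K (T - U)"
      if "T \<in> B_fin n" "U \<in> B_fin n" for T U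
    proof -
      have "tensor_norm ?K (ccd_finite S ?K T - ccd_finite S ?K U) \<le> L * tensor_norm ?K (T - U)"
        using elim that by blast
      also have "\<dots> \<le> \<mu> * tensor_norm ?K (T - U)"
        by (intro mult_right_mono \<mu>(3) tensor_norm_nonneg K)
      finally show ?thesis .
    qed
    define \<epsilon> where "\<epsilon> = C / real n / (1 - \<mu>)"
    have \<epsilon>0: "\<epsilon> \<ge> 0" using \<mu> by (simp add: \<epsilon>_def C_def)
    have err: "tensor_norm ?K (on_mesh ?K (t m) - ?T m) \<le> \<epsilon>" for m
      unfolding \<epsilon>_def t_def
    proof (rule iteration_error[OF K \<mu>(1,2), where B = "B_fin n"])
      show "on_mesh ?K ((ccd_tdl S ^^ m) 0) \<in> B_fin n" for m
        using elim(4) tB[of m] by (auto simp: t_def)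
      show "tensor_norm ?K (on_mesh ?K (ccd_tdl S ((ccd_tdl S ^^ m) 0))
          - ccd_finite S ?K (on_mesh ?K ((ccd_tdl S ^^ m) 0))) \<le> C / real n" for m
      \<comment> \<open>Consistency is assumed for positive \<open>m\<close>; for \<open>m = 0\<close> the residual vanishes.\<close>
      proof (cases "m = 0")
        case True
        have "on_mesh ?K 0 = (0 :: ('o, 'v) amplitude)" by (simp add: on_mesh_def fun_eq_iff)
        then have "tensor_norm ?K (on_mesh ?K (ccd_tdl S ((ccd_tdl S ^^ m) 0))
          - ccd_finite S ?K (on_mesh ?K ((ccd_tdl S ^^ m) 0))) \<le> 0"
          using True by (intro tensor_norm_leI K) (simp add: on_mesh_ccd_tdl_zero)
        then show ?thesis by (rule order_trans) (simp add: C_def)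
      next
        case False
        then have "tensor_norm ?K (on_mesh ?K (ccd_tdl S (t m)) - ccd_finite S ?K (on_mesh ?K (t m))) \<le> C0 * (1 / n)"
          using elim(5) rate[OF n] by simp
        also have "\<dots> \<le> C / n" by (simp add: C_def divide_right_mono)
        finally show ?thesis by (simp add: t_def)
      qed
      show "0 \<in> B_fin n" using elim(3) by blast
      show "ccd_finite S ?K T \<in> B_fin n" if "T \<in> B_fin n" for T using elim(3) that by blast
    qed (simp_all add: lip C_def)
    have off: "norm (t_star i j a b z - T_star n i j a b z) \<le> \<epsilon>"
      if z: "z \<in> ?K \<times> ?K \<times> ?K" "0 < diag_dist z" for i j a b z
    proof (rule tendsto_lowerbound)
      let ?x = "\<lambda>m. norm (t m i j a b z - t_star i j a b z) + \<epsilon> + tensor_norm ?K (?T m - T_star n)"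
      have "?x \<longlonglongrightarrow> 0 + \<epsilon> + 0" using elim(2) pointwise[OF z(2)] by (intro tendsto_intros)
      then show "?x \<longlonglongrightarrow> \<epsilon>" by simp
      have "norm (t_star i j a b z - T_star n i j a b z) \<le> ?x m" for m
      proof -
        have "norm (t m i j a b z - ?T m i j a b z) \<le> \<epsilon>"
          using norm_le_tensor_norm[OF K(1) z(1), of "on_mesh ?K (t m) - ?T m" i j a b] err[of m] z(1)
          by (simp add: on_mesh_def)
        moreover have "norm (?T m i j a b z - T_star n i j a b z) \<le> tensor_norm ?K (?T m - T_star n)"
          using norm_le_tensor_norm[OF K(1) z(1), of "?T m - T_star n" i j a b] by simp
        moreover have "norm (t_star i j a b z - T_star n i j a b z)
            \<le> norm (t m i j a b z - t_star i j a b z) + norm (t m i j a b z - ?T m i j a b z)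
              + norm (?T m i j a b z - T_star n i j a b z)"
          by norm
        ultimately show ?thesis by linarith
      qed
      then show "\<forall>\<^sub>F m in sequentially. norm (t_star i j a b z - T_star n i j a b z) \<le> ?x m" by simp
    qed simp
    have Tbound: "tensor_norm ?K (T_star n) \<le> D1 / (1 - \<mu>)"
    proof -
      have "tensor_norm ?K (T_star n) \<le> tensor_norm ?K (ccd_finite S ?K 0) / (1 - \<mu>)"
      proof (rule tensor_norm_fixed_point[OF K \<mu>(2)])
        show "ccd_finite S ?K (T_star n) = T_star n" using elim(1) by blast
        show "tensor_norm ?K (ccd_finite S ?K (T_star n) - ccd_finite S ?K 0) \<le> \<mu> * tensor_norm ?K (T_star n - 0)"
          using elim(3) by (intro lip) blast+
      qed
      also have "tensor_norm ?K (ccd_finite S ?K 0) \<le> D1"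
        using D1(2) by (intro tensor_norm_leI K) (simp add: on_mesh_ccd_tdl_zero[symmetric] on_mesh_def t_def)
      then have "tensor_norm ?K (ccd_finite S ?K 0) / (1 - \<mu>) \<le> D1 / (1 - \<mu>)"
        using \<mu> by (intro divide_right_mono) auto
      finally show ?thesis .
    qed
    have diag: "norm (t_star i j a b z - T_star n i j a b z) \<le> D" if z: "z \<in> ?K \<times> ?K \<times> ?K" for i j a b z
      using norm_triangle_ineq4[of "t_star i j a b z" "T_star n i j a b z"] D0(2)[of i j a b z]
        norm_le_tensor_norm[OF K(1) z, of "T_star n" i j a b] Tbound by (simp add: D_def)
    have "norm (G_finite S ?K t_star - G_finite S ?K (T_star n)) \<le> E * (\<epsilon> + D / real n ^ 3)"
      unfolding E_def using B by (intro G_finite_diff_le n \<epsilon>0 D off diag) auto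
    also have "\<dots> \<le> E * (\<epsilon> + D / real n)"
    proof (intro mult_left_mono add_left_mono E divide_left_mono D)
      show "real n \<le> real n ^ 3" using n by (intro self_le_power) auto
    qed (use n in auto)
    also have "\<dots> = E * (C / (1 - \<mu>) + D) / real n"
      by (simp add: \<epsilon>_def algebra_simps add_divide_distrib)
    finally have fin: "norm (G_finite S ?K t_star - G_finite S ?K (T_star n)) \<le> E * (C / (1 - \<mu>) + D) / real n" .
    have "norm (G_tdl S t_star - G_finite S ?K (T_star n))
        \<le> norm (G_tdl S t_star - G_finite S ?K t_star) + norm (G_finite S ?K t_star - G_finite S ?K (T_star n))"
      by norm
    also have "\<dots> \<le> \<bar>Q\<bar> / real n + E * (C / (1 - \<mu>) + D) / real n"
    proof (rule add_mono[OF _ fin])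
      have "Q / real n \<le> \<bar>Q\<bar> / real n" by (intro divide_right_mono) auto
      then show "norm (G_tdl S t_star - G_finite S ?K t_star) \<le> \<bar>Q\<bar> / real n" using Q[OF n] by linarith
    qed
    also have "\<dots> = (\<bar>Q\<bar> + E * (C / (1 - \<mu>) + D)) * norm (real (n ^ 3) powr (- 1 / 3))"
      unfolding rate[OF n] by (simp add: add_divide_distrib)
    finally show ?case .
  qed
  then show ?thesis by (intro bigoI) simp
qed

end
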